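(* Let $k$ be a field. The assignment $$Z:\mathcal{A}lg(k)\longrightarrow \mathbf{CAlg}(k)$$ which sends an algebra $A$ to its centre $Z(A)$ and an algebra homomorphism $f:A\to B$ to the cospan $$Z(B)\xrightarrow{\ \iota\ }Z_{A,B}(f)\xleftarrow{\ f|_{Z(A)}\ }Z(A)$$ from $Z(A)$ to $Z(B)$, where $\iota$ is the inclusion, defines a lax functor. Its unit transformations are identities and its multiplication transformations are given, for algebra homomorphisms $A\xrightarrow{f}B\xrightarrow{g}C$, by $$m_{g,f}:Z_{B,C}(g)\otimes_{Z(B)}Z_{A,B}(f)\longrightarrow Z_{A,C}(g\circ f),\qquad u\otimes_{Z(B)}v\longmapsto u\cdot g(v).$$
   Context: All algebras are unital associative algebras over $k$, and algebra homomorphisms are unital. $\mathcal{A}lg(k)$ is the category of algebras and algebra homomorphisms, regarded as a bicategory with only identity 2-morphisms (which $Z$ sends to identity 2-morphisms). $Z(A)$ is the centre of $A$, and for $f:A\to B$ the centraliser is $Z_{A,B}(f)=\{b\in B\mid f(a)b=bf(a)\ \text{for all } a\in A\}$. A *cospan (between commutative algebras)* $T:A\to B$ is a tuple $(B,\beta,T,\alpha,A)$ with $A,B$ commutative algebras, $T$ an algebra, and $\beta:B\to T$, $\alpha:A\to T$ algebra homomorphisms with images in the centre $Z(T)$. A morphism of cospans from $(B,\beta,T,\alpha,A)$ to $(B,\beta',T',\alpha',A)$ is an algebra homomorphism $f:T\to T'$ with $f\circ\beta=\beta'$ and $f\circ\alpha=\alpha'$. Cospans $A\to B$ and their morphisms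 form a category $\mathcal{C}osp(A,B)$. The composite of $(B,\beta,S,\alpha,A):A\to B$ and $(C,\gamma,T,\beta',B):B\to C$ is $T\otimes_B S$ with multiplication $(t\otimes_B s)(t'\otimes_B s')=(tt')\otimes_B(ss')$ and homomorphisms $c\mapsto\gamma(c)\otimes_B1$, $a\mapsto1\otimes_B\alpha(a)$; on morphisms the composition is $(g,f)\mapsto g\otimes_B f$. The bicategory $\mathbf{CAlg}(k)$ has commutative algebras as objects, $\mathcal{C}osp(A,B)$ as category of morphisms from $A$ to $B$, composition functors $\mathcal{C}osp(B,C)\times\mathcal{C}osp(A,B)\to\mathcal{C}osp(A,C)$ given on cospans by $(T,S)\mapsto T\otimes_B S$ and on morphisms of cospans by $(g,f)\mapsto g\otimes_B f$, identities $(A,\mathrm{id},A,\mathrm{id},A)$, and the standard associativity and unit isomorphisms of tensor products. A lax functor $\mathbf F$ between bicategories consists of a map on objects, functors on morphism categories, and natural unit 2-morphisms $\mathbf 1_{F(A)}\to\mathbf F(\mathbf 1_A)$ and multiplication 2-morphisms $\mathbf F(S)\circ\mathbf F(T)\to\mathbf F(S\circ T)$ (not necessarily invertible), satisfying the usual associativity and unit coherence conditions. *)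

theory Defs
  imports "HOL-Algebra.Module" "HOL-Algebra.Free_Abelian_Groups" "HOL-Library.Infinite_Typeclass"
begin

section \<open>Bicategories and lax functors\<close>

text \<open>
  Arrows (1-cells) and cells (2-cells) carry their source and target, so that the morphism
  category from \<open>A\<close> to \<open>B\<close> has the objects \<open>hom1 C A B\<close> and, between two of these, the
  morphisms \<open>hom2 C f g\<close>. All operations are total functions of which only the values on
  composable arguments matter.
\<close>

record ('o, 'm, 'c) bicat =
  objs :: "'o set"
  arrs :: "'m set"
  asrc :: "'m \<Rightarrow> 'o"
  atrg :: "'m \<Rightarrow> 'o"
  cells :: "'c set"
  cdom :: "'c \<Rightarrow> 'm"
  ccod :: "'c \<Rightarrow> 'm"
  id1 :: "'o \<Rightarrow> 'm"
  comp1 :: "'m \<Rightarrow> 'm \<Rightarrow> 'm"  (infixr \<open>\<diamondop>\<index>\<close> 70)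
  id2 :: "'m \<Rightarrow> 'c"
  vcomp :: "'c \<Rightarrow> 'c \<Rightarrow> 'c"  (infixr \<open>\<bullet>\<index>\<close> 55)
  hcomp :: "'c \<Rightarrow> 'c \<Rightarrow> 'c"  (infixr \<open>\<star>\<index>\<close> 65)
  associator :: "'m \<Rightarrow> 'm \<Rightarrow> 'm \<Rightarrow> 'c"
  lunitor :: "'m \<Rightarrow> 'c"
  runitor :: "'m \<Rightarrow> 'c"

definition hom1 :: "('o, 'm, 'c) bicat \<Rightarrow> 'o \<Rightarrow> 'o \<Rightarrow> 'm set" where
  "hom1 C A B = {f \<in> arrs C. asrc C f = A \<and> atrg C f = B}"

definition hom2 :: "('o, 'm, 'c) bicat \<Rightarrow> 'm \<Rightarrow> 'm \<Rightarrow> 'c set" where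
  "hom2 C f g = {\<sigma> \<in> cells C. cdom C \<sigma> = f \<and> ccod C \<sigma> = g}"

definition iso2 :: "('o, 'm, 'c) bicat \<Rightarrow> 'm \<Rightarrow> 'm \<Rightarrow> 'c set" where
  "iso2 C f g = {\<sigma> \<in> hom2 C f g. \<exists>\<tau> \<in> hom2 C g f.
     vcomp C \<tau> \<sigma> = id2 C f \<and> vcomp C \<sigma> \<tau> = id2 C g}"

locale bicategory =
  fixes C :: "('o, 'm, 'c) bicat" (structure)
  assumes arr_objs: "f \<in> arrs C \<Longrightarrow> asrc C f \<in> objs C \<and> atrg C f \<in> objs C"
    and cell_arrs: "\<sigma> \<in> cells C \<Longrightarrow> cdom C \<sigma> \<in> arrs C \<and> ccod C \<sigma> \<in> arrs C"
    and cell_parallel: "\<sigma> \<in> cells C \<Longrightarrow>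
      asrc C (cdom C \<sigma>) = asrc C (ccod C \<sigma>) \<and> atrg C (cdom C \<sigma>) = atrg C (ccod C \<sigma>)"
    \<comment> \<open>morphism categories\<close>
    and id2_hom: "f \<in> arrs C \<Longrightarrow> id2 C f \<in> hom2 C f f"
    and vcomp_hom: "\<lbrakk>\<sigma> \<in> hom2 C f g; \<tau> \<in> hom2 C g h\<rbrakk> \<Longrightarrow> \<tau> \<bullet> \<sigma> \<in> hom2 C f h"
    and vcomp_id_left: "\<sigma> \<in> hom2 C f g \<Longrightarrow> id2 C g \<bullet> \<sigma> = \<sigma>"
    and vcomp_id_right: "\<sigma> \<in> hom2 C f g \<Longrightarrow> \<sigma> \<bullet> id2 C f = \<sigma>"
    and vcomp_assoc: "\<lbrakk>\<sigma> \<in> hom2 C f g; \<tau> \<in> hom2 C g h; \<upsilon> \<in> hom2 C h i\<rbrakk> \<Longrightarrow>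
      (\<upsilon> \<bullet> \<tau>) \<bullet> \<sigma> = \<upsilon> \<bullet> (\<tau> \<bullet> \<sigma>)"
    \<comment> \<open>identities and composition functors\<close>
    and id1_hom: "A \<in> objs C \<Longrightarrow> id1 C A \<in> hom1 C A A"
    and comp1_hom: "\<lbrakk>f \<in> hom1 C A B; g \<in> hom1 C B D\<rbrakk> \<Longrightarrow> g \<diamondop> f \<in> hom1 C A D"
    and hcomp_hom: "\<lbrakk>f \<in> hom1 C A B; g \<in> hom1 C B D; \<sigma> \<in> hom2 C f f'; \<tau> \<in> hom2 C g g'\<rbrakk> \<Longrightarrow>
      \<tau> \<star> \<sigma> \<in> hom2 C (g \<diamondop> f) (g' \<diamondop> f')"
    and hcomp_id: "\<lbrakk>f \<in> hom1 C A B; g \<in> hom1 C B D\<rbrakk> \<Longrightarrow> id2 C g \<star> id2 C f = id2 C (g \<diamondop> f)"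
    and interchange: "\<lbrakk>f \<in> hom1 C A B; g \<in> hom1 C B D; \<sigma> \<in> hom2 C f f'; \<sigma>' \<in> hom2 C f' f'';
        \<tau> \<in> hom2 C g g'; \<tau>' \<in> hom2 C g' g''\<rbrakk> \<Longrightarrow>
      (\<tau>' \<bullet> \<tau>) \<star> (\<sigma>' \<bullet> \<sigma>) = (\<tau>' \<star> \<sigma>') \<bullet> (\<tau> \<star> \<sigma>)"
    \<comment> \<open>associativity and unit isomorphisms\<close>
    and associator_iso: "\<lbrakk>f \<in> hom1 C A B; g \<in> hom1 C B D; h \<in> hom1 C D E\<rbrakk> \<Longrightarrow>
      associator C h g f \<in> iso2 C ((h \<diamondop> g) \<diamondop> f) (h \<diamondop> (g \<diamondop> f))"
    and associator_natural: "\<lbrakk>f \<in> hom1 C A B; g \<in> hom1 C B D; h \<in> hom1 C D E;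
        \<rho> \<in> hom2 C f f'; \<sigma> \<in> hom2 C g g'; \<tau> \<in> hom2 C h h'\<rbrakk> \<Longrightarrow>
      associator C h' g' f' \<bullet> ((\<tau> \<star> \<sigma>) \<star> \<rho>) = (\<tau> \<star> (\<sigma> \<star> \<rho>)) \<bullet> associator C h g f"
    and lunitor_iso: "f \<in> hom1 C A B \<Longrightarrow> lunitor C f \<in> iso2 C (id1 C B \<diamondop> f) f"
    and lunitor_natural: "\<lbrakk>f \<in> hom1 C A B; \<sigma> \<in> hom2 C f f'\<rbrakk> \<Longrightarrow>
      lunitor C f' \<bullet> (id2 C (id1 C B) \<star> \<sigma>) = \<sigma> \<bullet> lunitor C f"
    and runitor_iso: "f \<in> hom1 C A B \<Longrightarrow> runitor C f \<in> iso2 C (f \<diamondop> id1 C A) f"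
    and runitor_natural: "\<lbrakk>f \<in> hom1 C A B; \<sigma> \<in> hom2 C f f'\<rbrakk> \<Longrightarrow>
      runitor C f' \<bullet> (\<sigma> \<star> id2 C (id1 C A)) = \<sigma> \<bullet> runitor C f"
    \<comment> \<open>coherence\<close>
    and pentagon: "\<lbrakk>f \<in> hom1 C A B; g \<in> hom1 C B D; h \<in> hom1 C D E; i \<in> hom1 C E G\<rbrakk> \<Longrightarrow>
      (id2 C i \<star> associator C h g f) \<bullet> associator C i (h \<diamondop> g) f \<bullet> (associator C i h g \<star> id2 C f)
        = associator C i h (g \<diamondop> f) \<bullet> associator C (i \<diamondop> h) g f"
    and triangle: "\<lbrakk>f \<in> hom1 C A B; g \<in> hom1 C B D\<rbrakk> \<Longrightarrow>
      (id2 C g \<star> lunitor C f) \<bullet> associator C g (id1 C B) f = runitor C g \<star> id2 C f"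

record ('o, 'm, 'c, 'p, 'n, 'd) lax_data =
  omap :: "'o \<Rightarrow> 'p"
  amap :: "'m \<Rightarrow> 'n"
  cmap :: "'c \<Rightarrow> 'd"
  lax_unit :: "'o \<Rightarrow> 'd"
  lax_mult :: "'m \<Rightarrow> 'm \<Rightarrow> 'd"

text \<open>
  Naturality of the unit is a condition on the terminal category only, hence empty.
\<close>

locale lax_functor = D: bicategory D + E: bicategory E
  for D :: "('o, 'm, 'c) bicat" and E :: "('p, 'n, 'd) bicat" +
  fixes F :: "('o, 'm, 'c, 'p, 'n, 'd) lax_data"
  assumes omap_objs: "A \<in> objs D \<Longrightarrow> omap F A \<in> objs E"
    and amap_hom: "f \<in> hom1 D A B \<Longrightarrow> amap F f \<in> hom1 E (omap F A) (omap F B)"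
    and cmap_hom: "\<sigma> \<in> hom2 D f g \<Longrightarrow> cmap F \<sigma> \<in> hom2 E (amap F f) (amap F g)"
    and cmap_id2: "f \<in> arrs D \<Longrightarrow> cmap F (id2 D f) = id2 E (amap F f)"
    and cmap_vcomp: "\<lbrakk>\<sigma> \<in> hom2 D f g; \<tau> \<in> hom2 D g h\<rbrakk> \<Longrightarrow>
      cmap F (\<tau> \<bullet>\<^bsub>D\<^esub> \<sigma>) = cmap F \<tau> \<bullet>\<^bsub>E\<^esub> cmap F \<sigma>"
    and lax_unit_hom: "A \<in> objs D \<Longrightarrow>
      lax_unit F A \<in> hom2 E (id1 E (omap F A)) (amap F (id1 D A))"
    and lax_mult_hom: "\<lbrakk>f \<in> hom1 D A B; g \<in> hom1 D B C\<rbrakk> \<Longrightarrow>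
      lax_mult F g f \<in> hom2 E (amap F g \<diamondop>\<^bsub>E\<^esub> amap F f) (amap F (g \<diamondop>\<^bsub>D\<^esub> f))"
    and lax_mult_natural: "\<lbrakk>f \<in> hom1 D A B; g \<in> hom1 D B C; \<sigma> \<in> hom2 D f f'; \<tau> \<in> hom2 D g g'\<rbrakk> \<Longrightarrow>
      lax_mult F g' f' \<bullet>\<^bsub>E\<^esub> (cmap F \<tau> \<star>\<^bsub>E\<^esub> cmap F \<sigma>) = cmap F (\<tau> \<star>\<^bsub>D\<^esub> \<sigma>) \<bullet>\<^bsub>E\<^esub> lax_mult F g f"
    and lax_assoc: "\<lbrakk>f \<in> hom1 D A B; g \<in> hom1 D B C; h \<in> hom1 D C G\<rbrakk> \<Longrightarrow>
      cmap F (associator D h g f) \<bullet>\<^bsub>E\<^esub> lax_mult F (h \<diamondop>\<^bsub>D\<^esub> g) f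
          \<bullet>\<^bsub>E\<^esub> (lax_mult F h g \<star>\<^bsub>E\<^esub> id2 E (amap F f))
        = lax_mult F h (g \<diamondop>\<^bsub>D\<^esub> f) \<bullet>\<^bsub>E\<^esub> (id2 E (amap F h) \<star>\<^bsub>E\<^esub> lax_mult F g f)
          \<bullet>\<^bsub>E\<^esub> associator E (amap F h) (amap F g) (amap F f)"
    and lax_left_unit: "f \<in> hom1 D A B \<Longrightarrow>
      cmap F (lunitor D f) \<bullet>\<^bsub>E\<^esub> lax_mult F (id1 D B) f \<bullet>\<^bsub>E\<^esub> (lax_unit F B \<star>\<^bsub>E\<^esub> id2 E (amap F f))
        = lunitor E (amap F f)"
    and lax_right_unit: "f \<in> hom1 D A B \<Longrightarrow>
      cmap F (runitor D f) \<bullet>\<^bsub>E\<^esub> lax_mult F f (id1 D A) \<bullet>\<^bsub>E\<^esub> (id2 E (amap F f) \<star>\<^bsub>E\<^esub> lax_unit F A)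
        = runitor E (amap F f)"


section \<open>Algebras, centres and centralisers\<close>

text \<open>
  The locale \<^locale>\<open>algebra\<close> of the library is about \<^emph>\<open>commutative\<close> algebras; this is its
  noncommutative counterpart. The zero algebra is allowed.
\<close>

locale assoc_algebra = Module.module k A + ring A for k (structure) and A (structure) +
  assumes smult_mult_left:
      "\<lbrakk>c \<in> carrier k; x \<in> carrier A; y \<in> carrier A\<rbrakk> \<Longrightarrow>
        (c \<odot>\<^bsub>A\<^esub> x) \<otimes>\<^bsub>A\<^esub> y = c \<odot>\<^bsub>A\<^esub> (x \<otimes>\<^bsub>A\<^esub> y)"
    and smult_mult_right:
      "\<lbrakk>c \<in> carrier k; x \<in> carrier A; y \<in> carrier A\<rbrakk> \<Longrightarrow>
        x \<otimes>\<^bsub>A\<^esub> (c \<odot>\<^bsub>A\<^esub> y) = c \<odot>\<^bsub>A\<^esub> (x \<otimes>\<^bsub>A\<^esub> y)"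

text \<open>
  Homomorphisms are normalised to be \<^const>\<open>undefined\<close> outside the carrier, so that they are
  equal iff they agree on the carrier.
\<close>

definition alg_hom :: "'k ring \<Rightarrow> ('k, 'a) module \<Rightarrow> ('k, 'b) module \<Rightarrow> ('a \<Rightarrow> 'b) set" where
  "alg_hom k A B = {f \<in> ring_hom A B \<inter> extensional (carrier A).
     \<forall>c \<in> carrier k. \<forall>x \<in> carrier A. f (c \<odot>\<^bsub>A\<^esub> x) = c \<odot>\<^bsub>B\<^esub> f x}"

definition centre :: "('k, 'u) module \<Rightarrow> 'u set" where
  "centre A = {z \<in> carrier A. \<forall>a \<in> carrier A. a \<otimes>\<^bsub>A\<^esub> z = z \<otimes>\<^bsub>A\<^esub> a}"

definition centraliser :: "('k, 'u) module \<Rightarrow> ('k, 'u) module \<Rightarrow> ('u \<Rightarrow> 'u) \<Rightarrow> 'u set" where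
  "centraliser A B f = {b \<in> carrier B. \<forall>a \<in> carrier A. f a \<otimes>\<^bsub>B\<^esub> b = b \<otimes>\<^bsub>B\<^esub> f a}"

definition centre_alg :: "('k, 'u) module \<Rightarrow> ('k, 'u) module" where
  "centre_alg A = A\<lparr>carrier := centre A\<rparr>"

definition centraliser_alg ::
    "('k, 'u) module \<Rightarrow> ('k, 'u) module \<Rightarrow> ('u \<Rightarrow> 'u) \<Rightarrow> ('k, 'u) module" where
  "centraliser_alg A B f = B\<lparr>carrier := centraliser A B f\<rparr>"


section \<open>The bicategory of algebras\<close>

text \<open>
  An element type \<open>'u\<close> of class \<^class>\<open>infinite\<close> takes the role of a universe: the objects
  are the algebras whose carrier is a set over \<open>'u\<close>. Up to isomorphism this leaves out only
  algebras of larger cardinality than \<open>'u\<close>, and \<open>'u\<close> is arbitrary.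
\<close>

record ('k, 'u) alg_arrow =
  hsrc :: "('k, 'u) module"
  hfun :: "'u \<Rightarrow> 'u"
  htrg :: "('k, 'u) module"

definition alg_id :: "('k, 'u) module \<Rightarrow> ('k, 'u) alg_arrow" where
  "alg_id A = \<lparr>hsrc = A, hfun = (\<lambda>x \<in> carrier A. x), htrg = A\<rparr>"

definition alg_comp :: "('k, 'u) alg_arrow \<Rightarrow> ('k, 'u) alg_arrow \<Rightarrow> ('k, 'u) alg_arrow" where
  "alg_comp g f =
     \<lparr>hsrc = hsrc f, hfun = compose (carrier (hsrc f)) (hfun g) (hfun f), htrg = htrg g\<rparr>"

text \<open>
  All 2-cells are identities; the identity 2-cell of an arrow is represented by the arrow itself.
\<close>

definition Alg :: "'k ring \<Rightarrow>
    (('k, 'u::infinite) module, ('k, 'u) alg_arrow, ('k, 'u) alg_arrow) bicat" where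
  "Alg k = (let
      arrows = {f. assoc_algebra k (hsrc f) \<and> assoc_algebra k (htrg f)
                   \<and> hfun f \<in> alg_hom k (hsrc f) (htrg f)}
    in \<lparr>objs = {A. assoc_algebra k A},
        arrs = arrows, asrc = hsrc, atrg = htrg,
        cells = arrows, cdom = (\<lambda>f. f), ccod = (\<lambda>f. f),
        id1 = alg_id, comp1 = alg_comp,
        id2 = (\<lambda>f. f), vcomp = (\<lambda>\<tau> \<sigma>. \<sigma>), hcomp = alg_comp,
        associator = (\<lambda>h g f. alg_comp (alg_comp h g) f),
        lunitor = (\<lambda>f. f), runitor = (\<lambda>f. f)\<rparr>)"


section \<open>Tensor products\<close>

text \<open>
  Let \<open>r\<close> map \<open>B\<close> to \<open>T\<close> and \<open>l\<close> map \<open>B\<close> to \<open>S\<close>. The tensor product \<open>T \<otimes>\<^sub>B S\<close> is the free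
  abelian group on \<open>T \<times> S\<close> modulo the subgroup generated by the usual relations.
\<close>

definition tensor_rels :: "('k, 'u) module \<Rightarrow> ('k, 'u) module \<Rightarrow> ('u \<Rightarrow> 'u) \<Rightarrow>
    ('k, 'u) module \<Rightarrow> ('u \<Rightarrow> 'u) \<Rightarrow> (('u \<times> 'u) \<Rightarrow>\<^sub>0 int) set" where
  "tensor_rels B T r S l =
     {frag_of (t \<oplus>\<^bsub>T\<^esub> t', s) - frag_of (t, s) - frag_of (t', s) | t t' s.
        t \<in> carrier T \<and> t' \<in> carrier T \<and> s \<in> carrier S}
   \<union> {frag_of (t, s \<oplus>\<^bsub>S\<^esub> s') - frag_of (t, s) - frag_of (t, s') | t s s'.
        t \<in> carrier T \<and> s \<in> carrier S \<and> s' \<in> carrier S}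
   \<union> {frag_of (t \<otimes>\<^bsub>T\<^esub> r b, s) - frag_of (t, l b \<otimes>\<^bsub>S\<^esub> s) | t b s.
        t \<in> carrier T \<and> b \<in> carrier B \<and> s \<in> carrier S}"

definition tensor_coset :: "('k, 'u) module \<Rightarrow> ('k, 'u) module \<Rightarrow> ('u \<Rightarrow> 'u) \<Rightarrow>
    ('k, 'u) module \<Rightarrow> ('u \<Rightarrow> 'u) \<Rightarrow> (('u \<times> 'u) \<Rightarrow>\<^sub>0 int) \<Rightarrow> (('u \<times> 'u) \<Rightarrow>\<^sub>0 int) set" where
  "tensor_coset B T r S l x =
     (let G = free_Abelian_group (carrier T \<times> carrier S)
      in generate G (tensor_rels B T r S l) #>\<^bsub>G\<^esub> x)"

text \<open>The biadditive extensions of \<open>(t, s)(t', s') = (tt', ss')\<close> and of \<open>c(t, s) = (ct, s)\<close>.\<close>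

definition frag_mult :: "('k, 'u) module \<Rightarrow> ('k, 'u) module \<Rightarrow>
    (('u \<times> 'u) \<Rightarrow>\<^sub>0 int) \<Rightarrow> (('u \<times> 'u) \<Rightarrow>\<^sub>0 int) \<Rightarrow> (('u \<times> 'u) \<Rightarrow>\<^sub>0 int)" where
  "frag_mult T S x y =
     frag_extend (\<lambda>(t, s). frag_extend (\<lambda>(t', s'). frag_of (t \<otimes>\<^bsub>T\<^esub> t', s \<otimes>\<^bsub>S\<^esub> s')) y) x"

definition frag_smult :: "('k, 'u) module \<Rightarrow> 'k \<Rightarrow>
    (('u \<times> 'u) \<Rightarrow>\<^sub>0 int) \<Rightarrow> (('u \<times> 'u) \<Rightarrow>\<^sub>0 int)" where
  "frag_smult T c x = frag_extend (\<lambda>(t, s). frag_of (c \<odot>\<^bsub>T\<^esub> t, s)) x"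

text \<open>
  As usual for quotients, a union over all representatives stands for the common value that
  all representatives give.
\<close>

definition tensor_quot :: "('k, 'u) module \<Rightarrow> ('k, 'u) module \<Rightarrow> ('u \<Rightarrow> 'u) \<Rightarrow>
    ('k, 'u) module \<Rightarrow> ('u \<Rightarrow> 'u) \<Rightarrow> ('k, (('u \<times> 'u) \<Rightarrow>\<^sub>0 int) set) module" where
  "tensor_quot B T r S l =
     (let G = free_Abelian_group (carrier T \<times> carrier S);
          Q = G Mod generate G (tensor_rels B T r S l);
          cl = tensor_coset B T r S l
      in \<lparr>carrier = carrier Q,
          mult = (\<lambda>X Y. \<Union>x \<in> X. \<Union>y \<in> Y. cl (frag_mult T S x y)),
          one = cl (frag_of (\<one>\<^bsub>T\<^esub>, \<one>\<^bsub>S\<^esub>)),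
          ring.zero = one Q,
          add = mult Q,
          smult = (\<lambda>c X. \<Union>x \<in> X. cl (frag_smult T c x))\<rparr>)"

text \<open>
  To be an algebra over \<open>'u\<close> again, the quotient is transported along an injection of its
  carrier into \<open>'u\<close>. There is one, because \<open>'u\<close> is infinite; see below.
\<close>

definition encode :: "'v set \<Rightarrow> 'v \<Rightarrow> 'u" where
  "encode X = (SOME e. inj_on e X)"

definition transport :: "('v \<Rightarrow> 'u) \<Rightarrow> ('k, 'v) module \<Rightarrow> ('k, 'u) module" where
  "transport e M = (let d = inv_into (carrier M) e in
     \<lparr>carrier = e ` carrier M,
      mult = (\<lambda>x y. e (d x \<otimes>\<^bsub>M\<^esub> d y)),
      one = e \<one>\<^bsub>M\<^esub>,
      ring.zero = e \<zero>\<^bsub>M\<^esub>,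
      add = (\<lambda>x y. e (d x \<oplus>\<^bsub>M\<^esub> d y)),
      smult = (\<lambda>c x. e (c \<odot>\<^bsub>M\<^esub> d x))\<rparr>)"

definition tensor :: "('k, 'u::infinite) module \<Rightarrow> ('k, 'u) module \<Rightarrow> ('u \<Rightarrow> 'u) \<Rightarrow>
    ('k, 'u) module \<Rightarrow> ('u \<Rightarrow> 'u) \<Rightarrow> ('k, 'u) module" where
  "tensor B T r S l =
     transport (encode (carrier (tensor_quot B T r S l))) (tensor_quot B T r S l)"

definition pure_tensor :: "('k, 'u::infinite) module \<Rightarrow> ('k, 'u) module \<Rightarrow> ('u \<Rightarrow> 'u) \<Rightarrow>
    ('k, 'u) module \<Rightarrow> ('u \<Rightarrow> 'u) \<Rightarrow> 'u \<Rightarrow> 'u \<Rightarrow> 'u" where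
  "pure_tensor B T r S l t s =
     encode (carrier (tensor_quot B T r S l)) (tensor_coset B T r S l (frag_of (t, s)))"

lemma frags_lepoll:
  "(UNIV :: (('u::infinite \<times> 'u) \<Rightarrow>\<^sub>0 int) set) \<lesssim> (UNIV :: 'u set)"
proof -
  have inf: "infinite (UNIV :: 'u set)" by (rule infinite_UNIV)
  have "carrier (free_Abelian_group (UNIV :: ('u \<times> 'u) set)) \<approx> (UNIV :: ('u \<times> 'u) set)"
    using inf by (intro eqpoll_free_Abelian_group_infinite) (simp add: finite_prod)
  moreover have "carrier (free_Abelian_group (UNIV :: ('u \<times> 'u) set)) = UNIV"
    by auto
  moreover have "(UNIV :: ('u \<times> 'u) set) \<approx> (UNIV :: 'u set)"
    using card_of_Times_same_infinite[OF inf] by (simp add: eqpoll_iff_card_of_ordIso)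
  ultimately show ?thesis
    by (metis eqpoll_imp_lepoll eqpoll_trans)
qed

lemma inj_on_encode_tensor_quot:
  fixes B T S :: "('k, 'u::infinite) module" and r l :: "'u \<Rightarrow> 'u"
  defines "X \<equiv> carrier (tensor_quot B T r S l)"
  shows "inj_on (encode X :: _ \<Rightarrow> 'u) X"
proof -
  define G where "G = free_Abelian_group (carrier T \<times> carrier S)"
  define H where "H = generate G (tensor_rels B T r S l)"
  have "X = (\<lambda>x. H #>\<^bsub>G\<^esub> x) ` carrier G"
    unfolding X_def tensor_quot_def G_def H_def by (auto simp: Let_def FactGroup_def RCOSETS_def)
  then have "X \<lesssim> carrier G"
    by (simp add: image_lepoll)
  also have "carrier G \<lesssim> (UNIV :: (('u \<times> 'u) \<Rightarrow>\<^sub>0 int) set)"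
    by (simp add: subset_imp_lepoll)
  also note frags_lepoll
  finally obtain e :: "_ \<Rightarrow> 'u" where "inj_on e X"
    unfolding lepoll_def by blast
  then show ?thesis
    unfolding encode_def by (rule someI[of "\<lambda>e. inj_on e X"])
qed


section \<open>The bicategory of commutative algebras and cospans\<close>

record ('k, 'u) cospan =
  ctrg :: "('k, 'u) module"
  lleg :: "'u \<Rightarrow> 'u"
  apex :: "('k, 'u) module"
  rleg :: "'u \<Rightarrow> 'u"
  csrc :: "('k, 'u) module"

definition is_cospan :: "'k ring \<Rightarrow> ('k, 'u) cospan \<Rightarrow> bool" where
  "is_cospan k X \<longleftrightarrow>
     algebra k (csrc X) \<and> algebra k (ctrg X) \<and> assoc_algebra k (apex X)
   \<and> lleg X \<in> alg_hom k (ctrg X) (apex X) \<and> lleg X ` carrier (ctrg X) \<subseteq> centre (apex X)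
   \<and> rleg X \<in> alg_hom k (csrc X) (apex X) \<and> rleg X ` carrier (csrc X) \<subseteq> centre (apex X)"

record ('k, 'u) cospan_mor =
  mdom :: "('k, 'u) cospan"
  mfun :: "'u \<Rightarrow> 'u"
  mcod :: "('k, 'u) cospan"

definition is_cospan_mor :: "'k ring \<Rightarrow> ('k, 'u) cospan_mor \<Rightarrow> bool" where
  "is_cospan_mor k \<phi> \<longleftrightarrow>
     is_cospan k (mdom \<phi>) \<and> is_cospan k (mcod \<phi>)
   \<and> csrc (mdom \<phi>) = csrc (mcod \<phi>) \<and> ctrg (mdom \<phi>) = ctrg (mcod \<phi>)
   \<and> mfun \<phi> \<in> alg_hom k (apex (mdom \<phi>)) (apex (mcod \<phi>))
   \<and> (\<forall>b \<in> carrier (ctrg (mdom \<phi>)). mfun \<phi> (lleg (mdom \<phi>) b) = lleg (mcod \<phi>) b)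
   \<and> (\<forall>a \<in> carrier (csrc (mdom \<phi>)). mfun \<phi> (rleg (mdom \<phi>) a) = rleg (mcod \<phi>) a)"

definition cospan_id :: "('k, 'u) module \<Rightarrow> ('k, 'u) cospan" where
  "cospan_id A =
     \<lparr>ctrg = A, lleg = (\<lambda>x \<in> carrier A. x), apex = A, rleg = (\<lambda>x \<in> carrier A. x), csrc = A\<rparr>"

text \<open>
  \<open>Y\<close> is a cospan from \<open>A\<close> to \<open>B\<close> and \<open>X\<close> is a cospan from \<open>B\<close> to \<open>C\<close>; the tensor product is
  over \<open>B\<close>, and \<open>ptensor X Y t s\<close> is the element \<open>t \<otimes>\<^sub>B s\<close> of it.
\<close>

definition ctensor :: "('k, 'u::infinite) cospan \<Rightarrow> ('k, 'u) cospan \<Rightarrow> ('k, 'u) module" where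
  "ctensor X Y = tensor (csrc X) (apex X) (rleg X) (apex Y) (lleg Y)"

definition ptensor :: "('k, 'u::infinite) cospan \<Rightarrow> ('k, 'u) cospan \<Rightarrow> 'u \<Rightarrow> 'u \<Rightarrow> 'u" where
  "ptensor X Y = pure_tensor (csrc X) (apex X) (rleg X) (apex Y) (lleg Y)"

definition cospan_comp :: "('k, 'u::infinite) cospan \<Rightarrow> ('k, 'u) cospan \<Rightarrow> ('k, 'u) cospan" where
  "cospan_comp X Y =
     \<lparr>ctrg = ctrg X,
      lleg = (\<lambda>c \<in> carrier (ctrg X). ptensor X Y (lleg X c) \<one>\<^bsub>apex Y\<^esub>),
      apex = ctensor X Y,
      rleg = (\<lambda>a \<in> carrier (csrc Y). ptensor X Y \<one>\<^bsub>apex X\<^esub> (rleg Y a)),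
      csrc = csrc Y\<rparr>"

definition cospan_mor_id :: "('k, 'u) cospan \<Rightarrow> ('k, 'u) cospan_mor" where
  "cospan_mor_id X = \<lparr>mdom = X, mfun = (\<lambda>t \<in> carrier (apex X). t), mcod = X\<rparr>"

definition cospan_mor_comp ::
    "('k, 'u) cospan_mor \<Rightarrow> ('k, 'u) cospan_mor \<Rightarrow> ('k, 'u) cospan_mor" where
  "cospan_mor_comp \<psi> \<phi> =
     \<lparr>mdom = mdom \<phi>, mfun = compose (carrier (apex (mdom \<phi>))) (mfun \<psi>) (mfun \<phi>), mcod = mcod \<psi>\<rparr>"

text \<open>
  The following maps out of tensor products are given by their values on pure tensors, which
  generate the tensor product, so that there is at most one such homomorphism.
\<close>

definition tensor_ind :: "'k ring \<Rightarrow> ('k, 'u::infinite) cospan \<Rightarrow> ('k, 'u) cospan \<Rightarrow>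
    ('k, 'u) module \<Rightarrow> ('u \<Rightarrow> 'u \<Rightarrow> 'u) \<Rightarrow> 'u \<Rightarrow> 'u" where
  "tensor_ind k X Y M p = (THE h. h \<in> alg_hom k (ctensor X Y) M
     \<and> (\<forall>t \<in> carrier (apex X). \<forall>s \<in> carrier (apex Y). h (ptensor X Y t s) = p t s))"

definition cospan_hcomp :: "'k ring \<Rightarrow>
    ('k, 'u::infinite) cospan_mor \<Rightarrow> ('k, 'u) cospan_mor \<Rightarrow> ('k, 'u) cospan_mor" where
  "cospan_hcomp k \<psi> \<phi> =
     \<lparr>mdom = cospan_comp (mdom \<psi>) (mdom \<phi>),
      mfun = tensor_ind k (mdom \<psi>) (mdom \<phi>) (ctensor (mcod \<psi>) (mcod \<phi>))
               (\<lambda>t s. ptensor (mcod \<psi>) (mcod \<phi>) (mfun \<psi> t) (mfun \<phi> s)),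
      mcod = cospan_comp (mcod \<psi>) (mcod \<phi>)\<rparr>"

definition cospan_assoc :: "'k ring \<Rightarrow> ('k, 'u::infinite) cospan \<Rightarrow> ('k, 'u) cospan \<Rightarrow>
    ('k, 'u) cospan \<Rightarrow> ('k, 'u) cospan_mor" where
  "cospan_assoc k W X Y =
     \<lparr>mdom = cospan_comp (cospan_comp W X) Y,
      mfun = (THE h. h \<in> alg_hom k (ctensor (cospan_comp W X) Y) (ctensor W (cospan_comp X Y))
               \<and> (\<forall>u \<in> carrier (apex W). \<forall>t \<in> carrier (apex X). \<forall>s \<in> carrier (apex Y).
                    h (ptensor (cospan_comp W X) Y (ptensor W X u t) s)
                      = ptensor W (cospan_comp X Y) u (ptensor X Y t s))),
      mcod = cospan_comp W (cospan_comp X Y)\<rparr>"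

definition cospan_lunitor :: "'k ring \<Rightarrow> ('k, 'u::infinite) cospan \<Rightarrow> ('k, 'u) cospan_mor" where
  "cospan_lunitor k X =
     \<lparr>mdom = cospan_comp (cospan_id (ctrg X)) X,
      mfun = tensor_ind k (cospan_id (ctrg X)) X (apex X) (\<lambda>b t. lleg X b \<otimes>\<^bsub>apex X\<^esub> t),
      mcod = X\<rparr>"

definition cospan_runitor :: "'k ring \<Rightarrow> ('k, 'u::infinite) cospan \<Rightarrow> ('k, 'u) cospan_mor" where
  "cospan_runitor k X =
     \<lparr>mdom = cospan_comp X (cospan_id (csrc X)),
      mfun = tensor_ind k X (cospan_id (csrc X)) (apex X) (\<lambda>t a. t \<otimes>\<^bsub>apex X\<^esub> rleg X a),
      mcod = X\<rparr>"

definition CAlg :: "'k ring \<Rightarrow>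
    (('k, 'u::infinite) module, ('k, 'u) cospan, ('k, 'u) cospan_mor) bicat" where
  "CAlg k =
     \<lparr>objs = {A. algebra k A},
      arrs = {X. is_cospan k X}, asrc = csrc, atrg = ctrg,
      cells = {\<phi>. is_cospan_mor k \<phi>}, cdom = mdom, ccod = mcod,
      id1 = cospan_id, comp1 = cospan_comp,
      id2 = cospan_mor_id, vcomp = cospan_mor_comp, hcomp = cospan_hcomp k,
      associator = cospan_assoc k,
      lunitor = cospan_lunitor k, runitor = cospan_runitor k\<rparr>"


section \<open>The centre\<close>

definition centre_cospan :: "('k, 'u) alg_arrow \<Rightarrow> ('k, 'u) cospan" where
  "centre_cospan f =
     \<lparr>ctrg = centre_alg (htrg f),
      lleg = (\<lambda>z \<in> centre (htrg f). z),
      apex = centraliser_alg (hsrc f) (htrg f) (hfun f),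
      rleg = restrict (hfun f) (centre (hsrc f)),
      csrc = centre_alg (hsrc f)\<rparr>"

definition centre_mult :: "'k ring \<Rightarrow>
    ('k, 'u::infinite) alg_arrow \<Rightarrow> ('k, 'u) alg_arrow \<Rightarrow> ('k, 'u) cospan_mor" where
  "centre_mult k g f =
     \<lparr>mdom = cospan_comp (centre_cospan g) (centre_cospan f),
      mfun = tensor_ind k (centre_cospan g) (centre_cospan f) (apex (centre_cospan (alg_comp g f)))
               (\<lambda>u v. u \<otimes>\<^bsub>htrg g\<^esub> hfun g v),
      mcod = centre_cospan (alg_comp g f)\<rparr>"

definition centre_functor :: "'k ring \<Rightarrow>
    (('k, 'u::infinite) module, ('k, 'u) alg_arrow, ('k, 'u) alg_arrow,
     ('k, 'u) module, ('k, 'u) cospan, ('k, 'u) cospan_mor) lax_data" where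
  "centre_functor k =
     \<lparr>omap = centre_alg,
      amap = centre_cospan,
      cmap = (\<lambda>f. cospan_mor_id (centre_cospan f)),
      lax_unit = (\<lambda>A. cospan_mor_id (cospan_id (centre_alg A))),
      lax_mult = centre_mult k\<rparr>"

end

theory Submission
  imports Defs
begin

text \<open>
  The tensor product, a quotient of a free abelian group, enters only through three facts: pure
  tensors generate it additively, they satisfy the bilinear and balanced relations, and it is
  universal for these relations. Hence every 2-cell out of a composite of cospans is determined by
  its values on pure tensors (or on iterated ones), and each axiom of the bicategory and of the lax
  functor becomes an identity in the apex algebras. The map \<open>u \<otimes> v \<mapsto> u \<cdot> g v\<close> is multiplicative
  because \<open>u'\<close> commutes with \<open>g v\<close>, so that \<open>u u' \<cdot> g v \<cdot> g v' = (u \<cdot> g v) (u' \<cdot> g v')\<close>, and both sides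
  of the associativity axiom send \<open>u \<otimes> v \<otimes> w\<close> to \<open>u \<cdot> h v \<cdot> h (g w)\<close>.
\<close>

section \<open>The tensor product as a quotient\<close>

text \<open>The obstacle is the associator. For a fixed \<open>s\<close> the map sending
  \<open>u \<otimes> t\<close> to \<open>u \<otimes> (t \<otimes> s)\<close> is additive and
  balanced but in general not multiplicative, so a universal property for algebra homomorphisms
  cannot supply it slice by slice. Universality is therefore established for additive maps into an
  abelian group. Products and scalars are dealt with afterwards: both sides of such a law are
  additive in each argument, so they are compared on generators. Invertibility of the structure
  2-cells is reduced to bijectivity, because the inverse of a bijective homomorphism is a
  homomorphism; thus the inverse of the associator is again constructed only as an additive map. On
  the side of the functor, the centraliser of an identity is literally the centre, which is why the
  unit 2-cells can be identities.\<close>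

locale tensor_product =
  fixes k :: "'k ring" and B T S :: "('k, 'u::infinite) module" and r l :: "'u \<Rightarrow> 'u"
  assumes B: "algebra k B" and T: "assoc_algebra k T" and S: "assoc_algebra k S"
    and r: "r \<in> alg_hom k B T" and r_centre: "r ` carrier B \<subseteq> centre T"
    and l: "l \<in> alg_hom k B S" and l_centre: "l ` carrier B \<subseteq> centre S"
begin

sublocale B: algebra k B by (rule B)
sublocale T: assoc_algebra k T by (rule T)
sublocale S: assoc_algebra k S by (rule S)

definition G where "G = free_Abelian_group (carrier T \<times> carrier S)"

definition H where "H = generate G (tensor_rels B T r S l)"

text \<open>The quotient map followed by the encoding into \<open>'u\<close>. It maps onto the
  carrier of \<open>TS\<close>, so every operation of the transported algebra can be computed on
  representatives in the free group.\<close>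

definition proj :: "(('u \<times> 'u) \<Rightarrow>\<^sub>0 int) \<Rightarrow> 'u" where
  "proj x = encode (carrier (tensor_quot B T r S l)) (H #>\<^bsub>G\<^esub> x)"

abbreviation TS :: "('k, 'u) module" where "TS \<equiv> tensor B T r S l"

abbreviation pure :: "'u \<Rightarrow> 'u \<Rightarrow> 'u" where "pure \<equiv> pure_tensor B T r S l"

lemma r_closed [simp]: "b \<in> carrier B \<Longrightarrow> r b \<in> carrier T"
  and r_commute: "b \<in> carrier B \<Longrightarrow> t \<in> carrier T \<Longrightarrow> t \<otimes>\<^bsub>T\<^esub> r b = r b \<otimes>\<^bsub>T\<^esub> t"
  using r_centre by (auto simp: centre_def)

lemma l_closed [simp]: "b \<in> carrier B \<Longrightarrow> l b \<in> carrier S"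
  and l_commute: "b \<in> carrier B \<Longrightarrow> s \<in> carrier S \<Longrightarrow> s \<otimes>\<^bsub>S\<^esub> l b = l b \<otimes>\<^bsub>S\<^esub> s"
  using l_centre by (auto simp: centre_def)

sublocale G: comm_group G
  unfolding G_def by (rule abelian_free_Abelian_group)

text \<open>The first rule turns membership in \<open>G\<close> into a statement about keys, to
  which closure facts such as \<open>frag_mult_closed\<close> may no longer apply; hence the
  deletions of \<open>G_simps(1)\<close> below.\<close>

lemma G_simps [simp]:
  "x \<in> carrier G \<longleftrightarrow> Poly_Mapping.keys x \<subseteq> carrier T \<times> carrier S"
  "\<one>\<^bsub>G\<^esub> = 0" "x \<otimes>\<^bsub>G\<^esub> y = x + y"
  unfolding G_def by simp_all

lemma zero_G [simp]: "0 \<in> carrier G"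
  by simp

lemma G_inv [simp]: "Poly_Mapping.keys x \<subseteq> carrier T \<times> carrier S \<Longrightarrow> inv\<^bsub>G\<^esub> x = - x"
  unfolding G_def by simp

lemma rels_G: "tensor_rels B T r S l \<subseteq> carrier G"
  unfolding tensor_rels_def
  by (auto dest!: subsetD[OF keys_diff] simp: keys_frag_of)

lemma H_subgroup: "subgroup H G"
  unfolding H_def by (rule G.generate_is_subgroup[OF rels_G])

lemma H_normal: "H \<lhd> G"
  by (simp add: G.normal_iff_subgroup H_subgroup)

text \<open>Sums and negatives are built from differences, so a property that survives subtraction
  reaches the whole subgroup. The shape matches the induction on the free group, with which it is
  combined below.\<close>

lemma H_induct [consumes 1, case_names rel diff]:
  assumes "x \<in> H"
    and rel: "\<And>x. x \<in> tensor_rels B T r S l \<Longrightarrow> P x"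
    and diff: "\<And>x y. x \<in> carrier G \<Longrightarrow> y \<in> carrier G \<Longrightarrow> P x \<Longrightarrow> P y \<Longrightarrow> P (x - y)"
  shows "P x"
proof -
  \<comment> \<open>The relation set is nonempty because the carriers are, so \<open>0\<close> is
    the difference of a relation with itself.\<close>
  have zero: "P 0"
  proof -
    obtain z where "z \<in> tensor_rels B T r S l"
      unfolding tensor_rels_def by blast
    then have "P (z - z)"
      using rels_G by (intro diff[of z z] rel) blast+
    then show ?thesis by simp
  qed
  have "x \<in> carrier G \<and> P x"
    using assms(1) unfolding H_def
  proof (induction x rule: generate.induct)
    case one
    then show ?case using zero by simp
  next
    case (incl h)
    then show ?case using rel rels_G by blast
  next
    case (inv h)
    then have h: "h \<in> carrier G" "P h" using rel rels_G by blast+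
    then have "P (0 - h)" by (intro diff zero) auto
    then show ?case using h G.inv_closed by simp
  next
    case (eng x y)
    then have "P (0 - y)" by (intro diff zero) auto
    then have "P (x - (0 - y))" using eng zero by (intro diff) auto
    then show ?case using eng G.m_closed[of x y] by simp
  qed
  then show ?thesis ..
qed

section \<open>Cosets of the relations and their codes in \<open>'u\<close>\<close>

lemma cl_eq_iff:
  assumes "x \<in> carrier G" "y \<in> carrier G"
  shows "H #>\<^bsub>G\<^esub> x = H #>\<^bsub>G\<^esub> y \<longleftrightarrow> x - y \<in> H"
proof -
  have "H #>\<^bsub>G\<^esub> x = H #>\<^bsub>G\<^esub> y \<longleftrightarrow> x \<in> H #>\<^bsub>G\<^esub> y"
    using assms H_subgroup by (metis G.rcos_self G.repr_independence)
  also have "\<dots> \<longleftrightarrow> x - y \<in> H"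
    using subgroup.rcos_module[OF H_subgroup G.is_group, of y x] assms by simp
  finally show ?thesis .
qed

lemma G_minus: "x \<in> carrier G \<Longrightarrow> y \<in> carrier G \<Longrightarrow> x - y \<in> carrier G"
  using keys_diff[of x y] by auto

lemma tensor_coset_eq: "tensor_coset B T r S l x = H #>\<^bsub>G\<^esub> x"
  by (simp add: tensor_coset_def G_def H_def Let_def)

lemma quot_simps:
  "carrier (tensor_quot B T r S l) = (\<lambda>x. H #>\<^bsub>G\<^esub> x) ` carrier G"
  "mult (tensor_quot B T r S l) X Y = (\<Union>x \<in> X. \<Union>y \<in> Y. H #>\<^bsub>G\<^esub> frag_mult T S x y)"
  "one (tensor_quot B T r S l) = H #>\<^bsub>G\<^esub> frag_of (\<one>\<^bsub>T\<^esub>, \<one>\<^bsub>S\<^esub>)"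
  "ring.zero (tensor_quot B T r S l) = H"
  "add (tensor_quot B T r S l) X Y = X <#>\<^bsub>G\<^esub> Y"
  "smult (tensor_quot B T r S l) c X = (\<Union>x \<in> X. H #>\<^bsub>G\<^esub> frag_smult T c x)"
  by (auto simp: tensor_quot_def Let_def tensor_coset_eq FactGroup_def RCOSETS_def
      simp flip: G_def H_def)

lemma pure_eq: "pure t s = proj (frag_of (t, s))"
  by (simp add: pure_tensor_def proj_def tensor_coset_eq)

lemma proj_eq_iff:
  assumes "x \<in> carrier G" "y \<in> carrier G"
  shows "proj x = proj y \<longleftrightarrow> x - y \<in> H"
  unfolding proj_def using assms
  by (subst inj_on_eq_iff[OF inj_on_encode_tensor_quot]) (auto simp: quot_simps cl_eq_iff)

lemma carrier_tensor: "carrier TS = proj ` carrier G"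
  by (simp add: tensor_def transport_def Let_def quot_simps(1) proj_def image_image)

text \<open>\<open>transport\<close> applies \<open>inv_into\<close> of the encoding to each
  argument. On \<open>proj x\<close> this returns the coset, by injectivity of the encoding on the
  quotient.\<close>

lemma decode: "x \<in> carrier G \<Longrightarrow>
  inv_into (carrier (tensor_quot B T r S l)) (encode (carrier (tensor_quot B T r S l))) (proj x)
    = H #>\<^bsub>G\<^esub> x"
  unfolding proj_def
  by (rule inv_into_f_f[OF inj_on_encode_tensor_quot]) (auto simp: quot_simps(1))

lemma zero_tensor: "\<zero>\<^bsub>TS\<^esub> = proj 0"
  using G.coset_mult_one[of H] subgroup.subset[OF H_subgroup]
  by (simp add: tensor_def transport_def Let_def proj_def quot_simps(4))

lemma one_tensor: "\<one>\<^bsub>TS\<^esub> = pure \<one>\<^bsub>T\<^esub> \<one>\<^bsub>S\<^esub>"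
  by (simp add: tensor_def transport_def Let_def proj_def quot_simps(3) pure_eq)

lemma add_proj:
  assumes "x \<in> carrier G" "y \<in> carrier G"
  shows "proj x \<oplus>\<^bsub>TS\<^esub> proj y = proj (x + y)"
  using normal.rcos_sum[OF H_normal assms] decode[OF assms(1)] decode[OF assms(2)]
  by (simp add: tensor_def transport_def Let_def quot_simps(5)) (simp add: proj_def)

section \<open>Products and scalars on the free abelian group\<close>

lemma frag_extend_diff_fun: "frag_extend (\<lambda>i. f i - g i) x = frag_extend f x - frag_extend g x"
  by (rule frag_induction[of x UNIV]) (auto simp: frag_extend_diff)

lemma frag_mult_simps [simp]:
  "frag_mult T S (frag_of (t, s)) (frag_of (t', s')) = frag_of (t \<otimes>\<^bsub>T\<^esub> t', s \<otimes>\<^bsub>S\<^esub> s')"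
  "frag_mult T S 0 y = 0"
  "frag_mult T S x 0 = 0"
  "frag_mult T S (x - x') y = frag_mult T S x y - frag_mult T S x' y"
  "frag_mult T S x (y - y') = frag_mult T S x y - frag_mult T S x y'"
proof -
  show "frag_mult T S x 0 = 0"
    unfolding frag_mult_def by (rule frag_extend_eq_0) auto
  \<comment> \<open>The second argument sits inside the function that is extended, so this rests on
    additivity of \<open>frag_extend\<close> in the function.\<close>
  show "frag_mult T S x (y - y') = frag_mult T S x y - frag_mult T S x y'"
    unfolding frag_mult_def frag_extend_diff_fun[symmetric]
    by (simp add: frag_extend_diff split_def)
qed (auto simp: frag_mult_def frag_extend_diff)

lemma frag_smult_simps [simp]:
  "frag_smult T c (frag_of (t, s)) = frag_of (c \<odot>\<^bsub>T\<^esub> t, s)"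
  "frag_smult T c 0 = 0"
  "frag_smult T c (x - x') = frag_smult T c x - frag_smult T c x'"
  by (simp_all add: frag_smult_def frag_extend_diff)

lemma G_induct [consumes 1, case_names zero of diff]:
  assumes "x \<in> carrier G" "P 0"
    and "\<And>t s. t \<in> carrier T \<Longrightarrow> s \<in> carrier S \<Longrightarrow> P (frag_of (t, s))"
    and "\<And>x y. x \<in> carrier G \<Longrightarrow> y \<in> carrier G \<Longrightarrow> P x \<Longrightarrow> P y \<Longrightarrow> P (x - y)"
  shows "P x"
  by (rule free_Abelian_group_induct[of x "carrier T \<times> carrier S"])
    (use assms in auto)

lemma frag_of_G [simp]: "t \<in> carrier T \<Longrightarrow> s \<in> carrier S \<Longrightarrow> frag_of (t, s) \<in> carrier G"
  by (simp add: keys_frag_of)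

lemma frag_mult_closed:
  assumes "x \<in> carrier G" "y \<in> carrier G"
  shows "frag_mult T S x y \<in> carrier G"
  using assms(1)
proof (induction x rule: G_induct)
  case (of t s)
  show ?case
    using assms(2) of
    by (induction y rule: G_induct) (auto simp: keys_frag_of intro!: G_minus simp del: G_simps(1))
qed (simp_all add: G_minus del: G_simps(1))

lemma frag_smult_closed:
  assumes "c \<in> carrier k" "x \<in> carrier G"
  shows "frag_smult T c x \<in> carrier G"
  using assms(2)
  by (induction x rule: G_induct) (simp_all add: G_minus assms(1) del: G_simps(1))

lemma H_zero: "0 \<in> H"
  using subgroup.one_closed[OF H_subgroup] by simp

lemma H_minus: "x \<in> H \<Longrightarrow> y \<in> H \<Longrightarrow> x - y \<in> H"
  using subgroup.m_closed[OF H_subgroup, of x "- y"] subgroup.m_inv_closed[OF H_subgroup, of y]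
    subgroup.mem_carrier[OF H_subgroup, of y] by simp

lemma rel_addl: "t \<in> carrier T \<Longrightarrow> t' \<in> carrier T \<Longrightarrow> s \<in> carrier S \<Longrightarrow>
    frag_of (t \<oplus>\<^bsub>T\<^esub> t', s) - frag_of (t, s) - frag_of (t', s) \<in> H"
  and rel_addr: "t \<in> carrier T \<Longrightarrow> s \<in> carrier S \<Longrightarrow> s' \<in> carrier S \<Longrightarrow>
    frag_of (t, s \<oplus>\<^bsub>S\<^esub> s') - frag_of (t, s) - frag_of (t, s') \<in> H"
  and rel_balance: "t \<in> carrier T \<Longrightarrow> b \<in> carrier B \<Longrightarrow> s \<in> carrier S \<Longrightarrow>
    frag_of (t \<otimes>\<^bsub>T\<^esub> r b, s) - frag_of (t, l b \<otimes>\<^bsub>S\<^esub> s) \<in> H"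
  unfolding H_def by (rule generate.incl; unfold tensor_rels_def; blast)+

lemma rels_cases [consumes 1, case_names addl addr balance]:
  assumes "x \<in> tensor_rels B T r S l"
  obtains t t' s where "t \<in> carrier T" "t' \<in> carrier T" "s \<in> carrier S"
      "x = frag_of (t \<oplus>\<^bsub>T\<^esub> t', s) - frag_of (t, s) - frag_of (t', s)"
    | t s s' where "t \<in> carrier T" "s \<in> carrier S" "s' \<in> carrier S"
      "x = frag_of (t, s \<oplus>\<^bsub>S\<^esub> s') - frag_of (t, s) - frag_of (t, s')"
    | t b s where "t \<in> carrier T" "b \<in> carrier B" "s \<in> carrier S"
      "x = frag_of (t \<otimes>\<^bsub>T\<^esub> r b, s) - frag_of (t, l b \<otimes>\<^bsub>S\<^esub> s)"
  using assms unfolding tensor_rels_def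
  by (elim UnE CollectE exE conjE) ((rule that(1); assumption), (rule that(2); assumption), (rule that(3); assumption))

text \<open>The images of \<^term>\<open>r\<close> and \<^term>\<open>l\<close> are central, so the relations form a two-sided ideal.\<close>

lemma frag_mult_H_left:
  assumes "x \<in> H" "y \<in> carrier G"
  shows "frag_mult T S x y \<in> H"
  using assms(1)
proof (induction x rule: H_induct)
  case (rel x)
  show ?case
    using assms(2)
  proof (induction y rule: G_induct)
    case (of t' s')
    from rel show ?case
    proof (cases x rule: rels_cases)
      case (addl t1 t2 s)
      then show ?thesis
        using rel_addl[of "t1 \<otimes>\<^bsub>T\<^esub> t'" "t2 \<otimes>\<^bsub>T\<^esub> t'" "s \<otimes>\<^bsub>S\<^esub> s'"] of by (simp add: T.l_distr)
    next
      case (addr t s1 s2)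
      then show ?thesis
        using rel_addr[of "t \<otimes>\<^bsub>T\<^esub> t'" "s1 \<otimes>\<^bsub>S\<^esub> s'" "s2 \<otimes>\<^bsub>S\<^esub> s'"] of by (simp add: S.l_distr)
    next
      case (balance t b s)
      \<comment> \<open>Right multiplication by \<open>t'\<close> separates \<open>r b\<close> from
        the end of its factor; centrality of \<open>r b\<close> moves it back.\<close>
      then have "(t \<otimes>\<^bsub>T\<^esub> r b) \<otimes>\<^bsub>T\<^esub> t' = (t \<otimes>\<^bsub>T\<^esub> t') \<otimes>\<^bsub>T\<^esub> r b"
        using of by (simp add: T.m_assoc r_commute)
      then show ?thesis
        using rel_balance[of "t \<otimes>\<^bsub>T\<^esub> t'" b "s \<otimes>\<^bsub>S\<^esub> s'"] of balance by (simp add: S.m_assoc)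
    qed
  qed (simp_all add: H_zero H_minus)
qed (simp_all add: H_minus)

lemma frag_mult_H_right:
  assumes "x \<in> carrier G" "y \<in> H"
  shows "frag_mult T S x y \<in> H"
  using assms(2)
proof (induction y rule: H_induct)
  case (rel y)
  show ?case
    using assms(1)
  proof (induction x rule: G_induct)
    case (of t' s')
    from rel show ?case
    proof (cases y rule: rels_cases)
      case (addl t1 t2 s)
      then show ?thesis
        using rel_addl[of "t' \<otimes>\<^bsub>T\<^esub> t1" "t' \<otimes>\<^bsub>T\<^esub> t2" "s' \<otimes>\<^bsub>S\<^esub> s"] of by (simp add: T.r_distr)
    next
      case (addr t s1 s2)
      then show ?thesis
        using rel_addr[of "t' \<otimes>\<^bsub>T\<^esub> t" "s' \<otimes>\<^bsub>S\<^esub> s1" "s' \<otimes>\<^bsub>S\<^esub> s2"] of by (simp add: S.r_distr)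
    next
      case (balance t b s)
      \<comment> \<open>Left multiplication by \<open>s'\<close> lands before \<open>l b\<close>, so
        on this side it is \<open>l b\<close> whose centrality is used.\<close>
      then have "s' \<otimes>\<^bsub>S\<^esub> (l b \<otimes>\<^bsub>S\<^esub> s) = l b \<otimes>\<^bsub>S\<^esub> (s' \<otimes>\<^bsub>S\<^esub> s)"
        using of by (metis S.m_assoc l_closed l_commute)
      then show ?thesis
        using rel_balance[of "t' \<otimes>\<^bsub>T\<^esub> t" b "s' \<otimes>\<^bsub>S\<^esub> s"] of balance by (simp add: T.m_assoc)
    qed
  qed (simp_all add: H_zero H_minus)
qed (simp_all add: H_minus)

lemma frag_smult_H:
  assumes "c \<in> carrier k" "x \<in> H"
  shows "frag_smult T c x \<in> H"
  using assms(2)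
proof (induction x rule: H_induct)
  case (rel x)
  then show ?case
  proof (cases x rule: rels_cases)
    case (addl t1 t2 s)
    then show ?thesis
      using rel_addl[of "c \<odot>\<^bsub>T\<^esub> t1" "c \<odot>\<^bsub>T\<^esub> t2" s] assms(1) by (simp add: T.smult_r_distr)
  next
    case (addr t s1 s2)
    then show ?thesis
      using rel_addr[of "c \<odot>\<^bsub>T\<^esub> t" s1 s2] assms(1) by simp
  next
    case (balance t b s)
    then show ?thesis
      using rel_balance[of "c \<odot>\<^bsub>T\<^esub> t" b s] assms(1) by (simp add: T.smult_mult_left)
  qed
qed (simp_all add: H_minus)

section \<open>Well-defined operations on classes\<close>

lemma mem_cosetD: "x' \<in> H #>\<^bsub>G\<^esub> x \<Longrightarrow> x \<in> carrier G \<Longrightarrow> x' \<in> carrier G \<and> x' - x \<in> H"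
  using subgroup.mem_carrier[OF H_subgroup] keys_add by (fastforce simp: r_coset_def)

text \<open>The union over all representatives in \<open>tensor_quot\<close> is a single coset:
  replacing the representatives one at a time changes the product by an element of
  \<open>H\<close>.\<close>

lemma mult_proj:
  assumes x: "x \<in> carrier G" and y: "y \<in> carrier G"
  shows "proj x \<otimes>\<^bsub>TS\<^esub> proj y = proj (frag_mult T S x y)"
proof -
  have "H #>\<^bsub>G\<^esub> frag_mult T S x' y' = H #>\<^bsub>G\<^esub> frag_mult T S x y"
    if "x' \<in> H #>\<^bsub>G\<^esub> x" "y' \<in> H #>\<^bsub>G\<^esub> y" for x' y'
  proof -
    have x': "x' \<in> carrier G" "x' - x \<in> H" and y': "y' \<in> carrier G" "y' - y \<in> H"
      using mem_cosetD that x y by blast+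
    have "frag_mult T S x' y' - frag_mult T S x y' \<in> H"
      using frag_mult_H_left[OF x'(2) y'(1)] by simp
    moreover have "frag_mult T S x y' - frag_mult T S x y \<in> H"
      using frag_mult_H_right[OF x y'(2)] by simp
    ultimately show ?thesis
      using x x' y y' by (simp add: frag_mult_closed flip: cl_eq_iff del: G_simps(1))
  qed
  \<comment> \<open>Each coset contains its representative, so the union has a nonempty index set
    and equals the common value.\<close>
  moreover have "x \<in> H #>\<^bsub>G\<^esub> x" "y \<in> H #>\<^bsub>G\<^esub> y"
    using x y H_subgroup by (simp_all add: G.rcos_self del: G_simps(1))
  ultimately have "(\<Union>x' \<in> H #>\<^bsub>G\<^esub> x. \<Union>y' \<in> H #>\<^bsub>G\<^esub> y. H #>\<^bsub>G\<^esub> frag_mult T S x' y')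
      = H #>\<^bsub>G\<^esub> frag_mult T S x y"
    by blast
  then show ?thesis
    using decode[OF x] decode[OF y]
    by (simp add: tensor_def transport_def Let_def quot_simps(2)) (simp add: proj_def)
qed

lemma smult_proj:
  assumes c: "c \<in> carrier k" and x: "x \<in> carrier G"
  shows "c \<odot>\<^bsub>TS\<^esub> proj x = proj (frag_smult T c x)"
proof -
  have "H #>\<^bsub>G\<^esub> frag_smult T c x' = H #>\<^bsub>G\<^esub> frag_smult T c x" if "x' \<in> H #>\<^bsub>G\<^esub> x" for x'
    using mem_cosetD[OF that x] frag_smult_H[OF c, of "x' - x"] c x
    by (simp add: frag_smult_closed cl_eq_iff del: G_simps(1))
  moreover have "x \<in> H #>\<^bsub>G\<^esub> x"
    using x H_subgroup by (simp_all add: G.rcos_self del: G_simps(1))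
  ultimately have "(\<Union>x' \<in> H #>\<^bsub>G\<^esub> x. H #>\<^bsub>G\<^esub> frag_smult T c x') = H #>\<^bsub>G\<^esub> frag_smult T c x"
    by blast
  then show ?thesis
    using decode[OF x]
    by (simp add: tensor_def transport_def Let_def quot_simps(6)) (simp add: proj_def)
qed

section \<open>Pure tensors, their relations and the group they generate\<close>

lemma pure_closed [simp]: "t \<in> carrier T \<Longrightarrow> s \<in> carrier S \<Longrightarrow> pure t s \<in> carrier TS"
  by (simp add: carrier_tensor pure_eq del: G_simps(1))

lemma proj_diff_eqI:
  assumes "x - y - z \<in> H" "x \<in> carrier G" "y \<in> carrier G" "z \<in> carrier G"
  shows "proj x = proj y \<oplus>\<^bsub>TS\<^esub> proj z"
proof -
  have "y + z \<in> carrier G"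
    using G.m_closed[of y z] assms by simp
  then show ?thesis
    using assms by (simp add: add_proj proj_eq_iff diff_diff_add del: G_simps(1))
qed

lemma pure_add_left:
  assumes "t \<in> carrier T" "t' \<in> carrier T" "s \<in> carrier S"
  shows "pure (t \<oplus>\<^bsub>T\<^esub> t') s = pure t s \<oplus>\<^bsub>TS\<^esub> pure t' s"
  unfolding pure_eq by (rule proj_diff_eqI) (use assms rel_addl in simp_all)

lemma pure_add_right:
  assumes "t \<in> carrier T" "s \<in> carrier S" "s' \<in> carrier S"
  shows "pure t (s \<oplus>\<^bsub>S\<^esub> s') = pure t s \<oplus>\<^bsub>TS\<^esub> pure t s'"
  unfolding pure_eq by (rule proj_diff_eqI) (use assms rel_addr in simp_all)

lemma pure_balanced:
  assumes "t \<in> carrier T" "b \<in> carrier B" "s \<in> carrier S"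
  shows "pure (t \<otimes>\<^bsub>T\<^esub> r b) s = pure t (l b \<otimes>\<^bsub>S\<^esub> s)"
  using assms rel_balance by (simp add: pure_eq proj_eq_iff del: G_simps(1))

lemma pure_mult:
  assumes "t \<in> carrier T" "t' \<in> carrier T" "s \<in> carrier S" "s' \<in> carrier S"
  shows "pure t s \<otimes>\<^bsub>TS\<^esub> pure t' s' = pure (t \<otimes>\<^bsub>T\<^esub> t') (s \<otimes>\<^bsub>S\<^esub> s')"
  using assms by (simp add: pure_eq mult_proj del: G_simps(1))

lemma pure_smult_left:
  assumes "c \<in> carrier k" "t \<in> carrier T" "s \<in> carrier S"
  shows "c \<odot>\<^bsub>TS\<^esub> pure t s = pure (c \<odot>\<^bsub>T\<^esub> t) s"
  using assms by (simp add: pure_eq smult_proj del: G_simps(1))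

text \<open>Verified on representatives, since \<open>tensor_induct\<close> itself relies on
  negatives in \<open>TS\<close>.\<close>

lemma abelian_group_tensor: "abelian_group TS"
proof (rule abelian_groupI)
  fix x y z
  assume "x \<in> carrier TS" "y \<in> carrier TS" "z \<in> carrier TS"
  then obtain a b c where "a \<in> carrier G" "b \<in> carrier G" "c \<in> carrier G"
      "x = proj a" "y = proj b" "z = proj c"
    unfolding carrier_tensor by blast
  moreover from this have "a + b \<in> carrier G" "b + c \<in> carrier G"
    using G.m_closed[of a b] G.m_closed[of b c] by simp_all
  ultimately show "x \<oplus>\<^bsub>TS\<^esub> y \<oplus>\<^bsub>TS\<^esub> z = x \<oplus>\<^bsub>TS\<^esub> (y \<oplus>\<^bsub>TS\<^esub> z)"
    by (simp add: add_proj add.assoc del: G_simps(1))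
next
  fix x y
  assume "x \<in> carrier TS" "y \<in> carrier TS"
  then obtain a b where "a \<in> carrier G" "b \<in> carrier G" "x = proj a" "y = proj b"
    unfolding carrier_tensor by blast
  moreover from this have "a + b \<in> carrier G"
    using G.m_closed[of a b] by simp
  ultimately show "x \<oplus>\<^bsub>TS\<^esub> y \<in> carrier TS" "x \<oplus>\<^bsub>TS\<^esub> y = y \<oplus>\<^bsub>TS\<^esub> x"
    by (simp_all add: add_proj carrier_tensor add.commute del: G_simps(1))
next
  show "\<zero>\<^bsub>TS\<^esub> \<in> carrier TS"
    by (simp add: zero_tensor carrier_tensor del: G_simps(1))
next
  fix x assume "x \<in> carrier TS"
  then obtain a where a: "a \<in> carrier G" "x = proj a"
    unfolding carrier_tensor by blast
  then show "\<zero>\<^bsub>TS\<^esub> \<oplus>\<^bsub>TS\<^esub> x = x"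
    by (simp add: zero_tensor add_proj del: G_simps(1))
  show "\<exists>y \<in> carrier TS. y \<oplus>\<^bsub>TS\<^esub> x = \<zero>\<^bsub>TS\<^esub>"
    using a G_minus[of 0 a]
    by (intro bexI[of _ "proj (- a)"]) (simp_all add: zero_tensor add_proj carrier_tensor del: G_simps(1))
qed

sublocale TS: abelian_group TS by (rule abelian_group_tensor)

lemma proj_diff:
  assumes "x \<in> carrier G" "y \<in> carrier G"
  shows "proj (x - y) = proj x \<ominus>\<^bsub>TS\<^esub> proj y"
proof -
  have "proj (x - y) \<oplus>\<^bsub>TS\<^esub> proj y = proj x"
    using assms by (simp add: add_proj G_minus del: G_simps(1))
  moreover have "proj x \<in> carrier TS" "proj y \<in> carrier TS" "proj (x - y) \<in> carrier TS"
    using assms G_minus[OF assms] unfolding carrier_tensor by blast+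
  ultimately show ?thesis
    by (simp add: a_minus_def TS.add.inv_solve_right)
qed

lemma pure_zero_left:
  assumes "s \<in> carrier S" shows "pure \<zero>\<^bsub>T\<^esub> s = \<zero>\<^bsub>TS\<^esub>"
  using pure_add_left[of "\<zero>\<^bsub>T\<^esub>" "\<zero>\<^bsub>T\<^esub>" s] assms by simp

lemma pure_minus_left:
  assumes "t \<in> carrier T" "s \<in> carrier S" shows "pure (\<ominus>\<^bsub>T\<^esub> t) s = \<ominus>\<^bsub>TS\<^esub> pure t s"
  using pure_add_left[of "\<ominus>\<^bsub>T\<^esub> t" t s] assms
  by (intro TS.minus_equality[symmetric]) (simp_all add: pure_zero_left T.l_neg)

text \<open>Zero and negatives need no case of their own: \<open>0 \<otimes> 0\<close> is zero, and
  the negative of \<open>t \<otimes> s\<close> is the pure tensor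
  \<open>(-t) \<otimes> s\<close>.\<close>

lemma tensor_induct [consumes 1, case_names pure add]:
  assumes "z \<in> carrier TS"
    and pure: "\<And>t s. t \<in> carrier T \<Longrightarrow> s \<in> carrier S \<Longrightarrow> P (pure t s)"
    and add: "\<And>x y. x \<in> carrier TS \<Longrightarrow> y \<in> carrier TS \<Longrightarrow> P x \<Longrightarrow> P y \<Longrightarrow> P (x \<oplus>\<^bsub>TS\<^esub> y)"
  shows "P z"
proof -
  from assms(1) obtain x where x: "x \<in> carrier G" "z = proj x"
    unfolding carrier_tensor by blast
  have mem: "proj y \<in> carrier TS" if "y \<in> carrier G" for y
    using that unfolding carrier_tensor by blast
  \<comment> \<open>The induction on the free group subtracts while the rule being proved only adds,
    so the claim is carried for an element together with its negative.\<close>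
  from x(1) have "P (proj x) \<and> P (\<ominus>\<^bsub>TS\<^esub> proj x)"
  proof (induction x rule: G_induct)
    case zero
    have m0: "\<ominus>\<^bsub>TS\<^esub> \<zero>\<^bsub>TS\<^esub> = \<zero>\<^bsub>TS\<^esub>"
      by (rule TS.minus_equality) simp_all
    have "P \<zero>\<^bsub>TS\<^esub>"
      using pure[of "\<zero>\<^bsub>T\<^esub>" "\<zero>\<^bsub>S\<^esub>"] by (simp add: pure_zero_left)
    then show ?case
      by (simp only: m0 simp_thms flip: zero_tensor)
  next
    case (of t s)
    then show ?case
      using pure[of t s] pure[of "\<ominus>\<^bsub>T\<^esub> t" s] by (simp add: pure_minus_left flip: pure_eq)
  next
    case (diff x y)
    then show ?case
      using add[of "proj x" "\<ominus>\<^bsub>TS\<^esub> proj y"] add[of "\<ominus>\<^bsub>TS\<^esub> proj x" "proj y"]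
      by (simp add: proj_diff a_minus_def TS.minus_add mem del: G_simps(1))
  qed
  then show ?thesis using x by simp
qed

section \<open>The algebra structure\<close>

lemma mult_closed_tensor:
  assumes "x \<in> carrier TS" "y \<in> carrier TS" shows "x \<otimes>\<^bsub>TS\<^esub> y \<in> carrier TS"
  using assms unfolding carrier_tensor by (auto simp: mult_proj frag_mult_closed simp del: G_simps(1))

lemma tensor_distr:
  assumes "x \<in> carrier TS" "y \<in> carrier TS" "z \<in> carrier TS"
  shows "(x \<oplus>\<^bsub>TS\<^esub> y) \<otimes>\<^bsub>TS\<^esub> z = x \<otimes>\<^bsub>TS\<^esub> z \<oplus>\<^bsub>TS\<^esub> y \<otimes>\<^bsub>TS\<^esub> z"
    and "z \<otimes>\<^bsub>TS\<^esub> (x \<oplus>\<^bsub>TS\<^esub> y) = z \<otimes>\<^bsub>TS\<^esub> x \<oplus>\<^bsub>TS\<^esub> z \<otimes>\<^bsub>TS\<^esub> y"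
proof -
  obtain a b c where abc: "a \<in> carrier G" "b \<in> carrier G" "c \<in> carrier G"
      "x = proj a" "y = proj b" "z = proj c"
    using assms unfolding carrier_tensor by blast
  have [simp]: "a + b \<in> carrier G"
    using G.m_closed[of a b] abc by simp
  \<comment> \<open>\<open>frag_mult_simps\<close> speaks of differences only, so the sum is read as
    \<open>a - (0 - b)\<close>.\<close>
  have "frag_mult T S (a + b) c = frag_mult T S a c + frag_mult T S b c"
    using frag_mult_simps(4)[of a "0 - b" c] frag_mult_simps(4)[of 0 b c] by simp
  then show "(x \<oplus>\<^bsub>TS\<^esub> y) \<otimes>\<^bsub>TS\<^esub> z = x \<otimes>\<^bsub>TS\<^esub> z \<oplus>\<^bsub>TS\<^esub> y \<otimes>\<^bsub>TS\<^esub> z"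
    using abc by (simp add: add_proj mult_proj frag_mult_closed del: G_simps(1))
  have "frag_mult T S c (a + b) = frag_mult T S c a + frag_mult T S c b"
    using frag_mult_simps(5)[of c a "0 - b"] frag_mult_simps(5)[of c 0 b] by simp
  then show "z \<otimes>\<^bsub>TS\<^esub> (x \<oplus>\<^bsub>TS\<^esub> y) = z \<otimes>\<^bsub>TS\<^esub> x \<oplus>\<^bsub>TS\<^esub> z \<otimes>\<^bsub>TS\<^esub> y"
    using abc by (simp add: add_proj mult_proj frag_mult_closed del: G_simps(1))
qed

lemma smult_closed_tensor:
  assumes "c \<in> carrier k" "x \<in> carrier TS" shows "c \<odot>\<^bsub>TS\<^esub> x \<in> carrier TS"
  using assms unfolding carrier_tensor by (auto simp: smult_proj frag_smult_closed simp del: G_simps(1))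

lemma smult_add_tensor:
  assumes "c \<in> carrier k" "x \<in> carrier TS" "y \<in> carrier TS"
  shows "c \<odot>\<^bsub>TS\<^esub> (x \<oplus>\<^bsub>TS\<^esub> y) = c \<odot>\<^bsub>TS\<^esub> x \<oplus>\<^bsub>TS\<^esub> c \<odot>\<^bsub>TS\<^esub> y"
proof -
  obtain a b where ab: "a \<in> carrier G" "b \<in> carrier G" "x = proj a" "y = proj b"
    using assms unfolding carrier_tensor by blast
  have [simp]: "a + b \<in> carrier G"
    using G.m_closed[of a b] ab by simp
  have "frag_smult T c (a + b) = frag_smult T c a + frag_smult T c b"
    using frag_smult_simps(3)[of c a "0 - b"] frag_smult_simps(3)[of c 0 b] by simp
  then show ?thesis
    using assms(1) ab by (simp add: add_proj smult_proj frag_smult_closed del: G_simps(1))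
qed

lemmas tensor_simps = pure_mult pure_smult_left mult_closed_tensor smult_closed_tensor
  tensor_distr smult_add_tensor

text \<open>The laws of products and scalars are additive in the tensors involved, so inductions,
  nested where necessary, reduce them to pure tensors, where they follow from the laws of the two
  factors.\<close>

lemma assoc_algebra_tensor: "assoc_algebra k TS"
proof -
  have assoc: "(x \<otimes>\<^bsub>TS\<^esub> y) \<otimes>\<^bsub>TS\<^esub> z = x \<otimes>\<^bsub>TS\<^esub> (y \<otimes>\<^bsub>TS\<^esub> z)"
    if "x \<in> carrier TS" "y \<in> carrier TS" "z \<in> carrier TS" for x y z
    using that(1)
  proof (induction x rule: tensor_induct)
    case (pure t s)
    note 1 = this
    show ?case
      using that(2)
    proof (induction y rule: tensor_induct)
      case (pure t' s')
      note 2 = this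
      show ?case
        using that(3)
        by (induction z rule: tensor_induct)
          (simp_all add: 1 2 tensor_simps T.m_assoc S.m_assoc)
    qed (simp_all add: 1 that tensor_simps)
  qed (simp_all add: that tensor_simps)
  have one: "\<one>\<^bsub>TS\<^esub> \<otimes>\<^bsub>TS\<^esub> x = x" "x \<otimes>\<^bsub>TS\<^esub> \<one>\<^bsub>TS\<^esub> = x" if "x \<in> carrier TS" for x
    using that by (induction x rule: tensor_induct) (simp_all add: one_tensor tensor_simps)
  have monoid: "monoid TS"
    using assoc one by (intro monoidI) (simp_all add: mult_closed_tensor one_tensor)
  have "(c \<oplus>\<^bsub>k\<^esub> d) \<odot>\<^bsub>TS\<^esub> x = c \<odot>\<^bsub>TS\<^esub> x \<oplus>\<^bsub>TS\<^esub> d \<odot>\<^bsub>TS\<^esub> x"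
    if "c \<in> carrier k" "d \<in> carrier k" "x \<in> carrier TS" for c d x
    using that(3)
    by (induction x rule: tensor_induct)
      (simp_all add: that(1,2) tensor_simps T.smult_l_distr pure_add_left TS.a_ac)
  moreover have "(c \<otimes>\<^bsub>k\<^esub> d) \<odot>\<^bsub>TS\<^esub> x = c \<odot>\<^bsub>TS\<^esub> (d \<odot>\<^bsub>TS\<^esub> x)"
    if "c \<in> carrier k" "d \<in> carrier k" "x \<in> carrier TS" for c d x
    using that(3)
    by (induction x rule: tensor_induct)
      (simp_all add: that(1,2) tensor_simps T.smult_assoc1)
  moreover have "\<one>\<^bsub>k\<^esub> \<odot>\<^bsub>TS\<^esub> x = x" if "x \<in> carrier TS" for x
    using that by (induction x rule: tensor_induct) (simp_all add: tensor_simps)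
  ultimately have module: "Module.module k TS"
    using B.R_cring abelian_group_tensor
    by (intro moduleI) (simp_all add: smult_closed_tensor smult_add_tensor)
  have "(c \<odot>\<^bsub>TS\<^esub> x) \<otimes>\<^bsub>TS\<^esub> y = c \<odot>\<^bsub>TS\<^esub> (x \<otimes>\<^bsub>TS\<^esub> y) \<and>
      x \<otimes>\<^bsub>TS\<^esub> (c \<odot>\<^bsub>TS\<^esub> y) = c \<odot>\<^bsub>TS\<^esub> (x \<otimes>\<^bsub>TS\<^esub> y)"
    if "c \<in> carrier k" "x \<in> carrier TS" "y \<in> carrier TS" for c x y
    using that(2)
  proof (induction x rule: tensor_induct)
    case (pure t s)
    note 1 = this
    show ?case
      using that(3)
      by (induction y rule: tensor_induct)
        (simp_all add: 1 that(1) tensor_simps T.smult_mult_left T.smult_mult_right)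
  qed (simp_all add: that tensor_simps)
  then show ?thesis
    using module monoid tensor_distr abelian_group_tensor
    by (intro assoc_algebra.intro assoc_algebra_axioms.intro ring.intro ring_axioms.intro) simp_all
qed

sublocale TS: assoc_algebra k TS by (rule assoc_algebra_tensor)

text \<open>Scalars are defined through the left factor. Balancing with \<open>b\<close> equal to
  \<open>c\<close> times \<open>1\<close> moves them to the right one, because \<open>r\<close> and
  \<open>l\<close> are linear and unital and so both send this \<open>b\<close> to \<open>c\<close>
  times \<open>1\<close>.\<close>

lemma pure_smult_right:
  assumes "c \<in> carrier k" "t \<in> carrier T" "s \<in> carrier S"
  shows "c \<odot>\<^bsub>TS\<^esub> pure t s = pure t (c \<odot>\<^bsub>S\<^esub> s)"
proof -
  have "r (c \<odot>\<^bsub>B\<^esub> \<one>\<^bsub>B\<^esub>) = c \<odot>\<^bsub>T\<^esub> \<one>\<^bsub>T\<^esub>" "l (c \<odot>\<^bsub>B\<^esub> \<one>\<^bsub>B\<^esub>) = c \<odot>\<^bsub>S\<^esub> \<one>\<^bsub>S\<^esub>"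
    using r l assms(1) by (simp_all add: alg_hom_def ring_hom_one[of r B T] ring_hom_one[of l B S])
  then show ?thesis
    using pure_balanced[of t "c \<odot>\<^bsub>B\<^esub> \<one>\<^bsub>B\<^esub>" s] assms
    by (simp add: pure_smult_left T.smult_mult_right S.smult_mult_left)
qed

text \<open>The target is a bare abelian group, so that the slices of the associator are covered as
  well. The extension to the free group kills each relation, hence \<open>H\<close>, and descends to
  the quotient.\<close>

lemma tensor_additive_universal:
  fixes M :: "('a, 'b) ring_scheme"
  assumes "abelian_group M"
    and closed: "\<And>t s. t \<in> carrier T \<Longrightarrow> s \<in> carrier S \<Longrightarrow> p t s \<in> carrier M"
    and addl: "\<And>t t' s. t \<in> carrier T \<Longrightarrow> t' \<in> carrier T \<Longrightarrow> s \<in> carrier S \<Longrightarrow>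
      p (t \<oplus>\<^bsub>T\<^esub> t') s = p t s \<oplus>\<^bsub>M\<^esub> p t' s"
    and addr: "\<And>t s s'. t \<in> carrier T \<Longrightarrow> s \<in> carrier S \<Longrightarrow> s' \<in> carrier S \<Longrightarrow>
      p t (s \<oplus>\<^bsub>S\<^esub> s') = p t s \<oplus>\<^bsub>M\<^esub> p t s'"
    and balanced: "\<And>t b s. t \<in> carrier T \<Longrightarrow> b \<in> carrier B \<Longrightarrow> s \<in> carrier S \<Longrightarrow>
      p (t \<otimes>\<^bsub>T\<^esub> r b) s = p t (l b \<otimes>\<^bsub>S\<^esub> s)"
  obtains h where "h \<in> carrier TS \<rightarrow> carrier M"
    and "\<And>x y. x \<in> carrier TS \<Longrightarrow> y \<in> carrier TS \<Longrightarrow> h (x \<oplus>\<^bsub>TS\<^esub> y) = h x \<oplus>\<^bsub>M\<^esub> h y"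
    and "\<And>t s. t \<in> carrier T \<Longrightarrow> s \<in> carrier S \<Longrightarrow> h (pure t s) = p t s"
proof -
  interpret M: abelian_group M by (rule assms(1))
  have img: "(\<lambda>(t, s). p t s) ` (carrier T \<times> carrier S) \<subseteq> carrier (add_monoid M)"
    using closed by auto
  obtain f where f: "f \<in> hom G (add_monoid M)"
      "\<And>x. x \<in> carrier T \<times> carrier S \<Longrightarrow> f (frag_of x) = (\<lambda>(t, s). p t s) x"
    unfolding G_def using comm_group.free_Abelian_group_universal[OF M.a_comm_group img] by metis
  interpret f: group_hom G "add_monoid M" f
    by (intro group_hom.intro group_hom_axioms.intro G.is_group M.a_group f(1))
  have f_closed: "f x \<in> carrier M" if "x \<in> carrier G" for x
    using f.hom_closed[OF that] by simp
  have f_add: "f (x + y) = f x \<oplus>\<^bsub>M\<^esub> f y" if "x \<in> carrier G" "y \<in> carrier G" for x y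
    using f.hom_mult[OF that] by simp
  have f_diff: "f (x - y) = f x \<ominus>\<^bsub>M\<^esub> f y" if "x \<in> carrier G" "y \<in> carrier G" for x y
    using f_add[OF G_minus[OF that] that(2)] f_closed that G_minus[OF that]
    by (simp add: a_minus_def M.add.inv_solve_right del: G_simps(1))
  have f_of: "f (frag_of (t, s)) = p t s" if "t \<in> carrier T" "s \<in> carrier S" for t s
    using f(2) that by simp
  \<comment> \<open>The value of an additive relation under \<open>f\<close>: the image of a sum,
    minus the images of both summands.\<close>
  have cancel: "a \<oplus>\<^bsub>M\<^esub> b \<ominus>\<^bsub>M\<^esub> a \<ominus>\<^bsub>M\<^esub> b = \<zero>\<^bsub>M\<^esub>"
    if "a \<in> carrier M" "b \<in> carrier M" for a b
  proof -
    have "b \<oplus>\<^bsub>M\<^esub> a \<ominus>\<^bsub>M\<^esub> a = b"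
      using that by (simp add: a_minus_def M.a_assoc M.r_neg)
    then show ?thesis
      using that by (simp add: M.a_comm[of a b] a_minus_def M.r_neg)
  qed
  have f_H: "f x = \<zero>\<^bsub>M\<^esub>" if "x \<in> H" for x
    using that
  proof (induction x rule: H_induct)
    case (rel x)
    then show ?case
    proof (cases x rule: rels_cases)
      case (addl t1 t2 s)
      then show ?thesis
        using closed assms(3)
        by (simp add: f_diff f_of G_minus cancel del: G_simps(1))
    next
      case (addr t s1 s2)
      then show ?thesis
        using closed assms(4)
        by (simp add: f_diff f_of G_minus cancel del: G_simps(1))
    next
      case (balance t b s)
      then show ?thesis
        using closed balanced
        by (simp add: f_diff f_of a_minus_def M.r_neg del: G_simps(1))
    qed
  qed (simp add: f_diff a_minus_def M.r_neg del: G_simps(1))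
  have f_cong: "f x = f y" if "x \<in> carrier G" "y \<in> carrier G" "proj x = proj y" for x y
  proof -
    have "f x \<ominus>\<^bsub>M\<^esub> f y = \<zero>\<^bsub>M\<^esub>"
      using that f_H[of "x - y"] f_diff[of x y] by (simp add: proj_eq_iff del: G_simps(1))
    then show ?thesis
      using M.minus_equality[of "f x" "\<ominus>\<^bsub>M\<^esub> f y"] f_closed that
      by (simp add: a_minus_def del: G_simps(1))
  qed
  \<comment> \<open>Any representative may be chosen, since by \<open>f_cong\<close> the value of
    \<open>f\<close> depends on \<open>proj x\<close> only.\<close>
  define h where "h z = f (SOME x. x \<in> carrier G \<and> proj x = z)" for z
  have h: "h (proj x) = f x" if "x \<in> carrier G" for x
    unfolding h_def
    by (rule f_cong) (use someI[of "\<lambda>y. y \<in> carrier G \<and> proj y = proj x" x] that in simp_all)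
  show thesis
  proof (rule that)
    show "h \<in> carrier TS \<rightarrow> carrier M"
      unfolding carrier_tensor using h f_closed by auto
  next
    fix x y assume "x \<in> carrier TS" "y \<in> carrier TS"
    then obtain a b where "a \<in> carrier G" "b \<in> carrier G" "x = proj a" "y = proj b"
      unfolding carrier_tensor by blast
    moreover from this have "a + b \<in> carrier G"
      using G.m_closed[of a b] by simp
    ultimately show "h (x \<oplus>\<^bsub>TS\<^esub> y) = h x \<oplus>\<^bsub>M\<^esub> h y"
      by (simp add: add_proj h f_add del: G_simps(1))
  next
    fix t s assume "t \<in> carrier T" "s \<in> carrier S"
    then show "h (pure t s) = p t s"
      by (simp add: pure_eq h f_of del: G_simps(1))
  qed
qed

end

section \<open>Homomorphisms out of tensor products\<close>

lemma alg_homI: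
  assumes "f \<in> extensional (carrier A)"
    and "\<And>x. x \<in> carrier A \<Longrightarrow> f x \<in> carrier B"
    and "\<And>x y. x \<in> carrier A \<Longrightarrow> y \<in> carrier A \<Longrightarrow> f (x \<otimes>\<^bsub>A\<^esub> y) = f x \<otimes>\<^bsub>B\<^esub> f y"
    and "\<And>x y. x \<in> carrier A \<Longrightarrow> y \<in> carrier A \<Longrightarrow> f (x \<oplus>\<^bsub>A\<^esub> y) = f x \<oplus>\<^bsub>B\<^esub> f y"
    and "f \<one>\<^bsub>A\<^esub> = \<one>\<^bsub>B\<^esub>"
    and "\<And>c x. c \<in> carrier k \<Longrightarrow> x \<in> carrier A \<Longrightarrow> f (c \<odot>\<^bsub>A\<^esub> x) = c \<odot>\<^bsub>B\<^esub> f x"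
  shows "f \<in> alg_hom k A B"
  using assms by (auto simp: alg_hom_def intro!: ring_hom_memI)

lemma alg_homD:
  assumes "f \<in> alg_hom k A B"
  shows "f \<in> extensional (carrier A)"
    and "\<And>x. x \<in> carrier A \<Longrightarrow> f x \<in> carrier B"
    and "\<And>x y. x \<in> carrier A \<Longrightarrow> y \<in> carrier A \<Longrightarrow> f (x \<otimes>\<^bsub>A\<^esub> y) = f x \<otimes>\<^bsub>B\<^esub> f y"
    and "\<And>x y. x \<in> carrier A \<Longrightarrow> y \<in> carrier A \<Longrightarrow> f (x \<oplus>\<^bsub>A\<^esub> y) = f x \<oplus>\<^bsub>B\<^esub> f y"
    and "f \<one>\<^bsub>A\<^esub> = \<one>\<^bsub>B\<^esub>"
    and "\<And>c x. c \<in> carrier k \<Longrightarrow> x \<in> carrier A \<Longrightarrow> f (c \<odot>\<^bsub>A\<^esub> x) = c \<odot>\<^bsub>B\<^esub> f x"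
  using assms by (auto simp: alg_hom_def ring_hom_closed ring_hom_mult ring_hom_add ring_hom_one)

lemma alg_hom_compose:
  assumes f: "f \<in> alg_hom k A B" and g: "g \<in> alg_hom k B C" and A: "assoc_algebra k A"
  shows "compose (carrier A) g f \<in> alg_hom k A C"
proof -
  interpret A: assoc_algebra k A by (rule A)
  show ?thesis
    by (rule alg_homI) (simp_all add: compose_eq alg_homD[OF f] alg_homD[OF g])
qed

lemma alg_hom_id:
  assumes "assoc_algebra k A"
  shows "(\<lambda>x \<in> carrier A. x) \<in> alg_hom k A A"
proof -
  interpret A: assoc_algebra k A by (rule assms)
  show ?thesis
    by (rule alg_homI) simp_all
qed

text \<open>What a map on pairs must satisfy to extend to an algebra homomorphism. The law for
  products of pairs also encodes that the images of the two factors commute in \<open>M\<close>.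
  Scalars are tested on the first factor, where \<open>frag_smult\<close> lets them act.\<close>

definition balanced_hom :: "'k ring \<Rightarrow> ('k, 'u) module \<Rightarrow> ('k, 'u) module \<Rightarrow> ('u \<Rightarrow> 'u) \<Rightarrow>
    ('k, 'u) module \<Rightarrow> ('u \<Rightarrow> 'u) \<Rightarrow> ('k, 'a) module \<Rightarrow> ('u \<Rightarrow> 'u \<Rightarrow> 'a) \<Rightarrow> bool" where
  "balanced_hom k B T r S l M p \<longleftrightarrow>
    (\<forall>t \<in> carrier T. \<forall>s \<in> carrier S. p t s \<in> carrier M)
  \<and> (\<forall>t \<in> carrier T. \<forall>t' \<in> carrier T. \<forall>s \<in> carrier S. p (t \<oplus>\<^bsub>T\<^esub> t') s = p t s \<oplus>\<^bsub>M\<^esub> p t' s)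
  \<and> (\<forall>t \<in> carrier T. \<forall>s \<in> carrier S. \<forall>s' \<in> carrier S. p t (s \<oplus>\<^bsub>S\<^esub> s') = p t s \<oplus>\<^bsub>M\<^esub> p t s')
  \<and> (\<forall>t \<in> carrier T. \<forall>b \<in> carrier B. \<forall>s \<in> carrier S. p (t \<otimes>\<^bsub>T\<^esub> r b) s = p t (l b \<otimes>\<^bsub>S\<^esub> s))
  \<and> (\<forall>t \<in> carrier T. \<forall>t' \<in> carrier T. \<forall>s \<in> carrier S. \<forall>s' \<in> carrier S.
       p (t \<otimes>\<^bsub>T\<^esub> t') (s \<otimes>\<^bsub>S\<^esub> s') = p t s \<otimes>\<^bsub>M\<^esub> p t' s')
  \<and> p \<one>\<^bsub>T\<^esub> \<one>\<^bsub>S\<^esub> = \<one>\<^bsub>M\<^esub>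
  \<and> (\<forall>c \<in> carrier k. \<forall>t \<in> carrier T. \<forall>s \<in> carrier S. p (c \<odot>\<^bsub>T\<^esub> t) s = c \<odot>\<^bsub>M\<^esub> p t s)"

section \<open>The universal property for algebra homomorphisms\<close>

context tensor_product
begin

text \<open>Asks for additivity alone, so that it also compares composites that are not known to be
  homomorphisms, as in the bijectivity of the unitors.\<close>

lemma additive_eqI:
  assumes "\<And>x y. x \<in> carrier TS \<Longrightarrow> y \<in> carrier TS \<Longrightarrow> f (x \<oplus>\<^bsub>TS\<^esub> y) = add M (f x) (f y)"
    and "\<And>x y. x \<in> carrier TS \<Longrightarrow> y \<in> carrier TS \<Longrightarrow> g (x \<oplus>\<^bsub>TS\<^esub> y) = add M (g x) (g y)"
    and "\<And>t s. t \<in> carrier T \<Longrightarrow> s \<in> carrier S \<Longrightarrow> f (pure t s) = g (pure t s)"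
    and "x \<in> carrier TS"
  shows "f x = g x"
  using assms(4) by (induction x rule: tensor_induct) (simp_all add: assms(1-3))

lemma alg_hom_eqI:
  assumes f: "f \<in> alg_hom k TS M" and g: "g \<in> alg_hom k TS M"
    and eq: "\<And>t s. t \<in> carrier T \<Longrightarrow> s \<in> carrier S \<Longrightarrow> f (pure t s) = g (pure t s)"
  shows "f = g"
  by (rule extensionalityI[OF alg_homD(1)[OF f] alg_homD(1)[OF g]])
    (rule additive_eqI[OF alg_homD(4)[OF f] alg_homD(4)[OF g] eq])

text \<open>The additive extension respects products and scalars because both sides of each law are
  additive and agree on pure tensors. Unique existence is what the definite description in
  \<open>tensor_ind\<close> calls for.\<close>

lemma tensor_universal:
  assumes M: "assoc_algebra k M" and p: "balanced_hom k B T r S l M p"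
  shows "\<exists>!h. h \<in> alg_hom k TS M \<and> (\<forall>t \<in> carrier T. \<forall>s \<in> carrier S. h (pure t s) = p t s)"
proof -
  interpret M: assoc_algebra k M by (rule M)
  note p' = p[unfolded balanced_hom_def]
  obtain h where h: "h \<in> carrier TS \<rightarrow> carrier M"
    and add: "\<And>x y. x \<in> carrier TS \<Longrightarrow> y \<in> carrier TS \<Longrightarrow> h (x \<oplus>\<^bsub>TS\<^esub> y) = h x \<oplus>\<^bsub>M\<^esub> h y"
    and h_pure: "\<And>t s. t \<in> carrier T \<Longrightarrow> s \<in> carrier S \<Longrightarrow> h (pure t s) = p t s"
    by (rule tensor_additive_universal[OF M.abelian_group_axioms, of p]) (use p' in auto)
  have closed: "h x \<in> carrier M" if "x \<in> carrier TS" for x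
    using h that by blast
  have mult: "h (x \<otimes>\<^bsub>TS\<^esub> y) = h x \<otimes>\<^bsub>M\<^esub> h y" if "x \<in> carrier TS" "y \<in> carrier TS" for x y
    using that(1)
  proof (induction x rule: tensor_induct)
    case (pure t s)
    note 1 = this
    show ?case
      using that(2)
      by (induction y rule: tensor_induct)
        (simp_all add: 1 that(1) tensor_simps add h_pure p' closed M.r_distr)
  qed (simp_all add: that tensor_simps add closed M.l_distr)
  have smult: "h (c \<odot>\<^bsub>TS\<^esub> x) = c \<odot>\<^bsub>M\<^esub> h x" if "c \<in> carrier k" "x \<in> carrier TS" for c x
    using that(2)
    by (induction x rule: tensor_induct)
      (simp_all add: that(1) tensor_simps add h_pure p' closed M.smult_r_distr)
  have "restrict h (carrier TS) \<in> alg_hom k TS M"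
    by (rule alg_homI) (simp_all add: closed mult add smult one_tensor h_pure p')
  moreover have "restrict h (carrier TS) (pure t s) = p t s"
    if "t \<in> carrier T" "s \<in> carrier S" for t s
    using that h_pure by simp
  ultimately show ?thesis
    by (intro ex1I[of _ "restrict h (carrier TS)"]) (auto intro: alg_hom_eqI)
qed

end

section \<open>Composites of cospans\<close>

lemma is_cospanD:
  assumes "is_cospan k X"
  shows "algebra k (csrc X)" "algebra k (ctrg X)" "assoc_algebra k (apex X)"
    "lleg X \<in> alg_hom k (ctrg X) (apex X)" "lleg X ` carrier (ctrg X) \<subseteq> centre (apex X)"
    "rleg X \<in> alg_hom k (csrc X) (apex X)" "rleg X ` carrier (csrc X) \<subseteq> centre (apex X)"
  using assms by (auto simp: is_cospan_def)

lemma algebra_imp_assoc_algebra: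
  assumes "algebra k A" shows "assoc_algebra k A"
proof -
  interpret algebra k A by (rule assms)
  show ?thesis
    by unfold_locales (simp add: smult_assoc2, metis m_comm smult_assoc2 smult_closed)
qed

locale composable =
  fixes k :: "'k ring" and X Y :: "('k, 'u::infinite) cospan"
  assumes X: "is_cospan k X" and Y: "is_cospan k Y" and composable: "csrc X = ctrg Y"

text \<open>The rewrites restate all facts on tensor products in terms of \<open>ctensor\<close> and
  \<open>ptensor\<close>, the forms that occur in composites of cospans.\<close>

sublocale composable \<subseteq> tensor_product k "csrc X" "apex X" "apex Y" "rleg X" "lleg Y"
  rewrites "tensor (csrc X) (apex X) (rleg X) (apex Y) (lleg Y) = ctensor X Y"
    and "pure_tensor (csrc X) (apex X) (rleg X) (apex Y) (lleg Y) = ptensor X Y"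
  by (rule tensor_product.intro, insert is_cospanD[OF X] is_cospanD[OF Y])
    (simp_all add: composable ctensor_def ptensor_def)

context composable
begin

lemma tensor_ind:
  assumes "assoc_algebra k M"
    and "balanced_hom k (csrc X) (apex X) (rleg X) (apex Y) (lleg Y) M p"
  shows "tensor_ind k X Y M p \<in> alg_hom k (ctensor X Y) M"
    and "t \<in> carrier (apex X) \<Longrightarrow> s \<in> carrier (apex Y) \<Longrightarrow>
      tensor_ind k X Y M p (ptensor X Y t s) = p t s"
  using theI'[OF tensor_universal[OF assms]] unfolding tensor_ind_def by blast+

lemma lleg_comp:
  assumes "c \<in> carrier (ctrg X)"
  shows "lleg (cospan_comp X Y) c = ptensor X Y (lleg X c) \<one>\<^bsub>apex Y\<^esub>"
  using assms by (simp add: cospan_comp_def)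

lemma rleg_comp:
  assumes "a \<in> carrier (csrc Y)"
  shows "rleg (cospan_comp X Y) a = ptensor X Y \<one>\<^bsub>apex X\<^esub> (rleg Y a)"
  using assms by (simp add: cospan_comp_def)

text \<open>The image of either leg consists of pure tensors with \<open>1\<close> in one factor and
  a central element in the other; these commute with pure tensors, hence with everything.\<close>

lemma is_cospan_comp: "is_cospan k (cospan_comp X Y)"
proof -
  note X' = is_cospanD[OF X] and Y' = is_cospanD[OF Y]
  interpret XT: algebra k "ctrg X" by (rule X'(2))
  interpret YS: algebra k "csrc Y" by (rule Y'(1))
  have lc: "lleg X c \<in> carrier (apex X)" "\<And>t. t \<in> carrier (apex X) \<Longrightarrow>
      t \<otimes>\<^bsub>apex X\<^esub> lleg X c = lleg X c \<otimes>\<^bsub>apex X\<^esub> t" if "c \<in> carrier (ctrg X)" for c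
    using X'(5) that by (auto simp: centre_def)
  have rc: "rleg Y c \<in> carrier (apex Y)" "\<And>t. t \<in> carrier (apex Y) \<Longrightarrow>
      t \<otimes>\<^bsub>apex Y\<^esub> rleg Y c = rleg Y c \<otimes>\<^bsub>apex Y\<^esub> t" if "c \<in> carrier (csrc Y)" for c
    using Y'(7) that by (auto simp: centre_def)
  have l: "lleg (cospan_comp X Y) \<in> alg_hom k (ctrg X) (ctensor X Y)"
    by (rule alg_homI)
      (simp_all add: lleg_comp lc(1) alg_homD[OF X'(4)] tensor_simps pure_add_left one_tensor,
       simp add: cospan_comp_def)
  \<comment> \<open>Linearity of the right leg puts the scalar on the second factor, hence
    \<open>pure_smult_right\<close>.\<close>
  have r: "rleg (cospan_comp X Y) \<in> alg_hom k (csrc Y) (ctensor X Y)"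
    by (rule alg_homI)
      (simp_all add: rleg_comp rc(1) alg_homD[OF Y'(6)] pure_mult pure_smult_right pure_add_right one_tensor,
       simp add: cospan_comp_def)
  have "z \<otimes>\<^bsub>ctensor X Y\<^esub> lleg (cospan_comp X Y) c = lleg (cospan_comp X Y) c \<otimes>\<^bsub>ctensor X Y\<^esub> z"
    if "c \<in> carrier (ctrg X)" "z \<in> carrier (ctensor X Y)" for c z
    using that(2) by (induction z rule: tensor_induct) (simp_all add: lleg_comp lc that(1) tensor_simps)
  moreover have "z \<otimes>\<^bsub>ctensor X Y\<^esub> rleg (cospan_comp X Y) c = rleg (cospan_comp X Y) c \<otimes>\<^bsub>ctensor X Y\<^esub> z"
    if "c \<in> carrier (csrc Y)" "z \<in> carrier (ctensor X Y)" for c z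
    using that(2) by (induction z rule: tensor_induct) (simp_all add: rleg_comp rc that(1) tensor_simps)
  moreover have "csrc (cospan_comp X Y) = csrc Y" "ctrg (cospan_comp X Y) = ctrg X"
      "apex (cospan_comp X Y) = ctensor X Y"
    by (simp_all add: cospan_comp_def)
  ultimately show ?thesis
    using l r alg_homD(2)[OF l] alg_homD(2)[OF r] X' Y' assoc_algebra_tensor
    by (auto simp: is_cospan_def centre_def)
qed

end

section \<open>Morphisms of cospans\<close>

lemma cospan_comp_simps [simp]:
  "csrc (cospan_comp X Y) = csrc Y" "ctrg (cospan_comp X Y) = ctrg X"
  "apex (cospan_comp X Y) = ctensor X Y"
  by (simp_all add: cospan_comp_def)

lemma is_cospan_morD:
  assumes "is_cospan_mor k \<phi>"
  shows "is_cospan k (mdom \<phi>)" "is_cospan k (mcod \<phi>)"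
    "csrc (mcod \<phi>) = csrc (mdom \<phi>)" "ctrg (mcod \<phi>) = ctrg (mdom \<phi>)"
    "mfun \<phi> \<in> alg_hom k (apex (mdom \<phi>)) (apex (mcod \<phi>))"
    "\<And>b. b \<in> carrier (ctrg (mdom \<phi>)) \<Longrightarrow> mfun \<phi> (lleg (mdom \<phi>) b) = lleg (mcod \<phi>) b"
    "\<And>a. a \<in> carrier (csrc (mdom \<phi>)) \<Longrightarrow> mfun \<phi> (rleg (mdom \<phi>) a) = rleg (mcod \<phi>) a"
  using assms by (auto simp: is_cospan_mor_def)

lemma mfun_closed:
  assumes "is_cospan_mor k \<phi>" "x \<in> carrier (apex (mdom \<phi>))"
  shows "mfun \<phi> x \<in> carrier (apex (mcod \<phi>))"
  using alg_homD(2)[OF is_cospan_morD(5)[OF assms(1)]] assms(2) .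

lemma cospan_mor_eqI:
  fixes \<phi> \<psi> :: "('k, 'u) cospan_mor"
  assumes "is_cospan_mor k \<phi>" "is_cospan_mor k \<psi>" "mdom \<phi> = mdom \<psi>" "mcod \<phi> = mcod \<psi>"
    and "\<And>x. x \<in> carrier (apex (mdom \<phi>)) \<Longrightarrow> mfun \<phi> x = mfun \<psi> x"
  shows "\<phi> = \<psi>"
proof -
  have "mfun \<phi> = mfun \<psi>"
    using assms alg_homD(1)[OF is_cospan_morD(5)[OF assms(1)]]
      alg_homD(1)[OF is_cospan_morD(5)[OF assms(2)]]
    by (intro extensionalityI) auto
  then show ?thesis using assms by simp
qed

lemma cospan_mor_id_simps [simp]:
  "mdom (cospan_mor_id X) = X" "mcod (cospan_mor_id X) = X"
  "x \<in> carrier (apex X) \<Longrightarrow> mfun (cospan_mor_id X) x = x"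
  by (simp_all add: cospan_mor_id_def)

lemma is_cospan_mor_id:
  assumes "is_cospan k X" shows "is_cospan_mor k (cospan_mor_id X)"
  using assms is_cospanD[OF assms] alg_homD(2) alg_hom_id
  unfolding is_cospan_mor_def cospan_mor_id_def by fastforce

lemma cospan_mor_comp_simps [simp]:
  "mdom (cospan_mor_comp \<psi> \<phi>) = mdom \<phi>" "mcod (cospan_mor_comp \<psi> \<phi>) = mcod \<psi>"
  "x \<in> carrier (apex (mdom \<phi>)) \<Longrightarrow> mfun (cospan_mor_comp \<psi> \<phi>) x = mfun \<psi> (mfun \<phi> x)"
  by (simp_all add: cospan_mor_comp_def compose_eq)

lemma is_cospan_mor_comp:
  assumes \<phi>: "is_cospan_mor k \<phi>" and \<psi>: "is_cospan_mor k \<psi>" and eq: "mcod \<phi> = mdom \<psi>"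
  shows "is_cospan_mor k (cospan_mor_comp \<psi> \<phi>)"
proof -
  note \<phi>' = is_cospan_morD[OF \<phi>] and \<psi>' = is_cospan_morD[OF \<psi>]
  have "mfun (cospan_mor_comp \<psi> \<phi>) \<in> alg_hom k (apex (mdom \<phi>)) (apex (mcod \<psi>))"
    unfolding cospan_mor_comp_def
    using alg_hom_compose[OF \<phi>'(5) _ is_cospanD(3)[OF \<phi>'(1)]] \<psi>'(5) eq by simp
  moreover have "lleg (mdom \<phi>) b \<in> carrier (apex (mdom \<phi>))" if "b \<in> carrier (ctrg (mdom \<phi>))" for b
    using alg_homD(2)[OF is_cospanD(4)[OF \<phi>'(1)] that] .
  moreover have "rleg (mdom \<phi>) b \<in> carrier (apex (mdom \<phi>))" if "b \<in> carrier (csrc (mdom \<phi>))" for b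
    using alg_homD(2)[OF is_cospanD(6)[OF \<phi>'(1)] that] .
  moreover have "csrc (mdom \<psi>) = csrc (mdom \<phi>)" "ctrg (mdom \<psi>) = ctrg (mdom \<phi>)"
    using \<phi>'(3,4) eq by simp_all
  ultimately show ?thesis
    using \<phi>' \<psi>' eq by (simp add: is_cospan_mor_def)
qed

lemma cospan_hcomp_simps [simp]:
  "mdom (cospan_hcomp k \<psi> \<phi>) = cospan_comp (mdom \<psi>) (mdom \<phi>)"
  "mcod (cospan_hcomp k \<psi> \<phi>) = cospan_comp (mcod \<psi>) (mcod \<phi>)"
  by (simp_all add: cospan_hcomp_def)

text \<open>The pairing is balanced over the shared middle algebra because \<open>\<psi>\<close>
  preserves right legs and \<open>\<phi>\<close> preserves left legs.\<close>

lemma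
  fixes \<phi> \<psi> :: "('k, 'u::infinite) cospan_mor"
  assumes \<phi>: "is_cospan_mor k \<phi>" and \<psi>: "is_cospan_mor k \<psi>"
    and comp: "csrc (mdom \<psi>) = ctrg (mdom \<phi>)"
  shows is_cospan_mor_hcomp: "is_cospan_mor k (cospan_hcomp k \<psi> \<phi>)"
    and mfun_hcomp: "\<And>t s. t \<in> carrier (apex (mdom \<psi>)) \<Longrightarrow> s \<in> carrier (apex (mdom \<phi>)) \<Longrightarrow>
      mfun (cospan_hcomp k \<psi> \<phi>) (ptensor (mdom \<psi>) (mdom \<phi>) t s)
        = ptensor (mcod \<psi>) (mcod \<phi>) (mfun \<psi> t) (mfun \<phi> s)"
proof -
  note \<phi>' = is_cospan_morD[OF \<phi>] and \<psi>' = is_cospan_morD[OF \<psi>]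
  interpret d: composable k "mdom \<psi>" "mdom \<phi>"
    using \<phi>' \<psi>' comp by unfold_locales
  interpret c: composable k "mcod \<psi>" "mcod \<phi>"
    using \<phi>' \<psi>' comp by (intro composable.intro) simp_all
  note h\<phi> = alg_homD[OF \<phi>'(5)] and h\<psi> = alg_homD[OF \<psi>'(5)]
  have bal: "balanced_hom k (csrc (mdom \<psi>)) (apex (mdom \<psi>)) (rleg (mdom \<psi>)) (apex (mdom \<phi>))
      (lleg (mdom \<phi>)) (ctensor (mcod \<psi>) (mcod \<phi>))
      (\<lambda>t s. ptensor (mcod \<psi>) (mcod \<phi>) (mfun \<psi> t) (mfun \<phi> s))"
    unfolding balanced_hom_def
    by (intro conjI ballI)
      (simp_all add: h\<phi>(2-) h\<psi>(2-) \<phi>'(6) \<psi>'(7) c.pure_add_left c.pure_add_right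
        c.pure_mult c.pure_smult_left c.one_tensor c.pure_balanced[unfolded \<psi>'(3)] comp[symmetric])
  note ind = d.tensor_ind[OF c.assoc_algebra_tensor bal]
  have f: "mfun (cospan_hcomp k \<psi> \<phi>)
      \<in> alg_hom k (ctensor (mdom \<psi>) (mdom \<phi>)) (ctensor (mcod \<psi>) (mcod \<phi>))"
    using ind(1) by (simp add: cospan_hcomp_def)
  show *: "mfun (cospan_hcomp k \<psi> \<phi>) (ptensor (mdom \<psi>) (mdom \<phi>) t s)
        = ptensor (mcod \<psi>) (mcod \<phi>) (mfun \<psi> t) (mfun \<phi> s)"
    if "t \<in> carrier (apex (mdom \<psi>))" "s \<in> carrier (apex (mdom \<phi>))" for t s
    using ind(2)[OF that] by (simp add: cospan_hcomp_def)
  have lr: "lleg (mdom \<psi>) b \<in> carrier (apex (mdom \<psi>))" if "b \<in> carrier (ctrg (mdom \<psi>))" for b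
    using alg_homD(2)[OF is_cospanD(4)[OF \<psi>'(1)] that] .
  have rr: "rleg (mdom \<phi>) b \<in> carrier (apex (mdom \<phi>))" if "b \<in> carrier (csrc (mdom \<phi>))" for b
    using alg_homD(2)[OF is_cospanD(6)[OF \<phi>'(1)] that] .
  show "is_cospan_mor k (cospan_hcomp k \<psi> \<phi>)"
    unfolding is_cospan_mor_def
    by (simp add: d.is_cospan_comp c.is_cospan_comp f \<phi>'(3,4) \<psi>'(3,4) d.lleg_comp c.lleg_comp
        d.rleg_comp c.rleg_comp * lr rr \<psi>'(6) \<phi>'(7) h\<phi>(5) h\<psi>(5))
qed

lemma CAlg_simps [simp]:
  "objs (CAlg k) = {A. algebra k A}" "arrs (CAlg k) = {X. is_cospan k X}"
  "asrc (CAlg k) = csrc" "atrg (CAlg k) = ctrg"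
  "cells (CAlg k) = {\<phi>. is_cospan_mor k \<phi>}" "cdom (CAlg k) = mdom" "ccod (CAlg k) = mcod"
  "id1 (CAlg k) = cospan_id" "comp1 (CAlg k) = cospan_comp"
  "id2 (CAlg k) = cospan_mor_id" "vcomp (CAlg k) = cospan_mor_comp" "hcomp (CAlg k) = cospan_hcomp k"
  "associator (CAlg k) = cospan_assoc k"
  "lunitor (CAlg k) = cospan_lunitor k" "runitor (CAlg k) = cospan_runitor k"
  by (simp_all add: CAlg_def)

section \<open>Typing of 1-cells and 2-cells, and invertible 2-cells\<close>

lemma hom1_CAlg: "X \<in> hom1 (CAlg k) A B \<longleftrightarrow> is_cospan k X \<and> csrc X = A \<and> ctrg X = B"
  by (simp add: hom1_def)

lemma hom2_CAlg: "\<phi> \<in> hom2 (CAlg k) X Y \<longleftrightarrow> is_cospan_mor k \<phi> \<and> mdom \<phi> = X \<and> mcod \<phi> = Y"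
  by (simp add: hom2_def)

text \<open>The inverse map of a bijective homomorphism is again one, and it preserves the legs
  because \<open>\<phi>\<close> does. So a structure 2-cell is shown to be invertible by exhibiting
  any two-sided inverse map.\<close>

lemma is_cospan_mor_inverse:
  fixes \<phi> :: "('k, 'u) cospan_mor"
  assumes \<phi>: "is_cospan_mor k \<phi>"
    and bij: "bij_betw (mfun \<phi>) (carrier (apex (mdom \<phi>))) (carrier (apex (mcod \<phi>)))"
  defines "\<psi> \<equiv> \<lparr>mdom = mcod \<phi>,
    mfun = restrict (inv_into (carrier (apex (mdom \<phi>))) (mfun \<phi>)) (carrier (apex (mcod \<phi>))),
    mcod = mdom \<phi>\<rparr>"
  shows "is_cospan_mor k \<psi>" "cospan_mor_comp \<psi> \<phi> = cospan_mor_id (mdom \<phi>)"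
    "cospan_mor_comp \<phi> \<psi> = cospan_mor_id (mcod \<phi>)"
proof -
  note \<phi>' = is_cospan_morD[OF \<phi>]
  note h = alg_homD[OF \<phi>'(5)]
  interpret D: assoc_algebra k "apex (mdom \<phi>)" by (rule is_cospanD(3)[OF \<phi>'(1)])
  interpret C: assoc_algebra k "apex (mcod \<phi>)" by (rule is_cospanD(3)[OF \<phi>'(2)])
  have 1: "mfun \<psi> (mfun \<phi> x) = x" if "x \<in> carrier (apex (mdom \<phi>))" for x
    using that bij h(2) by (simp add: \<psi>_def bij_betw_def)
  have 2: "mfun \<phi> (mfun \<psi> y) = y" "mfun \<psi> y \<in> carrier (apex (mdom \<phi>))"
    if "y \<in> carrier (apex (mcod \<phi>))" for y
    using that bij by (auto simp: \<psi>_def bij_betw_def inv_into_into f_inv_into_f)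
  \<comment> \<open>A value of \<open>\<psi>\<close> is identified by applying \<open>\<phi>\<close>
    to the candidate, which turns each law for \<open>\<psi>\<close> into the same law for
    \<open>\<phi>\<close>.\<close>
  have eqI: "mfun \<psi> y = x" if "x \<in> carrier (apex (mdom \<phi>))" "mfun \<phi> x = y" for x y
    using 1 that by blast
  have "mfun \<psi> \<in> alg_hom k (apex (mcod \<phi>)) (apex (mdom \<phi>))"
  proof (rule alg_homI)
    show "mfun \<psi> \<in> extensional (carrier (apex (mcod \<phi>)))"
      by (simp add: \<psi>_def)
  qed (auto intro!: eqI simp: 2 h)
  moreover have "mfun \<psi> (lleg (mcod \<phi>) b) = lleg (mdom \<phi>) b" if "b \<in> carrier (ctrg (mdom \<phi>))" for b
    using \<phi>'(6)[OF that] 1 alg_homD(2)[OF is_cospanD(4)[OF \<phi>'(1)] that] by metis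
  moreover have "mfun \<psi> (rleg (mcod \<phi>) b) = rleg (mdom \<phi>) b" if "b \<in> carrier (csrc (mdom \<phi>))" for b
    using \<phi>'(7)[OF that] 1 alg_homD(2)[OF is_cospanD(6)[OF \<phi>'(1)] that] by metis
  moreover have [simp]: "mdom \<psi> = mcod \<phi>" "mcod \<psi> = mdom \<phi>"
    by (simp_all add: \<psi>_def)
  ultimately show \<psi>: "is_cospan_mor k \<psi>"
    using \<phi>' by (simp add: is_cospan_mor_def)
  show "cospan_mor_comp \<psi> \<phi> = cospan_mor_id (mdom \<phi>)"
    by (rule cospan_mor_eqI[of k])
      (simp_all add: is_cospan_mor_comp \<phi> \<psi> is_cospan_mor_id \<phi>' 1)
  show "cospan_mor_comp \<phi> \<psi> = cospan_mor_id (mcod \<phi>)"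
    by (rule cospan_mor_eqI[of k])
      (simp_all add: is_cospan_mor_comp \<phi> \<psi> is_cospan_mor_id \<phi>' 2)
qed

lemma iso2_CAlgI:
  assumes "is_cospan_mor k \<phi>" "mdom \<phi> = X" "mcod \<phi> = Y"
    and "bij_betw (mfun \<phi>) (carrier (apex (mdom \<phi>))) (carrier (apex (mcod \<phi>)))"
  shows "\<phi> \<in> iso2 (CAlg k) X Y"
  using is_cospan_mor_inverse[OF assms(1,4)] assms(1-3)
  unfolding iso2_def
  by (auto simp: hom2_CAlg
      intro!: bexI[of _ "\<lparr>mdom = mcod \<phi>, mfun = restrict (inv_into (carrier (apex (mdom \<phi>)))
        (mfun \<phi>)) (carrier (apex (mcod \<phi>))), mcod = mdom \<phi>\<rparr>"])

context composable
begin

lemma cospan_comp_mor_eqI: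
  assumes "is_cospan_mor k \<phi>" "is_cospan_mor k \<psi>" "mdom \<phi> = cospan_comp X Y" "mdom \<psi> = cospan_comp X Y"
    and "mcod \<phi> = mcod \<psi>"
    and "\<And>t s. t \<in> carrier (apex X) \<Longrightarrow> s \<in> carrier (apex Y) \<Longrightarrow>
      mfun \<phi> (ptensor X Y t s) = mfun \<psi> (ptensor X Y t s)"
  shows "\<phi> = \<psi>"
proof -
  have "mfun \<phi> = mfun \<psi>"
    by (rule alg_hom_eqI[of _ "apex (mcod \<phi>)"])
      (use is_cospan_morD(5)[OF assms(1)] is_cospan_morD(5)[OF assms(2)] assms in simp_all)
  then show ?thesis using assms by simp
qed

end

section \<open>Unitors\<close>

lemma cospan_id_simps [simp]:
  "csrc (cospan_id A) = A" "ctrg (cospan_id A) = A" "apex (cospan_id A) = A"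
  "x \<in> carrier A \<Longrightarrow> lleg (cospan_id A) x = x" "x \<in> carrier A \<Longrightarrow> rleg (cospan_id A) x = x"
  by (simp_all add: cospan_id_def)

lemma is_cospan_id:
  assumes "algebra k A" shows "is_cospan k (cospan_id A)"
proof -
  interpret algebra k A by (rule assms)
  show ?thesis
    using assms algebra_imp_assoc_algebra[OF assms] alg_hom_id[OF algebra_imp_assoc_algebra[OF assms]]
    by (auto simp: is_cospan_def cospan_id_def centre_def m_comm)
qed

lemma unitor_dom_cod [simp]:
  "mdom (cospan_lunitor k X) = cospan_comp (cospan_id (ctrg X)) X" "mcod (cospan_lunitor k X) = X"
  "mdom (cospan_runitor k X) = cospan_comp X (cospan_id (csrc X))" "mcod (cospan_runitor k X) = X"
  by (simp_all add: cospan_lunitor_def cospan_runitor_def)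

lemma
  fixes X :: "('k, 'u::infinite) cospan"
  assumes X: "is_cospan k X"
  shows is_cospan_mor_lunitor: "is_cospan_mor k (cospan_lunitor k X)"
    and mfun_lunitor: "\<And>b t. b \<in> carrier (ctrg X) \<Longrightarrow> t \<in> carrier (apex X) \<Longrightarrow>
      mfun (cospan_lunitor k X) (ptensor (cospan_id (ctrg X)) X b t) = lleg X b \<otimes>\<^bsub>apex X\<^esub> t"
    and bij_lunitor: "bij_betw (mfun (cospan_lunitor k X))
      (carrier (ctensor (cospan_id (ctrg X)) X)) (carrier (apex X))"
proof -
  note X' = is_cospanD[OF X]
  interpret c: composable k "cospan_id (ctrg X)" X
    using X is_cospan_id[OF X'(2)] by (intro composable.intro) simp_all
  interpret B: algebra k "ctrg X" by (rule X'(2))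
  note hl = alg_homD(2-)[OF X'(4)]
  have comm: "t \<otimes>\<^bsub>apex X\<^esub> lleg X b = lleg X b \<otimes>\<^bsub>apex X\<^esub> t"
    if "b \<in> carrier (ctrg X)" "t \<in> carrier (apex X)" for b t
    using X'(5) that by (auto simp: centre_def)
  \<comment> \<open>This is multiplicativity of the pairing: \<open>t\<close> is moved past the
    central element \<open>lleg X b'\<close>.\<close>
  have m4: "(lleg X b \<otimes>\<^bsub>apex X\<^esub> lleg X b') \<otimes>\<^bsub>apex X\<^esub> (t \<otimes>\<^bsub>apex X\<^esub> t')
      = (lleg X b \<otimes>\<^bsub>apex X\<^esub> t) \<otimes>\<^bsub>apex X\<^esub> (lleg X b' \<otimes>\<^bsub>apex X\<^esub> t')"
    if "b \<in> carrier (ctrg X)" "b' \<in> carrier (ctrg X)" "t \<in> carrier (apex X)" "t' \<in> carrier (apex X)"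
    for b b' t t'
    using that hl(1) comm by (smt (verit) c.S.m_assoc c.S.m_closed)
  have bal: "balanced_hom k (ctrg X) (ctrg X) (rleg (cospan_id (ctrg X))) (apex X) (lleg X) (apex X)
      (\<lambda>b t. lleg X b \<otimes>\<^bsub>apex X\<^esub> t)"
    unfolding balanced_hom_def
    by (intro conjI ballI)
      (simp_all add: hl c.S.l_distr c.S.r_distr c.S.smult_mult_left m4, simp_all add: hl c.S.m_assoc)
  note ind = c.tensor_ind[simplified, OF X'(3) bal]
  show *: "mfun (cospan_lunitor k X) (ptensor (cospan_id (ctrg X)) X b t) = lleg X b \<otimes>\<^bsub>apex X\<^esub> t"
    if "b \<in> carrier (ctrg X)" "t \<in> carrier (apex X)" for b t
    using ind(2)[OF that] by (simp add: cospan_lunitor_def)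
  have h: "mfun (cospan_lunitor k X) \<in> alg_hom k (ctensor (cospan_id (ctrg X)) X) (apex X)"
    using ind(1) by (simp add: cospan_lunitor_def)
  show "is_cospan_mor k (cospan_lunitor k X)"
    using X X' h c.is_cospan_comp
    by (simp add: is_cospan_mor_def c.lleg_comp c.rleg_comp * hl alg_homD(2)[OF X'(6)])
  \<comment> \<open>The inverse sends \<open>t\<close> to \<open>1 \<otimes> t\<close>: balancing
    moves \<open>b\<close> across, so that \<open>1 \<otimes> (lleg X b) t\<close> equals
    \<open>b \<otimes> t\<close>.\<close>
  have "ptensor (cospan_id (ctrg X)) X \<one>\<^bsub>ctrg X\<^esub> (mfun (cospan_lunitor k X) z) = z"
    if "z \<in> carrier (ctensor (cospan_id (ctrg X)) X)" for z
  proof (rule c.additive_eqI[OF _ _ _ that])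
    fix b t assume "b \<in> carrier (apex (cospan_id (ctrg X)))" "t \<in> carrier (apex X)"
    then show "ptensor (cospan_id (ctrg X)) X \<one>\<^bsub>ctrg X\<^esub>
        (mfun (cospan_lunitor k X) (ptensor (cospan_id (ctrg X)) X b t))
      = ptensor (cospan_id (ctrg X)) X b t"
      using c.pure_balanced[of "\<one>\<^bsub>ctrg X\<^esub>" b t] by (simp add: * hl)
  qed (simp_all add: alg_homD(2,4)[OF h] c.pure_add_right)
  then show "bij_betw (mfun (cospan_lunitor k X))
      (carrier (ctensor (cospan_id (ctrg X)) X)) (carrier (apex X))"
    by (intro bij_betw_byWitness[where f' = "ptensor (cospan_id (ctrg X)) X \<one>\<^bsub>ctrg X\<^esub>"])
      (auto simp: * hl alg_homD(2)[OF h])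
qed

lemma
  fixes X :: "('k, 'u::infinite) cospan"
  assumes X: "is_cospan k X"
  shows is_cospan_mor_runitor: "is_cospan_mor k (cospan_runitor k X)"
    and mfun_runitor: "\<And>b t. t \<in> carrier (apex X) \<Longrightarrow> b \<in> carrier (csrc X) \<Longrightarrow>
      mfun (cospan_runitor k X) (ptensor X (cospan_id (csrc X)) t b) = t \<otimes>\<^bsub>apex X\<^esub> rleg X b"
    and bij_runitor: "bij_betw (mfun (cospan_runitor k X))
      (carrier (ctensor X (cospan_id (csrc X)))) (carrier (apex X))"
proof -
  note X' = is_cospanD[OF X]
  interpret c: composable k X "cospan_id (csrc X)"
    using X is_cospan_id[OF X'(1)] by (intro composable.intro) simp_all
  interpret B: algebra k "csrc X" by (rule X'(1))
  note hr = alg_homD(2-)[OF X'(6)]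
  have comm: "t \<otimes>\<^bsub>apex X\<^esub> rleg X b = rleg X b \<otimes>\<^bsub>apex X\<^esub> t"
    if "b \<in> carrier (csrc X)" "t \<in> carrier (apex X)" for b t
    using X'(7) that by (auto simp: centre_def)
  have m4: "(t \<otimes>\<^bsub>apex X\<^esub> t') \<otimes>\<^bsub>apex X\<^esub> (rleg X b \<otimes>\<^bsub>apex X\<^esub> rleg X b')
      = (t \<otimes>\<^bsub>apex X\<^esub> rleg X b) \<otimes>\<^bsub>apex X\<^esub> (t' \<otimes>\<^bsub>apex X\<^esub> rleg X b')"
    if "b \<in> carrier (csrc X)" "b' \<in> carrier (csrc X)" "t \<in> carrier (apex X)" "t' \<in> carrier (apex X)"
    for b b' t t'
    using that hr(1) comm by (smt (verit) c.T.m_assoc c.T.m_closed)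
  have bal: "balanced_hom k (csrc X) (apex X) (rleg X) (csrc X) (lleg (cospan_id (csrc X))) (apex X)
      (\<lambda>t b. t \<otimes>\<^bsub>apex X\<^esub> rleg X b)"
    unfolding balanced_hom_def
    by (intro conjI ballI)
      (simp_all add: hr c.T.l_distr c.T.r_distr c.T.smult_mult_left m4, simp_all add: hr c.T.m_assoc)
  note ind = c.tensor_ind[simplified, OF X'(3) bal]
  show *: "mfun (cospan_runitor k X) (ptensor X (cospan_id (csrc X)) t b) = t \<otimes>\<^bsub>apex X\<^esub> rleg X b"
    if "t \<in> carrier (apex X)" "b \<in> carrier (csrc X)" for b t
    using ind(2)[OF that] by (simp add: cospan_runitor_def)
  have h: "mfun (cospan_runitor k X) \<in> alg_hom k (ctensor X (cospan_id (csrc X))) (apex X)"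
    using ind(1) by (simp add: cospan_runitor_def)
  show "is_cospan_mor k (cospan_runitor k X)"
    using X X' h c.is_cospan_comp
    by (simp add: is_cospan_mor_def c.lleg_comp c.rleg_comp * hr alg_homD(2)[OF X'(4)])
  \<comment> \<open>On this side the inverse is \<open>t \<otimes> 1\<close>, and balancing turns
    \<open>t (rleg X b) \<otimes> 1\<close> into \<open>t \<otimes> b\<close>.\<close>
  have "ptensor X (cospan_id (csrc X)) (mfun (cospan_runitor k X) z) \<one>\<^bsub>csrc X\<^esub> = z"
    if "z \<in> carrier (ctensor X (cospan_id (csrc X)))" for z
  proof (rule c.additive_eqI[OF _ _ _ that])
    fix b t assume "t \<in> carrier (apex X)" "b \<in> carrier (apex (cospan_id (csrc X)))"
    then show "ptensor X (cospan_id (csrc X))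
        (mfun (cospan_runitor k X) (ptensor X (cospan_id (csrc X)) t b)) \<one>\<^bsub>csrc X\<^esub>
      = ptensor X (cospan_id (csrc X)) t b"
      using c.pure_balanced[of t b "\<one>\<^bsub>csrc X\<^esub>"] by (simp add: * hr)
  qed (simp_all add: alg_homD(2,4)[OF h] c.pure_add_left)
  then show "bij_betw (mfun (cospan_runitor k X))
      (carrier (ctensor X (cospan_id (csrc X)))) (carrier (apex X))"
    by (intro bij_betw_byWitness[where f' = "\<lambda>t. ptensor X (cospan_id (csrc X)) t \<one>\<^bsub>csrc X\<^esub>"])
      (auto simp: * hr alg_homD(2)[OF h])
qed

section \<open>The associator\<close>

lemma assoc_dom_cod [simp]:
  "mdom (cospan_assoc k W X Y) = cospan_comp (cospan_comp W X) Y"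
  "mcod (cospan_assoc k W X Y) = cospan_comp W (cospan_comp X Y)"
  by (simp_all add: cospan_assoc_def)

locale composable3 =
  fixes k :: "'k ring" and W X Y :: "('k, 'u::infinite) cospan"
  assumes WX: "composable k W X" and XY: "composable k X Y"
begin

sublocale WX: composable k W X by (rule WX)
sublocale XY: composable k X Y by (rule XY)

sublocale L: composable k "cospan_comp W X" Y
  using WX.is_cospan_comp XY.Y XY.composable by (intro composable.intro) simp_all

sublocale R: composable k W "cospan_comp X Y"
  using XY.is_cospan_comp WX.X WX.composable by (intro composable.intro) simp_all

abbreviation ltriple :: "'u \<Rightarrow> 'u \<Rightarrow> 'u \<Rightarrow> 'u" where
  "ltriple u t s \<equiv> ptensor (cospan_comp W X) Y (ptensor W X u t) s"

abbreviation rtriple :: "'u \<Rightarrow> 'u \<Rightarrow> 'u \<Rightarrow> 'u" where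
  "rtriple u t s \<equiv> ptensor W (cospan_comp X Y) u (ptensor X Y t s)"

text \<open>The simplifier rewrites the apex of a composite to \<open>ctensor\<close>, so the rules
  have to be brought into that form to match sums and products taken there.\<close>

lemmas L_simps =
  L.pure_closed[unfolded cospan_comp_simps] L.pure_add_left[unfolded cospan_comp_simps]
  L.pure_add_right[unfolded cospan_comp_simps] L.tensor_simps[unfolded cospan_comp_simps]

lemmas R_simps =
  R.pure_closed[unfolded cospan_comp_simps] R.pure_add_left[unfolded cospan_comp_simps]
  R.pure_add_right[unfolded cospan_comp_simps] R.tensor_simps[unfolded cospan_comp_simps]

lemma L_induct [consumes 1, case_names triple add]:
  assumes "z \<in> carrier (ctensor (cospan_comp W X) Y)"
    and triple: "\<And>u t s. u \<in> carrier (apex W) \<Longrightarrow> t \<in> carrier (apex X) \<Longrightarrow> s \<in> carrier (apex Y) \<Longrightarrow>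
      P (ltriple u t s)"
    and add: "\<And>x y. x \<in> carrier (ctensor (cospan_comp W X) Y) \<Longrightarrow>
      y \<in> carrier (ctensor (cospan_comp W X) Y) \<Longrightarrow> P x \<Longrightarrow> P y \<Longrightarrow>
      P (x \<oplus>\<^bsub>ctensor (cospan_comp W X) Y\<^esub> y)"
  shows "P z"
  using assms(1)
proof (induction z rule: L.tensor_induct)
  case (pure w s)
  then have "w \<in> carrier (ctensor W X)" by simp
  then show ?case
    by (induction w rule: WX.tensor_induct) (simp_all add: triple add L_simps pure)
qed (rule add)

lemma R_induct [consumes 1, case_names triple add]:
  assumes "z \<in> carrier (ctensor W (cospan_comp X Y))"
    and triple: "\<And>u t s. u \<in> carrier (apex W) \<Longrightarrow> t \<in> carrier (apex X) \<Longrightarrow> s \<in> carrier (apex Y) \<Longrightarrow>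
      P (rtriple u t s)"
    and add: "\<And>x y. x \<in> carrier (ctensor W (cospan_comp X Y)) \<Longrightarrow>
      y \<in> carrier (ctensor W (cospan_comp X Y)) \<Longrightarrow> P x \<Longrightarrow> P y \<Longrightarrow>
      P (x \<oplus>\<^bsub>ctensor W (cospan_comp X Y)\<^esub> y)"
  shows "P z"
  using assms(1)
proof (induction z rule: R.tensor_induct)
  case (pure u w)
  then have "w \<in> carrier (ctensor X Y)" by simp
  then show ?case
    by (induction w rule: XY.tensor_induct) (simp_all add: triple add R_simps pure)
qed (rule add)

text \<open>Balancing across the second joint: elements of \<open>csrc X\<close> act on the
  composite of \<open>W\<close> and \<open>X\<close> through its second factor, as its unfolded
  right leg shows.\<close>

lemma ltriple_middle:
  assumes "b \<in> carrier (csrc X)" "w \<in> carrier (ctensor W X)" "s \<in> carrier (apex Y)"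
  shows "ptensor (cospan_comp W X) Y (w \<otimes>\<^bsub>ctensor W X\<^esub> ptensor W X \<one>\<^bsub>apex W\<^esub> (rleg X b)) s
    = ptensor (cospan_comp W X) Y w (lleg Y b \<otimes>\<^bsub>apex Y\<^esub> s)"
  using L.pure_balanced[of w b s] assms XY.composable by (simp add: WX.rleg_comp)

lemma rtriple_middle:
  assumes "b \<in> carrier (csrc W)" "u \<in> carrier (apex W)" "z \<in> carrier (ctensor X Y)"
  shows "ptensor W (cospan_comp X Y) (u \<otimes>\<^bsub>apex W\<^esub> rleg W b) z
    = ptensor W (cospan_comp X Y) u (ptensor X Y (lleg X b) \<one>\<^bsub>apex Y\<^esub> \<otimes>\<^bsub>ctensor X Y\<^esub> z)"
  using R.pure_balanced[of u b z] assms WX.composable by (simp add: XY.lleg_comp)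

text \<open>Built in two stages. For fixed \<open>s\<close> the map
  \<open>u \<otimes> t \<mapsto> u \<otimes> (t \<otimes> s)\<close> is additive and balanced over
  \<open>csrc W\<close>. The resulting family is additive in \<open>s\<close> and balanced over
  \<open>csrc X\<close>, so it extends once more.\<close>

lemma assoc_additive:
  "\<exists>h \<in> carrier (ctensor (cospan_comp W X) Y) \<rightarrow> carrier (ctensor W (cospan_comp X Y)).
     (\<forall>x \<in> carrier (ctensor (cospan_comp W X) Y). \<forall>y \<in> carrier (ctensor (cospan_comp W X) Y).
       h (x \<oplus>\<^bsub>ctensor (cospan_comp W X) Y\<^esub> y) = h x \<oplus>\<^bsub>ctensor W (cospan_comp X Y)\<^esub> h y)
   \<and> (\<forall>u \<in> carrier (apex W). \<forall>t \<in> carrier (apex X). \<forall>s \<in> carrier (apex Y).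
       h (ltriple u t s) = rtriple u t s)"
proof -
  let ?P = "\<lambda>s h. h \<in> carrier (ctensor W X) \<rightarrow> carrier (ctensor W (cospan_comp X Y)) \<and>
      (\<forall>x \<in> carrier (ctensor W X). \<forall>y \<in> carrier (ctensor W X).
        h (x \<oplus>\<^bsub>ctensor W X\<^esub> y) = h x \<oplus>\<^bsub>ctensor W (cospan_comp X Y)\<^esub> h y) \<and>
      (\<forall>u \<in> carrier (apex W). \<forall>t \<in> carrier (apex X). h (ptensor W X u t) = rtriple u t s)"
  have "\<exists>h. ?P s h" if s: "s \<in> carrier (apex Y)" for s
  proof -
    have "rtriple (u \<otimes>\<^bsub>apex W\<^esub> rleg W b) t s = rtriple u (lleg X b \<otimes>\<^bsub>apex X\<^esub> t) s"
      if "u \<in> carrier (apex W)" "b \<in> carrier (csrc W)" "t \<in> carrier (apex X)" for u b t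
      using that s by (simp add: rtriple_middle XY.pure_mult)
    then show ?thesis
      by (rule_tac WX.tensor_additive_universal[OF R.abelian_group_tensor, of "\<lambda>u t. rtriple u t s"])
        (use s in \<open>auto simp: R_simps XY.pure_add_left\<close>)
  qed
  then have "\<forall>s \<in> carrier (apex Y). \<exists>h. ?P s h" by blast
  \<comment> \<open>One slice is chosen for each \<open>s\<close>. Laws relating different slices
    can still be proved, as a slice is determined by its values on pure tensors.\<close>
  then obtain h where hP: "\<forall>s \<in> carrier (apex Y). ?P s (h s)"
    by (rule bchoice[THEN exE])
  have h: "\<And>s w. s \<in> carrier (apex Y) \<Longrightarrow> w \<in> carrier (ctensor W X) \<Longrightarrow>
      h s w \<in> carrier (ctensor W (cospan_comp X Y))"
    and h_add: "\<And>s x y. s \<in> carrier (apex Y) \<Longrightarrow> x \<in> carrier (ctensor W X) \<Longrightarrow> y \<in> carrier (ctensor W X) \<Longrightarrow>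
      h s (x \<oplus>\<^bsub>ctensor W X\<^esub> y) = h s x \<oplus>\<^bsub>ctensor W (cospan_comp X Y)\<^esub> h s y"
    and triple: "\<And>u t s. u \<in> carrier (apex W) \<Longrightarrow> t \<in> carrier (apex X) \<Longrightarrow> s \<in> carrier (apex Y) \<Longrightarrow>
      h s (ptensor W X u t) = rtriple u t s"
    using hP by blast+
  have addr: "h (s \<oplus>\<^bsub>apex Y\<^esub> s') w = h s w \<oplus>\<^bsub>ctensor W (cospan_comp X Y)\<^esub> h s' w"
    if "s \<in> carrier (apex Y)" "s' \<in> carrier (apex Y)" "w \<in> carrier (ctensor W X)" for s s' w
    using that(3)
    by (induction w rule: WX.tensor_induct)
      (simp_all add: that(1,2) triple h_add h R_simps XY.pure_add_right R.TS.a_ac)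
  \<comment> \<open>On \<open>u \<otimes> t\<close> the leg acts on \<open>t\<close>, so balancing
    between \<open>X\<close> and \<open>Y\<close> carries \<open>b\<close> over to
    \<open>s\<close>.\<close>
  have bal: "h s (w \<otimes>\<^bsub>ctensor W X\<^esub> rleg (cospan_comp W X) b) = h (lleg Y b \<otimes>\<^bsub>apex Y\<^esub> s) w"
    if "s \<in> carrier (apex Y)" "b \<in> carrier (csrc X)" "w \<in> carrier (ctensor W X)" for s b w
    using that(3)
  proof (induction w rule: WX.tensor_induct)
    case (pure u t)
    then show ?case
      using that(1,2) XY.composable
      by (simp add: WX.rleg_comp WX.pure_mult triple XY.pure_balanced)
  next
    case (add x y)
    then show ?case
      using that(1,2) XY.composable
      by (simp add: WX.rleg_comp WX.tensor_simps h_add)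
  qed
  obtain g where "g \<in> carrier (ctensor (cospan_comp W X) Y) \<rightarrow> carrier (ctensor W (cospan_comp X Y))"
    "\<And>x y. x \<in> carrier (ctensor (cospan_comp W X) Y) \<Longrightarrow>
      y \<in> carrier (ctensor (cospan_comp W X) Y) \<Longrightarrow>
      g (x \<oplus>\<^bsub>ctensor (cospan_comp W X) Y\<^esub> y) = g x \<oplus>\<^bsub>ctensor W (cospan_comp X Y)\<^esub> g y"
    "\<And>w s. w \<in> carrier (ctensor W X) \<Longrightarrow> s \<in> carrier (apex Y) \<Longrightarrow>
      g (ptensor (cospan_comp W X) Y w s) = h s w"
    by (rule L.tensor_additive_universal[OF R.abelian_group_tensor, of "\<lambda>w s. h s w"])
      (simp_all add: h h_add addr bal)
  then show ?thesis
    using triple by (intro bexI[of _ g]) simp_all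
qed

text \<open>The mirror image, with slices at fixed \<open>u\<close>. An additive map suffices,
  because it serves only to show that the associator is bijective.\<close>

lemma assoc_inv_additive:
  "\<exists>h \<in> carrier (ctensor W (cospan_comp X Y)) \<rightarrow> carrier (ctensor (cospan_comp W X) Y).
     (\<forall>x \<in> carrier (ctensor W (cospan_comp X Y)). \<forall>y \<in> carrier (ctensor W (cospan_comp X Y)).
       h (x \<oplus>\<^bsub>ctensor W (cospan_comp X Y)\<^esub> y) = h x \<oplus>\<^bsub>ctensor (cospan_comp W X) Y\<^esub> h y)
   \<and> (\<forall>u \<in> carrier (apex W). \<forall>t \<in> carrier (apex X). \<forall>s \<in> carrier (apex Y).
       h (rtriple u t s) = ltriple u t s)"
proof -
  let ?P = "\<lambda>u h. h \<in> carrier (ctensor X Y) \<rightarrow> carrier (ctensor (cospan_comp W X) Y) \<and>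
      (\<forall>x \<in> carrier (ctensor X Y). \<forall>y \<in> carrier (ctensor X Y).
        h (x \<oplus>\<^bsub>ctensor X Y\<^esub> y) = h x \<oplus>\<^bsub>ctensor (cospan_comp W X) Y\<^esub> h y) \<and>
      (\<forall>t \<in> carrier (apex X). \<forall>s \<in> carrier (apex Y). h (ptensor X Y t s) = ltriple u t s)"
  have "\<exists>h. ?P u h" if u: "u \<in> carrier (apex W)" for u
  proof -
    have "ltriple u (t \<otimes>\<^bsub>apex X\<^esub> rleg X b) s = ltriple u t (lleg Y b \<otimes>\<^bsub>apex Y\<^esub> s)"
      if "t \<in> carrier (apex X)" "b \<in> carrier (csrc X)" "s \<in> carrier (apex Y)" for t b s
      using ltriple_middle[of b "ptensor W X u t" s] that u by (simp add: WX.pure_mult)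
    then show ?thesis
      by (rule_tac XY.tensor_additive_universal[OF L.abelian_group_tensor, of "\<lambda>t s. ltriple u t s"])
        (use u in \<open>auto simp: L_simps WX.pure_add_right\<close>)
  qed
  then have "\<forall>u \<in> carrier (apex W). \<exists>h. ?P u h" by blast
  then obtain h where hP: "\<forall>u \<in> carrier (apex W). ?P u (h u)"
    by (rule bchoice[THEN exE])
  have h: "\<And>u z. u \<in> carrier (apex W) \<Longrightarrow> z \<in> carrier (ctensor X Y) \<Longrightarrow>
      h u z \<in> carrier (ctensor (cospan_comp W X) Y)"
    and h_add: "\<And>u x y. u \<in> carrier (apex W) \<Longrightarrow> x \<in> carrier (ctensor X Y) \<Longrightarrow> y \<in> carrier (ctensor X Y) \<Longrightarrow>
      h u (x \<oplus>\<^bsub>ctensor X Y\<^esub> y) = h u x \<oplus>\<^bsub>ctensor (cospan_comp W X) Y\<^esub> h u y"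
    and triple: "\<And>u t s. u \<in> carrier (apex W) \<Longrightarrow> t \<in> carrier (apex X) \<Longrightarrow> s \<in> carrier (apex Y) \<Longrightarrow>
      h u (ptensor X Y t s) = ltriple u t s"
    using hP by blast+
  have addl: "h (u \<oplus>\<^bsub>apex W\<^esub> u') z = h u z \<oplus>\<^bsub>ctensor (cospan_comp W X) Y\<^esub> h u' z"
    if "u \<in> carrier (apex W)" "u' \<in> carrier (apex W)" "z \<in> carrier (ctensor X Y)" for u u' z
    using that(3)
    by (induction z rule: XY.tensor_induct)
      (simp_all add: that(1,2) triple h_add h L_simps WX.pure_add_left L.TS.a_ac)
  have bal: "h (u \<otimes>\<^bsub>apex W\<^esub> rleg W b) z = h u (lleg (cospan_comp X Y) b \<otimes>\<^bsub>ctensor X Y\<^esub> z)"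
    if "u \<in> carrier (apex W)" "b \<in> carrier (csrc W)" "z \<in> carrier (ctensor X Y)" for u b z
    using that(3)
  proof (induction z rule: XY.tensor_induct)
    case (pure t s)
    then show ?case
      using that(1,2) WX.composable
      by (simp add: XY.lleg_comp XY.pure_mult triple WX.pure_balanced)
  next
    case (add x y)
    then show ?case
      using that(1,2) WX.composable
      by (simp add: XY.lleg_comp XY.tensor_simps h_add)
  qed
  obtain g where "g \<in> carrier (ctensor W (cospan_comp X Y)) \<rightarrow> carrier (ctensor (cospan_comp W X) Y)"
    "\<And>x y. x \<in> carrier (ctensor W (cospan_comp X Y)) \<Longrightarrow>
      y \<in> carrier (ctensor W (cospan_comp X Y)) \<Longrightarrow>
      g (x \<oplus>\<^bsub>ctensor W (cospan_comp X Y)\<^esub> y) = g x \<oplus>\<^bsub>ctensor (cospan_comp W X) Y\<^esub> g y"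
    "\<And>u z. u \<in> carrier (apex W) \<Longrightarrow> z \<in> carrier (ctensor X Y) \<Longrightarrow>
      g (ptensor W (cospan_comp X Y) u z) = h u z"
    by (rule R.tensor_additive_universal[OF L.abelian_group_tensor, of h])
      (simp_all add: h h_add addl bal)
  then show ?thesis
    using triple by (intro bexI[of _ g]) simp_all
qed

text \<open>Triples multiply componentwise in both bracketings, so the additive map is
  multiplicative on triples and therefore everywhere. Uniqueness holds because triples generate the
  source additively.\<close>

lemma assoc_ex1:
  "\<exists>!h. h \<in> alg_hom k (ctensor (cospan_comp W X) Y) (ctensor W (cospan_comp X Y))
    \<and> (\<forall>u \<in> carrier (apex W). \<forall>t \<in> carrier (apex X). \<forall>s \<in> carrier (apex Y).
         h (ltriple u t s) = rtriple u t s)"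
proof -
  let ?L = "ctensor (cospan_comp W X) Y" and ?R = "ctensor W (cospan_comp X Y)"
  obtain h where h: "h \<in> carrier ?L \<rightarrow> carrier ?R"
    and add: "\<And>x y. x \<in> carrier ?L \<Longrightarrow> y \<in> carrier ?L \<Longrightarrow> h (x \<oplus>\<^bsub>?L\<^esub> y) = h x \<oplus>\<^bsub>?R\<^esub> h y"
    and h_triple: "\<And>u t s. u \<in> carrier (apex W) \<Longrightarrow> t \<in> carrier (apex X) \<Longrightarrow> s \<in> carrier (apex Y) \<Longrightarrow>
      h (ltriple u t s) = rtriple u t s"
    using assoc_additive by blast
  have closed: "h x \<in> carrier ?R" if "x \<in> carrier ?L" for x
    using h that by blast
  have mult: "h (x \<otimes>\<^bsub>?L\<^esub> y) = h x \<otimes>\<^bsub>?R\<^esub> h y" if "x \<in> carrier ?L" "y \<in> carrier ?L" for x y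
    using that(1)
  proof (induction x rule: L_induct)
    case (triple u t s)
    note 1 = this
    show ?case
      using that(2)
      by (induction y rule: L_induct)
        (simp_all add: 1 that(1) L_simps R_simps add closed WX.pure_mult XY.pure_mult
          h_triple)
  qed (simp_all add: that L_simps R_simps add closed)
  have smult: "h (c \<odot>\<^bsub>?L\<^esub> x) = c \<odot>\<^bsub>?R\<^esub> h x" if "c \<in> carrier k" "x \<in> carrier ?L" for c x
    using that(2)
    by (induction x rule: L_induct)
      (simp_all add: that(1) L_simps R_simps WX.pure_smult_left add h_triple closed)
  have one: "h \<one>\<^bsub>?L\<^esub> = \<one>\<^bsub>?R\<^esub>"
    using h_triple[of "\<one>\<^bsub>apex W\<^esub>" "\<one>\<^bsub>apex X\<^esub>" "\<one>\<^bsub>apex Y\<^esub>"]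
    by (simp add: L.one_tensor R.one_tensor WX.one_tensor XY.one_tensor)
  have "restrict h (carrier ?L) \<in> alg_hom k ?L ?R"
    by (rule alg_homI) (simp_all add: closed mult add smult one)
  moreover have "restrict h (carrier ?L) (ltriple u t s) = rtriple u t s"
    if "u \<in> carrier (apex W)" "t \<in> carrier (apex X)" "s \<in> carrier (apex Y)" for u t s
    using that h_triple by (simp add: L_simps)
  moreover have "f = g" if f: "f \<in> alg_hom k ?L ?R" and g: "g \<in> alg_hom k ?L ?R"
    and eq: "\<And>u t s. u \<in> carrier (apex W) \<Longrightarrow> t \<in> carrier (apex X) \<Longrightarrow> s \<in> carrier (apex Y) \<Longrightarrow>
      f (ltriple u t s) = g (ltriple u t s)" for f g
  proof (rule extensionalityI[OF alg_homD(1)[OF f] alg_homD(1)[OF g]])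
    fix x assume "x \<in> carrier ?L"
    then show "f x = g x"
      by (induction x rule: L_induct) (simp_all add: eq alg_homD(4)[OF f] alg_homD(4)[OF g])
  qed
  ultimately show ?thesis
    by (intro ex1I[of _ "restrict h (carrier ?L)"]) auto
qed

lemma alg_hom_assoc: "mfun (cospan_assoc k W X Y)
    \<in> alg_hom k (ctensor (cospan_comp W X) Y) (ctensor W (cospan_comp X Y))"
  and mfun_assoc: "\<lbrakk>u \<in> carrier (apex W); t \<in> carrier (apex X); s \<in> carrier (apex Y)\<rbrakk> \<Longrightarrow>
    mfun (cospan_assoc k W X Y) (ltriple u t s) = rtriple u t s"
  using theI'[OF assoc_ex1] by (simp_all add: cospan_assoc_def)

lemma is_cospan_mor_assoc: "is_cospan_mor k (cospan_assoc k W X Y)"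
proof -
  have "lleg W c \<in> carrier (apex W)" if "c \<in> carrier (ctrg W)" for c
    using alg_homD(2)[OF is_cospanD(4)[OF WX.X] that] .
  moreover have "rleg Y a \<in> carrier (apex Y)" if "a \<in> carrier (csrc Y)" for a
    using alg_homD(2)[OF is_cospanD(6)[OF XY.Y] that] .
  ultimately show ?thesis
    by (simp add: is_cospan_mor_def L.is_cospan_comp R.is_cospan_comp alg_hom_assoc
        L.lleg_comp R.lleg_comp L.rleg_comp R.rleg_comp WX.lleg_comp XY.rleg_comp mfun_assoc
        WX.one_tensor XY.one_tensor)
qed

lemma bij_assoc: "bij_betw (mfun (cospan_assoc k W X Y))
  (carrier (ctensor (cospan_comp W X) Y)) (carrier (ctensor W (cospan_comp X Y)))"
proof -
  let ?L = "ctensor (cospan_comp W X) Y" and ?R = "ctensor W (cospan_comp X Y)"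
  let ?f = "mfun (cospan_assoc k W X Y)"
  note f = alg_homD(2,4)[OF alg_hom_assoc]
  obtain h where h: "h \<in> carrier ?R \<rightarrow> carrier ?L"
    and add: "\<And>x y. x \<in> carrier ?R \<Longrightarrow> y \<in> carrier ?R \<Longrightarrow> h (x \<oplus>\<^bsub>?R\<^esub> y) = h x \<oplus>\<^bsub>?L\<^esub> h y"
    and triple: "\<And>u t s. u \<in> carrier (apex W) \<Longrightarrow> t \<in> carrier (apex X) \<Longrightarrow> s \<in> carrier (apex Y) \<Longrightarrow>
      h (rtriple u t s) = ltriple u t s"
    using assoc_inv_additive by blast
  have closed: "h x \<in> carrier ?L" if "x \<in> carrier ?R" for x
    using h that by blast
  have "h (?f x) = x" if "x \<in> carrier ?L" for x
    using that by (induction x rule: L_induct) (simp_all add: mfun_assoc triple add f)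
  moreover have "?f (h x) = x" if "x \<in> carrier ?R" for x
    using that by (induction x rule: R_induct) (simp_all add: mfun_assoc triple add f closed)
  ultimately show ?thesis
    by (intro bij_betw_byWitness[where f' = h]) (use f closed in auto)
qed

lemma cospan_comp3_mor_eqI:
  assumes "is_cospan_mor k \<phi>" "is_cospan_mor k \<psi>"
    and "mdom \<phi> = cospan_comp (cospan_comp W X) Y" "mdom \<psi> = cospan_comp (cospan_comp W X) Y"
    and "mcod \<phi> = mcod \<psi>"
    and eq: "\<And>u t s. u \<in> carrier (apex W) \<Longrightarrow> t \<in> carrier (apex X) \<Longrightarrow> s \<in> carrier (apex Y) \<Longrightarrow>
      mfun \<phi> (ltriple u t s) = mfun \<psi> (ltriple u t s)"
  shows "\<phi> = \<psi>"
proof (rule cospan_mor_eqI[OF assms(1,2)])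
  note \<phi> = alg_homD(4)[OF is_cospan_morD(5)[OF assms(1)]]
    and \<psi> = alg_homD(4)[OF is_cospan_morD(5)[OF assms(2)]]
  fix x assume "x \<in> carrier (apex (mdom \<phi>))"
  then have "x \<in> carrier (ctensor (cospan_comp W X) Y)" using assms by simp
  then show "mfun \<phi> x = mfun \<psi> x"
    by (induction x rule: L_induct) (use eq \<phi> \<psi> assms(3-5) in simp_all)
qed (use assms in simp_all)

end

section \<open>The bicategory of cospans\<close>

context
  fixes k :: "'k ring"
begin

section \<open>Typing and evaluation rules for pasted 2-cells\<close>

lemma composableI:
  "is_cospan k X \<Longrightarrow> is_cospan k Y \<Longrightarrow> csrc X = ctrg Y \<Longrightarrow> composable k X Y"
  by (rule composable.intro)

lemma composable3I:
  "is_cospan k W \<Longrightarrow> is_cospan k X \<Longrightarrow> is_cospan k Y \<Longrightarrow> csrc W = ctrg X \<Longrightarrow> csrc X = ctrg Y \<Longrightarrow>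
    composable3 k W X Y"
  by (simp add: composable3_def composableI)

lemma is_cospan_compI:
  "is_cospan k X \<Longrightarrow> is_cospan k Y \<Longrightarrow> csrc X = ctrg Y \<Longrightarrow> is_cospan k (cospan_comp X Y)"
  using composable.is_cospan_comp[OF composableI] .

lemma ptensor_closed:
  assumes "is_cospan k X" "is_cospan k Y" "csrc X = ctrg Y" "t \<in> carrier (apex X)" "s \<in> carrier (apex Y)"
  shows "ptensor X Y t s \<in> carrier (ctensor X Y)"
proof -
  interpret composable k X Y by (rule composableI[OF assms(1-3)])
  show ?thesis using assms(4,5) by (rule pure_closed)
qed

lemma mfun_closedI:
  "is_cospan_mor k \<phi> \<Longrightarrow> x \<in> carrier (apex (mdom \<phi>)) \<Longrightarrow> mcod \<phi> = Y \<Longrightarrow> mfun \<phi> x \<in> carrier (apex Y)"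
  using mfun_closed[of k \<phi> x] by simp

text \<open>The domains are variables fixed by equations among the premises, so that the rule
  matches terms whose endpoints have already been simplified.\<close>

lemma mfun_hcomp_ptensor:
  "is_cospan_mor k \<phi> \<Longrightarrow> is_cospan_mor k \<psi> \<Longrightarrow> mdom \<psi> = X \<Longrightarrow> mdom \<phi> = Y \<Longrightarrow> csrc X = ctrg Y \<Longrightarrow>
    t \<in> carrier (apex X) \<Longrightarrow> s \<in> carrier (apex Y) \<Longrightarrow>
    mfun (cospan_hcomp k \<psi> \<phi>) (ptensor X Y t s) = ptensor (mcod \<psi>) (mcod \<phi>) (mfun \<psi> t) (mfun \<phi> s)"
  using mfun_hcomp[of k \<phi> \<psi> t s] by simp

lemma is_cospan_mor_assocI:
  "is_cospan k W \<Longrightarrow> is_cospan k X \<Longrightarrow> is_cospan k Y \<Longrightarrow> csrc W = ctrg X \<Longrightarrow> csrc X = ctrg Y \<Longrightarrow>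
    is_cospan_mor k (cospan_assoc k W X Y)"
  using composable3.is_cospan_mor_assoc[OF composable3I] .

lemma mfun_assoc_ptensor:
  "is_cospan k W \<Longrightarrow> is_cospan k X \<Longrightarrow> is_cospan k Y \<Longrightarrow> csrc W = ctrg X \<Longrightarrow> csrc X = ctrg Y \<Longrightarrow>
    u \<in> carrier (apex W) \<Longrightarrow> t \<in> carrier (apex X) \<Longrightarrow> s \<in> carrier (apex Y) \<Longrightarrow>
    mfun (cospan_assoc k W X Y) (ptensor (cospan_comp W X) Y (ptensor W X u t) s)
      = ptensor W (cospan_comp X Y) u (ptensor X Y t s)"
  using composable3.mfun_assoc[OF composable3I] .

lemma mfun_lunitor_ptensor:
  "is_cospan k X \<Longrightarrow> ctrg X = B \<Longrightarrow> b \<in> carrier B \<Longrightarrow> t \<in> carrier (apex X) \<Longrightarrow>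
    mfun (cospan_lunitor k X) (ptensor (cospan_id B) X b t) = lleg X b \<otimes>\<^bsub>apex X\<^esub> t"
  using mfun_lunitor[of k X b t] by simp

lemma mfun_runitor_ptensor:
  "is_cospan k X \<Longrightarrow> csrc X = B \<Longrightarrow> b \<in> carrier B \<Longrightarrow> t \<in> carrier (apex X) \<Longrightarrow>
    mfun (cospan_runitor k X) (ptensor X (cospan_id B) t b) = t \<otimes>\<^bsub>apex X\<^esub> rleg X b"
  using mfun_runitor[of k X t b] by simp

lemma cospan_closed:
  assumes "is_cospan k X"
  shows "b \<in> carrier (ctrg X) \<Longrightarrow> lleg X b \<in> carrier (apex X)"
    and "a \<in> carrier (csrc X) \<Longrightarrow> rleg X a \<in> carrier (apex X)"
    and "t \<in> carrier (apex X) \<Longrightarrow> s \<in> carrier (apex X) \<Longrightarrow> t \<otimes>\<^bsub>apex X\<^esub> s \<in> carrier (apex X)"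
proof -
  interpret assoc_algebra k "apex X" by (rule is_cospanD(3)[OF assms])
  show "b \<in> carrier (ctrg X) \<Longrightarrow> lleg X b \<in> carrier (apex X)"
    "a \<in> carrier (csrc X) \<Longrightarrow> rleg X a \<in> carrier (apex X)"
    "t \<in> carrier (apex X) \<Longrightarrow> s \<in> carrier (apex X) \<Longrightarrow> t \<otimes>\<^bsub>apex X\<^esub> s \<in> carrier (apex X)"
    using alg_homD(2)[OF is_cospanD(4)[OF assms]] alg_homD(2)[OF is_cospanD(6)[OF assms]] by simp_all
qed

lemma hom2_CAlgD:
  assumes "\<phi> \<in> hom2 (CAlg k) X Y"
  shows "is_cospan_mor k \<phi>" "mdom \<phi> = X" "mcod \<phi> = Y" "is_cospan k Y"
    "csrc Y = csrc X" "ctrg Y = ctrg X"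
  using assms is_cospan_morD[of k \<phi>] by (auto simp: hom2_CAlg)

text \<open>Together these rules type a pasted 2-cell and evaluate it on pure tensors by
  simplification, which settles most equations of the bicategory directly.\<close>

lemmas cell_rules = is_cospan_mor_hcomp is_cospan_mor_comp is_cospan_mor_id is_cospan_compI
  ptensor_closed mfun_closedI mfun_hcomp_ptensor is_cospan_mor_assocI mfun_assoc_ptensor
  is_cospan_mor_lunitor is_cospan_mor_runitor mfun_lunitor_ptensor mfun_runitor_ptensor
  is_cospan_id cospan_closed

lemma bicategory_CAlg:
  "bicategory (CAlg k :: (('k, 'u::infinite) module, ('k, 'u) cospan, ('k, 'u) cospan_mor) bicat)"
proof
  fix f :: "('k, 'u) cospan" assume "f \<in> arrs (CAlg k)"
  then show "asrc (CAlg k) f \<in> objs (CAlg k) \<and> atrg (CAlg k) f \<in> objs (CAlg k)"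
    by (simp add: is_cospanD)
next
  fix \<sigma> :: "('k, 'u) cospan_mor" assume "\<sigma> \<in> cells (CAlg k)"
  then show "cdom (CAlg k) \<sigma> \<in> arrs (CAlg k) \<and> ccod (CAlg k) \<sigma> \<in> arrs (CAlg k)"
    "asrc (CAlg k) (cdom (CAlg k) \<sigma>) = asrc (CAlg k) (ccod (CAlg k) \<sigma>) \<and>
     atrg (CAlg k) (cdom (CAlg k) \<sigma>) = atrg (CAlg k) (ccod (CAlg k) \<sigma>)"
    by (simp_all add: is_cospan_morD)
next
  fix f :: "('k, 'u) cospan" assume "f \<in> arrs (CAlg k)"
  then show "id2 (CAlg k) f \<in> hom2 (CAlg k) f f"
    by (simp add: hom2_CAlg is_cospan_mor_id)
next
  fix f g h :: "('k, 'u) cospan" and \<sigma> \<tau>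
  assume "\<sigma> \<in> hom2 (CAlg k) f g" "\<tau> \<in> hom2 (CAlg k) g h"
  then show "\<tau> \<bullet>\<^bsub>CAlg k\<^esub> \<sigma> \<in> hom2 (CAlg k) f h"
    by (simp add: hom2_CAlg is_cospan_mor_comp)
next
  fix f g :: "('k, 'u) cospan" and \<sigma>
  assume \<sigma>: "\<sigma> \<in> hom2 (CAlg k) f g"
  note \<sigma>' = hom2_CAlgD[OF \<sigma>] is_cospan_morD(1)[OF hom2_CAlgD(1)[OF \<sigma>]]
  show "id2 (CAlg k) g \<bullet>\<^bsub>CAlg k\<^esub> \<sigma> = \<sigma>"
    using \<sigma>' by (intro cospan_mor_eqI[of k]) (simp_all add: cell_rules)
  show "\<sigma> \<bullet>\<^bsub>CAlg k\<^esub> id2 (CAlg k) f = \<sigma>"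
    using \<sigma>' by (intro cospan_mor_eqI[of k]) (simp_all add: cell_rules)
next
  fix f g h i :: "('k, 'u) cospan" and \<sigma> \<tau> \<upsilon>
  assume "\<sigma> \<in> hom2 (CAlg k) f g" "\<tau> \<in> hom2 (CAlg k) g h" "\<upsilon> \<in> hom2 (CAlg k) h i"
  note * = this[THEN hom2_CAlgD(1)] this[THEN hom2_CAlgD(2)] this[THEN hom2_CAlgD(3)]
  show "(\<upsilon> \<bullet>\<^bsub>CAlg k\<^esub> \<tau>) \<bullet>\<^bsub>CAlg k\<^esub> \<sigma> = \<upsilon> \<bullet>\<^bsub>CAlg k\<^esub> \<tau> \<bullet>\<^bsub>CAlg k\<^esub> \<sigma>"
    using * by (intro cospan_mor_eqI[of k]) (simp_all add: cell_rules)
next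
  fix A :: "('k, 'u) module" assume "A \<in> objs (CAlg k)"
  then show "id1 (CAlg k) A \<in> hom1 (CAlg k) A A"
    by (simp add: hom1_CAlg is_cospan_id)
next
  fix f g :: "('k, 'u) cospan" and A B D
  assume fg: "f \<in> hom1 (CAlg k) A B" "g \<in> hom1 (CAlg k) B D"
  then have fg': "is_cospan k f" "is_cospan k g" "csrc f = A" "ctrg f = B" "csrc g = B" "ctrg g = D"
    by (simp_all add: hom1_CAlg)
  interpret composable k g f
    using fg' by (intro composableI) simp_all
  show "g \<diamondop>\<^bsub>CAlg k\<^esub> f \<in> hom1 (CAlg k) A D"
    using fg' by (simp add: hom1_CAlg cell_rules)
  show "id2 (CAlg k) g \<star>\<^bsub>CAlg k\<^esub> id2 (CAlg k) f = id2 (CAlg k) (g \<diamondop>\<^bsub>CAlg k\<^esub> f)"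
    using fg' by (intro cospan_comp_mor_eqI) (simp_all add: cell_rules)
  {
    fix f' g' \<sigma> \<tau>
    assume "\<sigma> \<in> hom2 (CAlg k) f f'" "\<tau> \<in> hom2 (CAlg k) g g'"
    note * = this[THEN hom2_CAlgD(1)] this[THEN hom2_CAlgD(2)] this[THEN hom2_CAlgD(3)]
    show "\<tau> \<star>\<^bsub>CAlg k\<^esub> \<sigma> \<in> hom2 (CAlg k) (g \<diamondop>\<^bsub>CAlg k\<^esub> f) (g' \<diamondop>\<^bsub>CAlg k\<^esub> f')"
      using * fg' by (simp add: hom2_CAlg cell_rules)
  }
  {
    fix f' f'' g' g'' \<sigma> \<sigma>' \<tau> \<tau>'
    assume cells: "\<sigma> \<in> hom2 (CAlg k) f f'" "\<sigma>' \<in> hom2 (CAlg k) f' f''"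
      "\<tau> \<in> hom2 (CAlg k) g g'" "\<tau>' \<in> hom2 (CAlg k) g' g''"
    note * = cells[THEN hom2_CAlgD(1)] cells[THEN hom2_CAlgD(2)] cells[THEN hom2_CAlgD(3)]
      cells[THEN hom2_CAlgD(4)] cells[THEN hom2_CAlgD(5)] cells[THEN hom2_CAlgD(6)]
    show "(\<tau>' \<bullet>\<^bsub>CAlg k\<^esub> \<tau>) \<star>\<^bsub>CAlg k\<^esub> (\<sigma>' \<bullet>\<^bsub>CAlg k\<^esub> \<sigma>)
        = (\<tau>' \<star>\<^bsub>CAlg k\<^esub> \<sigma>') \<bullet>\<^bsub>CAlg k\<^esub> (\<tau> \<star>\<^bsub>CAlg k\<^esub> \<sigma>)"
      using * fg' by (intro cospan_comp_mor_eqI) (simp_all add: cell_rules)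
  }
  \<comment> \<open>On \<open>(t \<otimes> b) \<otimes> s\<close> the sides give
    \<open>t \<otimes> (lleg f b) s\<close> and \<open>t (rleg g b) \<otimes> s\<close>: the
    triangle is the balancing relation over \<open>B\<close>.\<close>
  show "(id2 (CAlg k) g \<star>\<^bsub>CAlg k\<^esub> lunitor (CAlg k) f) \<bullet>\<^bsub>CAlg k\<^esub> associator (CAlg k) g (id1 (CAlg k) B) f
      = runitor (CAlg k) g \<star>\<^bsub>CAlg k\<^esub> id2 (CAlg k) f"
  proof -
    have B: "algebra k B" using is_cospanD(2)[OF fg'(1)] fg' by simp
    interpret T: composable3 k g "cospan_id B" f
      using fg' B by (intro composable3I) (simp_all add: is_cospan_id)
    show ?thesis
      using fg' B by (intro T.cospan_comp3_mor_eqI) (simp_all add: cell_rules pure_balanced)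
  qed
next
  fix f g h :: "('k, 'u) cospan" and A B D E
  assume fgh: "f \<in> hom1 (CAlg k) A B" "g \<in> hom1 (CAlg k) B D" "h \<in> hom1 (CAlg k) D E"
  then have fgh': "is_cospan k f" "is_cospan k g" "is_cospan k h" "csrc f = A" "ctrg f = B"
      "csrc g = B" "ctrg g = D" "csrc h = D" "ctrg h = E"
    by (simp_all add: hom1_CAlg)
  interpret composable3 k h g f
    using fgh' by (intro composable3I) simp_all
  show "associator (CAlg k) h g f
      \<in> iso2 (CAlg k) ((h \<diamondop>\<^bsub>CAlg k\<^esub> g) \<diamondop>\<^bsub>CAlg k\<^esub> f) (h \<diamondop>\<^bsub>CAlg k\<^esub> g \<diamondop>\<^bsub>CAlg k\<^esub> f)"
    by (rule iso2_CAlgI) (simp_all add: is_cospan_mor_assoc bij_assoc)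
  {
    fix f' g' h' \<rho> \<sigma> \<tau>
    assume cells: "\<rho> \<in> hom2 (CAlg k) f f'" "\<sigma> \<in> hom2 (CAlg k) g g'" "\<tau> \<in> hom2 (CAlg k) h h'"
    note * = cells[THEN hom2_CAlgD(1)] cells[THEN hom2_CAlgD(2)] cells[THEN hom2_CAlgD(3)]
      cells[THEN hom2_CAlgD(4)] cells[THEN hom2_CAlgD(5)] cells[THEN hom2_CAlgD(6)]
    show "associator (CAlg k) h' g' f' \<bullet>\<^bsub>CAlg k\<^esub> ((\<tau> \<star>\<^bsub>CAlg k\<^esub> \<sigma>) \<star>\<^bsub>CAlg k\<^esub> \<rho>)
        = (\<tau> \<star>\<^bsub>CAlg k\<^esub> \<sigma> \<star>\<^bsub>CAlg k\<^esub> \<rho>) \<bullet>\<^bsub>CAlg k\<^esub> associator (CAlg k) h g f"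
      using * fgh' by (intro cospan_comp3_mor_eqI) (simp_all add: cell_rules)
  }
  {
    fix i G
    assume "i \<in> hom1 (CAlg k) E G"
    then have i: "is_cospan k i" "csrc i = E" "ctrg i = G"
      by (simp_all add: hom1_CAlg)
    interpret P: composable3 k "cospan_comp i h" g f
      using fgh' i by (intro composable3I) (simp_all add: cell_rules)
    interpret Q: composable3 k i h g
      using fgh' i by (intro composable3I) (simp_all add: cell_rules)
    let ?l = "cospan_mor_comp (cospan_hcomp k (cospan_mor_id i) (cospan_assoc k h g f))
      (cospan_mor_comp (cospan_assoc k i (cospan_comp h g) f)
        (cospan_hcomp k (cospan_assoc k i h g) (cospan_mor_id f)))"
    let ?r = "cospan_mor_comp (cospan_assoc k i h (cospan_comp g f)) (cospan_assoc k (cospan_comp i h) g f)"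
    \<comment> \<open>The source is a fourfold composite. It is treated as a triple one with first
      factor \<open>cospan_comp i h\<close>, whose elements are decomposed by a further
      induction.\<close>
    have "?l = ?r"
    proof (rule P.cospan_comp3_mor_eqI)
      show l: "is_cospan_mor k ?l" and r: "is_cospan_mor k ?r"
        using fgh' i by (simp_all add: cell_rules)
      fix w t s assume "w \<in> carrier (apex (cospan_comp i h))"
        and ts: "t \<in> carrier (apex g)" "s \<in> carrier (apex f)"
      then have "w \<in> carrier (ctensor i h)" by simp
      then show "mfun ?l (P.ltriple w t s) = mfun ?r (P.ltriple w t s)"
      proof (induction w rule: Q.WX.tensor_induct)
        case (pure v u)
        then show ?case
          using fgh' i ts by (simp add: cell_rules)
      next
        \<comment> \<open>Both composites stay folded here, so that their own additivity applies
          instead of an evaluation step by step.\<close>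
        case (add x y)
        then show ?case
          using ts alg_homD(4)[OF is_cospan_morD(5)[OF l]] alg_homD(4)[OF is_cospan_morD(5)[OF r]]
          by (simp add: P.WX.pure_add_left[unfolded cospan_comp_simps]
              P.WX.pure_closed[unfolded cospan_comp_simps] P.L_simps del: cospan_mor_comp_simps(3))
      qed
    qed simp_all
    then show "(id2 (CAlg k) i \<star>\<^bsub>CAlg k\<^esub> associator (CAlg k) h g f) \<bullet>\<^bsub>CAlg k\<^esub>
        associator (CAlg k) i (h \<diamondop>\<^bsub>CAlg k\<^esub> g) f \<bullet>\<^bsub>CAlg k\<^esub>
        (associator (CAlg k) i h g \<star>\<^bsub>CAlg k\<^esub> id2 (CAlg k) f)
      = associator (CAlg k) i h (g \<diamondop>\<^bsub>CAlg k\<^esub> f) \<bullet>\<^bsub>CAlg k\<^esub>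
        associator (CAlg k) (i \<diamondop>\<^bsub>CAlg k\<^esub> h) g f"
      by simp
  }
next
  fix f :: "('k, 'u) cospan" and A B
  assume "f \<in> hom1 (CAlg k) A B"
  then have f: "is_cospan k f" "csrc f = A" "ctrg f = B"
    by (simp_all add: hom1_CAlg)
  then have AB: "algebra k A" "algebra k B"
    using is_cospanD[of k f] by simp_all
  interpret l: composable k "cospan_id B" f
    using f AB by (intro composableI) (simp_all add: is_cospan_id)
  interpret r: composable k f "cospan_id A"
    using f AB by (intro composableI) (simp_all add: is_cospan_id)
  show "lunitor (CAlg k) f \<in> iso2 (CAlg k) (id1 (CAlg k) B \<diamondop>\<^bsub>CAlg k\<^esub> f) f"
    by (rule iso2_CAlgI) (use f bij_lunitor[of k f] in \<open>simp_all add: is_cospan_mor_lunitor\<close>)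
  show "runitor (CAlg k) f \<in> iso2 (CAlg k) (f \<diamondop>\<^bsub>CAlg k\<^esub> id1 (CAlg k) A) f"
    by (rule iso2_CAlgI) (use f bij_runitor[of k f] in \<open>simp_all add: is_cospan_mor_runitor\<close>)
  {
    fix f' \<sigma>
    assume \<sigma>: "\<sigma> \<in> hom2 (CAlg k) f f'"
    note * = hom2_CAlgD[OF \<sigma>]
    \<comment> \<open>Naturality of the unitors: \<open>\<sigma>\<close> is multiplicative and
      preserves legs, so it sends the product of \<open>lleg f b\<close> and \<open>t\<close> to
      that of \<open>lleg f' b\<close> and \<open>\<sigma> t\<close>, and likewise on the
      right.\<close>
    note hom = alg_homD(3)[OF is_cospan_morD(5)[OF *(1)]] is_cospan_morD(6,7)[OF *(1)]
    show "lunitor (CAlg k) f' \<bullet>\<^bsub>CAlg k\<^esub> (id2 (CAlg k) (id1 (CAlg k) B) \<star>\<^bsub>CAlg k\<^esub> \<sigma>)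
        = \<sigma> \<bullet>\<^bsub>CAlg k\<^esub> lunitor (CAlg k) f"
      using * f AB hom by (intro l.cospan_comp_mor_eqI) (simp_all add: cell_rules)
    show "runitor (CAlg k) f' \<bullet>\<^bsub>CAlg k\<^esub> (\<sigma> \<star>\<^bsub>CAlg k\<^esub> id2 (CAlg k) (id1 (CAlg k) A))
        = \<sigma> \<bullet>\<^bsub>CAlg k\<^esub> runitor (CAlg k) f"
      using * f AB hom by (intro r.cospan_comp_mor_eqI) (simp_all add: cell_rules)
  }
qed

end

section \<open>The bicategory of algebras\<close>

lemma Alg_simps [simp]:
  "objs (Alg k) = {A. assoc_algebra k A}"
  "arrs (Alg k) = {f. assoc_algebra k (hsrc f) \<and> assoc_algebra k (htrg f)
    \<and> hfun f \<in> alg_hom k (hsrc f) (htrg f)}"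
  "asrc (Alg k) = hsrc" "atrg (Alg k) = htrg"
  "cells (Alg k) = arrs (Alg k)" "cdom (Alg k) = (\<lambda>f. f)" "ccod (Alg k) = (\<lambda>f. f)"
  "id1 (Alg k) = alg_id" "comp1 (Alg k) = alg_comp" "id2 (Alg k) = (\<lambda>f. f)"
  "vcomp (Alg k) = (\<lambda>\<tau> \<sigma>. \<sigma>)" "hcomp (Alg k) = alg_comp"
  "associator (Alg k) = (\<lambda>h g f. alg_comp (alg_comp h g) f)"
  "lunitor (Alg k) = (\<lambda>f. f)" "runitor (Alg k) = (\<lambda>f. f)"
  by (simp_all add: Alg_def Let_def)

lemma hom1_Alg: "f \<in> hom1 (Alg k) A B \<longleftrightarrow> assoc_algebra k A \<and> assoc_algebra k B
    \<and> hfun f \<in> alg_hom k A B \<and> hsrc f = A \<and> htrg f = B"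
  by (auto simp: hom1_def)

lemma hom2_Alg: "\<sigma> \<in> hom2 (Alg k) f g \<longleftrightarrow> f \<in> arrs (Alg k) \<and> \<sigma> = f \<and> g = f"
  by (auto simp: hom2_def)

lemma iso2_Alg: "\<sigma> \<in> iso2 (Alg k) f g \<longleftrightarrow> f \<in> arrs (Alg k) \<and> \<sigma> = f \<and> g = f"
  by (auto simp: iso2_def hom2_Alg)

lemma alg_comp_simps [simp]:
  "hsrc (alg_comp g f) = hsrc f" "htrg (alg_comp g f) = htrg g"
  by (simp_all add: alg_comp_def)

lemma alg_comp_hom1:
  "f \<in> hom1 (Alg k) A B \<Longrightarrow> g \<in> hom1 (Alg k) B C \<Longrightarrow> alg_comp g f \<in> hom1 (Alg k) A C"
  using alg_hom_compose[of "hfun f" k A B "hfun g" C] by (simp add: hom1_Alg alg_comp_def)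

lemma alg_id_hom1: "assoc_algebra k A \<Longrightarrow> alg_id A \<in> hom1 (Alg k) A A"
  using alg_hom_id[of k A] by (simp add: hom1_Alg alg_id_def)

text \<open>Composites are restricted to carriers, so strict associativity uses that
  \<open>f\<close> maps into the carrier on which the inner composite is defined.\<close>

lemma alg_comp_assoc:
  assumes "f \<in> hom1 (Alg k) A B" "g \<in> hom1 (Alg k) B C" "h \<in> hom1 (Alg k) C D"
  shows "alg_comp (alg_comp h g) f = alg_comp h (alg_comp g f)"
proof -
  have "hfun f x \<in> carrier B" if "x \<in> carrier A" for x
    using assms(1) alg_homD(2) that by (auto simp: hom1_Alg)
  then show ?thesis
    using assms by (auto simp: alg_comp_def compose_def hom1_Alg)
qed

text \<open>Identities are strict because a homomorphism is \<open>undefined\<close> outside its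
  carrier, so that restricting it again changes nothing.\<close>

lemma
  assumes "f \<in> hom1 (Alg k) A B"
  shows alg_comp_id_left: "alg_comp (alg_id B) f = f"
    and alg_comp_id_right: "alg_comp f (alg_id A) = f"
proof -
  have "hfun f x \<in> carrier B" if "x \<in> carrier A" for x
    using assms alg_homD(2) that by (auto simp: hom1_Alg)
  moreover have "hfun f \<in> extensional (carrier A)"
    using assms alg_homD(1) by (auto simp: hom1_Alg)
  ultimately have "compose (carrier A) (\<lambda>x \<in> carrier B. x) (hfun f) = hfun f"
    "compose (carrier A) (hfun f) (\<lambda>x \<in> carrier A. x) = hfun f"
    by (auto simp: compose_def extensional_def fun_eq_iff)
  then show "alg_comp (alg_id B) f = f" "alg_comp f (alg_id A) = f"
    using assms by (simp_all add: alg_comp_def alg_id_def hom1_Alg)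
qed

lemma hfun_alg_id [simp]: "x \<in> carrier A \<Longrightarrow> hfun (alg_id A) x = x"
  by (simp add: alg_id_def)

lemma arrs_Alg_iff: "f \<in> arrs (Alg k) \<longleftrightarrow> f \<in> hom1 (Alg k) (hsrc f) (htrg f)"
  by (simp add: hom1_def)

lemma hom1_AlgD: "f \<in> hom1 (Alg k) A B \<Longrightarrow> f \<in> arrs (Alg k)"
  by (simp add: hom1_def del: Alg_simps(2))

text \<open>Composition is strictly associative and unital, so the structure cells are identities
  with the required endpoints, and naturality only compares a cell with itself.\<close>

lemma bicategory_Alg:
  "bicategory (Alg k :: (('k, 'u::infinite) module, ('k, 'u) alg_arrow, ('k, 'u) alg_arrow) bicat)"
proof
  fix f g h i :: "('k, 'u) alg_arrow" and A B D E G
  assume f: "f \<in> hom1 (Alg k) A B"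
  show "lunitor (Alg k) f \<in> iso2 (Alg k) (id1 (Alg k) B \<diamondop>\<^bsub>Alg k\<^esub> f) f"
    "runitor (Alg k) f \<in> iso2 (Alg k) (f \<diamondop>\<^bsub>Alg k\<^esub> id1 (Alg k) A) f"
    using hom1_AlgD[OF f] alg_comp_id_left[OF f] alg_comp_id_right[OF f]
    by (simp_all add: iso2_Alg del: Alg_simps(2))
  {
    fix f' \<sigma> assume "\<sigma> \<in> hom2 (Alg k) f f'"
    then show "lunitor (Alg k) f' \<bullet>\<^bsub>Alg k\<^esub> (id2 (Alg k) (id1 (Alg k) B) \<star>\<^bsub>Alg k\<^esub> \<sigma>)
        = \<sigma> \<bullet>\<^bsub>Alg k\<^esub> lunitor (Alg k) f"
      "runitor (Alg k) f' \<bullet>\<^bsub>Alg k\<^esub> (\<sigma> \<star>\<^bsub>Alg k\<^esub> id2 (Alg k) (id1 (Alg k) A))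
        = \<sigma> \<bullet>\<^bsub>Alg k\<^esub> runitor (Alg k) f"
      using alg_comp_id_left[OF f] alg_comp_id_right[OF f] by (simp_all add: hom2_Alg)
  }
  assume g: "g \<in> hom1 (Alg k) B D"
  note gf = alg_comp_hom1[OF f g]
  show "g \<diamondop>\<^bsub>Alg k\<^esub> f \<in> hom1 (Alg k) A D"
    "id2 (Alg k) g \<star>\<^bsub>Alg k\<^esub> id2 (Alg k) f = id2 (Alg k) (g \<diamondop>\<^bsub>Alg k\<^esub> f)"
    using gf by simp_all
  show "(id2 (Alg k) g \<star>\<^bsub>Alg k\<^esub> lunitor (Alg k) f) \<bullet>\<^bsub>Alg k\<^esub> associator (Alg k) g (id1 (Alg k) B) f
      = runitor (Alg k) g \<star>\<^bsub>Alg k\<^esub> id2 (Alg k) f"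
    using alg_comp_id_right[OF g] by simp
  {
    fix f' g' \<sigma> \<tau> assume "\<sigma> \<in> hom2 (Alg k) f f'" "\<tau> \<in> hom2 (Alg k) g g'"
    then show "\<tau> \<star>\<^bsub>Alg k\<^esub> \<sigma> \<in> hom2 (Alg k) (g \<diamondop>\<^bsub>Alg k\<^esub> f) (g' \<diamondop>\<^bsub>Alg k\<^esub> f')"
      using hom1_AlgD[OF gf] by (simp add: hom2_Alg del: Alg_simps(2))
  }
  {
    fix f' f'' g' g'' \<sigma> \<sigma>' \<tau> \<tau>'
    assume "\<sigma> \<in> hom2 (Alg k) f f'" "\<sigma>' \<in> hom2 (Alg k) f' f''"
      "\<tau> \<in> hom2 (Alg k) g g'" "\<tau>' \<in> hom2 (Alg k) g' g''"
    then show "(\<tau>' \<bullet>\<^bsub>Alg k\<^esub> \<tau>) \<star>\<^bsub>Alg k\<^esub> (\<sigma>' \<bullet>\<^bsub>Alg k\<^esub> \<sigma>)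
        = (\<tau>' \<star>\<^bsub>Alg k\<^esub> \<sigma>') \<bullet>\<^bsub>Alg k\<^esub> (\<tau> \<star>\<^bsub>Alg k\<^esub> \<sigma>)"
      by (simp add: hom2_Alg)
  }
  assume h: "h \<in> hom1 (Alg k) D E"
  note assoc = alg_comp_assoc[OF f g h]
  show "associator (Alg k) h g f \<in> iso2 (Alg k) ((h \<diamondop>\<^bsub>Alg k\<^esub> g) \<diamondop>\<^bsub>Alg k\<^esub> f) (h \<diamondop>\<^bsub>Alg k\<^esub> g \<diamondop>\<^bsub>Alg k\<^esub> f)"
    using hom1_AlgD[OF alg_comp_hom1[OF gf h]] by (simp add: iso2_Alg assoc del: Alg_simps(2))
  {
    fix f' g' h' \<rho> \<sigma> \<tau>
    assume "\<rho> \<in> hom2 (Alg k) f f'" "\<sigma> \<in> hom2 (Alg k) g g'" "\<tau> \<in> hom2 (Alg k) h h'"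
    then show "associator (Alg k) h' g' f' \<bullet>\<^bsub>Alg k\<^esub> ((\<tau> \<star>\<^bsub>Alg k\<^esub> \<sigma>) \<star>\<^bsub>Alg k\<^esub> \<rho>)
        = (\<tau> \<star>\<^bsub>Alg k\<^esub> \<sigma> \<star>\<^bsub>Alg k\<^esub> \<rho>) \<bullet>\<^bsub>Alg k\<^esub> associator (Alg k) h g f"
      by (simp add: hom2_Alg)
  }
  assume i: "i \<in> hom1 (Alg k) E G"
  \<comment> \<open>\<open>vcomp\<close> returns its right argument, so both sides are the arrow
    \<open>((i h) g) f\<close>.\<close>
  show "(id2 (Alg k) i \<star>\<^bsub>Alg k\<^esub> associator (Alg k) h g f) \<bullet>\<^bsub>Alg k\<^esub>
      associator (Alg k) i (h \<diamondop>\<^bsub>Alg k\<^esub> g) f \<bullet>\<^bsub>Alg k\<^esub> (associator (Alg k) i h g \<star>\<^bsub>Alg k\<^esub> id2 (Alg k) f)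
    = associator (Alg k) i h (g \<diamondop>\<^bsub>Alg k\<^esub> f) \<bullet>\<^bsub>Alg k\<^esub> associator (Alg k) (i \<diamondop>\<^bsub>Alg k\<^esub> h) g f"
    by simp
next
  fix A :: "('k, 'u) module" assume "A \<in> objs (Alg k)"
  then show "id1 (Alg k) A \<in> hom1 (Alg k) A A"
    by (simp add: alg_id_hom1)
qed (auto simp: hom2_Alg)

section \<open>Centralisers and the lax functor\<close>

text \<open>Zero and negatives come from scalars: zero is \<open>0 \<odot> 1\<close>, and
  \<open>-x\<close> is \<open>(-1) \<odot> x\<close>.\<close>

lemma assoc_algebra_restrict:
  assumes "assoc_algebra k B" and "S \<subseteq> carrier B" "\<one>\<^bsub>B\<^esub> \<in> S"
    and "\<And>x y. x \<in> S \<Longrightarrow> y \<in> S \<Longrightarrow> x \<otimes>\<^bsub>B\<^esub> y \<in> S"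
    and add: "\<And>x y. x \<in> S \<Longrightarrow> y \<in> S \<Longrightarrow> x \<oplus>\<^bsub>B\<^esub> y \<in> S"
    and smult: "\<And>c x. c \<in> carrier k \<Longrightarrow> x \<in> S \<Longrightarrow> c \<odot>\<^bsub>B\<^esub> x \<in> S"
  shows "assoc_algebra k (B\<lparr>carrier := S\<rparr>)"
proof -
  interpret B: assoc_algebra k B by (rule assms(1))
  have S [simp]: "x \<in> carrier B" if "x \<in> S" for x using assms(2) that by blast
  have "\<zero>\<^bsub>k\<^esub> \<odot>\<^bsub>B\<^esub> \<one>\<^bsub>B\<^esub> \<in> S"
    using assms(3) by (intro smult) simp_all
  then have zero: "\<zero>\<^bsub>B\<^esub> \<in> S" by simp
  have minus: "\<ominus>\<^bsub>B\<^esub> x \<in> S" if "x \<in> S" for x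
  proof -
    have "(\<ominus>\<^bsub>k\<^esub> \<one>\<^bsub>k\<^esub>) \<odot>\<^bsub>B\<^esub> x \<in> S"
      using that by (intro smult) simp_all
    then show ?thesis
      using that by (simp add: B.smult_l_minus)
  qed
  have ab: "abelian_group (B\<lparr>carrier := S\<rparr>)"
    by (rule abelian_groupI) (auto simp: zero add B.a_ac B.l_neg B.r_neg intro!: bexI[OF _ minus])
  have "monoid (B\<lparr>carrier := S\<rparr>)"
    by (rule monoidI) (simp_all add: assms(3,4) B.m_assoc)
  moreover have "Module.module k (B\<lparr>carrier := S\<rparr>)"
    by (rule moduleI)
      (simp_all add: ab B.R.cring_axioms smult B.smult_l_distr B.smult_r_distr B.smult_assoc1)
  ultimately show ?thesis
    using ab
    by (intro assoc_algebra.intro assoc_algebra_axioms.intro ring.intro ring_axioms.intro)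
      (simp_all add: B.l_distr B.r_distr B.smult_mult_left B.smult_mult_right)
qed

lemma algebra_of_commutative:
  assumes "assoc_algebra k A"
    and "\<And>x y. x \<in> carrier A \<Longrightarrow> y \<in> carrier A \<Longrightarrow> x \<otimes>\<^bsub>A\<^esub> y = y \<otimes>\<^bsub>A\<^esub> x"
  shows "algebra k A"
proof -
  interpret assoc_algebra k A by (rule assms(1))
  show ?thesis
    by unfold_locales (rule assms(2) smult_mult_left; assumption)+
qed

section \<open>Centralisers and centres as algebras\<close>

lemma centraliserD:
  assumes "b \<in> centraliser A B f"
  shows "b \<in> carrier B" "a \<in> carrier A \<Longrightarrow> f a \<otimes>\<^bsub>B\<^esub> b = b \<otimes>\<^bsub>B\<^esub> f a"
  using assms by (auto simp: centraliser_def)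

lemma assoc_algebra_centraliser:
  assumes A: "assoc_algebra k A" and B: "assoc_algebra k B" and f: "f \<in> alg_hom k A B"
  shows "assoc_algebra k (centraliser_alg A B f)"
proof -
  interpret A: assoc_algebra k A by (rule A)
  interpret B: assoc_algebra k B by (rule B)
  note hf [simp] = alg_homD(2)[OF f]
  show ?thesis
    unfolding centraliser_alg_def
  proof (rule assoc_algebra_restrict[OF B])
    fix x y assume xy: "x \<in> centraliser A B f" "y \<in> centraliser A B f"
    note xy' = centraliserD[OF xy(1)] centraliserD[OF xy(2)]
    have "f a \<otimes>\<^bsub>B\<^esub> (x \<otimes>\<^bsub>B\<^esub> y) = (x \<otimes>\<^bsub>B\<^esub> y) \<otimes>\<^bsub>B\<^esub> f a" if a: "a \<in> carrier A" for a
    proof -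
      have "f a \<otimes>\<^bsub>B\<^esub> (x \<otimes>\<^bsub>B\<^esub> y) = x \<otimes>\<^bsub>B\<^esub> f a \<otimes>\<^bsub>B\<^esub> y"
        using a xy'(1,3) xy'(2)[OF a] by (simp add: B.m_assoc[symmetric])
      then show ?thesis
        using a xy'(1,3) xy'(4)[OF a] by (simp add: B.m_assoc)
    qed
    then show "x \<otimes>\<^bsub>B\<^esub> y \<in> centraliser A B f"
      using xy' by (simp add: centraliser_def)
    show "x \<oplus>\<^bsub>B\<^esub> y \<in> centraliser A B f"
      using xy' by (simp add: centraliser_def B.l_distr B.r_distr)
  next
    fix c x assume "c \<in> carrier k" "x \<in> centraliser A B f"
    then show "c \<odot>\<^bsub>B\<^esub> x \<in> centraliser A B f"
      by (simp add: centraliser_def B.smult_mult_left B.smult_mult_right)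
  qed (auto simp: centraliser_def)
qed

text \<open>Lets the centre inherit its algebra structure from centralisers, and identifies the apex
  of \<open>centre_cospan\<close> at an identity.\<close>

lemma centre_eq_centraliser: "centre A = centraliser A A (\<lambda>x \<in> carrier A. x)"
  by (auto simp: centre_def centraliser_def)

lemma algebra_centre:
  fixes k :: "'k ring"
  assumes "assoc_algebra k A" shows "algebra k (centre_alg A)"
proof (rule algebra_of_commutative)
  have "centre_alg A = centraliser_alg A A (\<lambda>x \<in> carrier A. x)"
    by (simp add: centre_alg_def centraliser_alg_def centre_eq_centraliser)
  then show "assoc_algebra k (centre_alg A)"
    using assoc_algebra_centraliser[OF assms assms alg_hom_id[OF assms]] by simp
next
  fix x y assume "x \<in> carrier (centre_alg A)" "y \<in> carrier (centre_alg A)"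
  then have "x \<in> carrier A" "y \<in> centre A"
    by (simp_all add: centre_alg_def centre_def)
  then show "x \<otimes>\<^bsub>centre_alg A\<^esub> y = y \<otimes>\<^bsub>centre_alg A\<^esub> x"
    by (simp add: centre_alg_def) (simp add: centre_def)
qed

lemma centre_cospan_simps [simp]:
  "ctrg (centre_cospan f) = centre_alg (htrg f)" "csrc (centre_cospan f) = centre_alg (hsrc f)"
  "apex (centre_cospan f) = centraliser_alg (hsrc f) (htrg f) (hfun f)"
  "lleg (centre_cospan f) = (\<lambda>z \<in> centre (htrg f). z)"
  "rleg (centre_cospan f) = restrict (hfun f) (centre (hsrc f))"
  by (simp_all add: centre_cospan_def)

lemma sub_alg_simps [simp]:
  "carrier (centre_alg A) = centre A" "mult (centre_alg A) = mult A" "one (centre_alg A) = one A"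
  "add (centre_alg A) = add A" "smult (centre_alg A) = smult A"
  "carrier (centraliser_alg A B f) = centraliser A B f" "mult (centraliser_alg A B f) = mult B"
  "one (centraliser_alg A B f) = one B" "add (centraliser_alg A B f) = add B"
  "smult (centraliser_alg A B f) = smult B"
  by (simp_all add: centre_alg_def centraliser_alg_def)

text \<open>For central \<open>z\<close> in \<open>A\<close> the element \<open>f z\<close> commutes
  with all \<open>f a\<close>, so it lies in the centraliser; it is central there because the
  centraliser commutes with the image of \<open>f\<close> by definition. Central elements of
  \<open>B\<close> commute with everything.\<close>

lemma is_cospan_centre:
  assumes f: "f \<in> hom1 (Alg k) A B"
  shows "is_cospan k (centre_cospan f)"
proof -
  from f have A: "assoc_algebra k A" and B: "assoc_algebra k B" and hf: "hfun f \<in> alg_hom k A B"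
    and [simp]: "hsrc f = A" "htrg f = B"
    by (simp_all add: hom1_Alg)
  interpret A: assoc_algebra k A by (rule A)
  interpret B: assoc_algebra k B by (rule B)
  interpret ZA: algebra k "centre_alg A" by (rule algebra_centre[OF A])
  interpret ZB: algebra k "centre_alg B" by (rule algebra_centre[OF B])
  note [simp] = ZA.m_closed[simplified] ZB.m_closed[simplified] ZA.add.m_closed[simplified]
    ZB.add.m_closed[simplified] ZA.one_closed[simplified] ZB.one_closed[simplified]
    ZA.smult_closed[simplified] ZB.smult_closed[simplified]
  have cen: "z \<in> carrier A" if "z \<in> centre A" for z
    using that by (simp add: centre_def)
  have r: "hfun f z \<in> centraliser A B (hfun f)" if "z \<in> centre A" for z
    using that alg_homD(2,3)[OF hf] unfolding centre_def centraliser_def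
    by clarsimp metis
  have l: "z \<in> centraliser A B (hfun f)" if "z \<in> centre B" for z
    using that alg_homD(2)[OF hf] by (simp add: centraliser_def centre_def)
  have "(\<lambda>z \<in> centre B. z) \<in> alg_hom k (centre_alg B) (centraliser_alg A B (hfun f))"
    by (rule alg_homI) (simp_all add: l)
  moreover have "restrict (hfun f) (centre A) \<in> alg_hom k (centre_alg A) (centraliser_alg A B (hfun f))"
    by (rule alg_homI) (simp_all add: r cen alg_homD[OF hf])
  moreover have "(\<lambda>z \<in> centre B. z) ` centre B \<subseteq> centre (centraliser_alg A B (hfun f))"
    using l by (auto simp: centre_def[of "centraliser_alg A B _"]) (auto simp: centre_def centraliser_def)
  moreover have "restrict (hfun f) (centre A) ` centre A \<subseteq> centre (centraliser_alg A B (hfun f))"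
    using r cen by (auto simp: centre_def[of "centraliser_alg A B _"] centraliserD(2))
  ultimately show ?thesis
    using assoc_algebra_centraliser[OF A B hf] algebra_centre[OF A] algebra_centre[OF B]
    by (simp add: is_cospan_def)
qed

lemma centre_cospan_id: "centre_cospan (alg_id A) = cospan_id (centre_alg A)"
proof -
  have "restrict (\<lambda>x \<in> carrier A. x) (centre A) = (\<lambda>x \<in> centre A. x)"
    by (rule restrict_ext) (simp add: centre_def)
  then show ?thesis
    by (simp add: centre_cospan_def cospan_id_def alg_id_def centre_alg_def centraliser_alg_def
        flip: centre_eq_centraliser)
qed

text \<open>Balancing over the centre of \<open>B\<close> comes from multiplicativity of
  \<open>g\<close>: \<open>(u (g b)) (g v) = u (g (b v))\<close>. The legs are preserved because
  \<open>z (g 1) = z\<close> and \<open>1 (g (f a)) = g (f a)\<close>.\<close>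

lemma
  fixes f g :: "('k, 'u::infinite) alg_arrow"
  assumes f: "f \<in> hom1 (Alg k) A B" and g: "g \<in> hom1 (Alg k) B C"
  shows is_cospan_mor_centre_mult: "is_cospan_mor k (centre_mult k g f)"
    and mfun_centre_mult: "\<And>u v. u \<in> centraliser B C (hfun g) \<Longrightarrow> v \<in> centraliser A B (hfun f) \<Longrightarrow>
      mfun (centre_mult k g f) (ptensor (centre_cospan g) (centre_cospan f) u v) = u \<otimes>\<^bsub>C\<^esub> hfun g v"
    and centre_mult_closed: "\<And>u v. u \<in> centraliser B C (hfun g) \<Longrightarrow> v \<in> centraliser A B (hfun f) \<Longrightarrow>
      u \<otimes>\<^bsub>C\<^esub> hfun g v \<in> centraliser A C (hfun (alg_comp g f))"
proof -
  note gf = alg_comp_hom1[OF f g]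
  from f g have A: "assoc_algebra k A" and B: "assoc_algebra k B" and C: "assoc_algebra k C"
    and hf: "hfun f \<in> alg_hom k A B" and hg: "hfun g \<in> alg_hom k B C"
    and [simp]: "hsrc f = A" "htrg f = B" "hsrc g = B" "htrg g = C"
    by (simp_all add: hom1_Alg)
  have hgf [simp]: "hfun (alg_comp g f) a = hfun g (hfun f a)" if "a \<in> carrier A" for a
    using that by (simp add: alg_comp_def compose_eq)
  interpret A: assoc_algebra k A by (rule A)
  interpret B: assoc_algebra k B by (rule B)
  interpret C: assoc_algebra k C by (rule C)
  interpret c: composable k "centre_cospan g" "centre_cospan f"
    by (intro composable.intro is_cospan_centre[OF f] is_cospan_centre[OF g]) simp
  note Zgf = is_cospanD[OF is_cospan_centre[OF gf]]
  note hf' [simp] = alg_homD(2-)[OF hf] and hg' [simp] = alg_homD(2-)[OF hg]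
  have cenB: "b \<in> carrier B" if "b \<in> centre B" for b
    using that by (simp add: centre_def)
  show closed: "u \<otimes>\<^bsub>C\<^esub> hfun g v \<in> centraliser A C (hfun (alg_comp g f))"
    if u: "u \<in> centraliser B C (hfun g)" and v: "v \<in> centraliser A B (hfun f)" for u v
  proof -
    note [simp] = centraliserD(1)[OF u] centraliserD(1)[OF v]
    \<comment> \<open>\<open>g (f a)\<close> passes \<open>u\<close>, which centralises
      \<open>g\<close>, and then passes \<open>g v\<close>, because \<open>v\<close> commutes with
      \<open>f a\<close> in \<open>B\<close>.\<close>
    have "hfun g (hfun f a) \<otimes>\<^bsub>C\<^esub> (u \<otimes>\<^bsub>C\<^esub> hfun g v) = u \<otimes>\<^bsub>C\<^esub> hfun g v \<otimes>\<^bsub>C\<^esub> hfun g (hfun f a)"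
      if a: "a \<in> carrier A" for a
    proof -
      have "hfun g (hfun f a) \<otimes>\<^bsub>C\<^esub> (u \<otimes>\<^bsub>C\<^esub> hfun g v) = u \<otimes>\<^bsub>C\<^esub> hfun g (hfun f a) \<otimes>\<^bsub>C\<^esub> hfun g v"
        using a centraliserD(2)[OF u, of "hfun f a"] by (simp add: C.m_assoc[symmetric])
      also have "\<dots> = u \<otimes>\<^bsub>C\<^esub> hfun g (hfun f a \<otimes>\<^bsub>B\<^esub> v)"
        using a by (simp add: C.m_assoc)
      also have "\<dots> = u \<otimes>\<^bsub>C\<^esub> hfun g v \<otimes>\<^bsub>C\<^esub> hfun g (hfun f a)"
        using a centraliserD(2)[OF v a] by (simp add: C.m_assoc)
      finally show ?thesis .
    qed
    then show ?thesis
      by (simp add: centraliser_def)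
  qed
  have swap: "(u \<otimes>\<^bsub>C\<^esub> u') \<otimes>\<^bsub>C\<^esub> (hfun g v \<otimes>\<^bsub>C\<^esub> hfun g v') = (u \<otimes>\<^bsub>C\<^esub> hfun g v) \<otimes>\<^bsub>C\<^esub> (u' \<otimes>\<^bsub>C\<^esub> hfun g v')"
    if "u \<in> centraliser B C (hfun g)" and u': "u' \<in> centraliser B C (hfun g)"
      and "v \<in> centraliser A B (hfun f)" "v' \<in> centraliser A B (hfun f)" for u u' v v'
  proof -
    note [simp] = that[THEN centraliserD(1)]
    have "u' \<otimes>\<^bsub>C\<^esub> (hfun g v \<otimes>\<^bsub>C\<^esub> hfun g v') = hfun g v \<otimes>\<^bsub>C\<^esub> (u' \<otimes>\<^bsub>C\<^esub> hfun g v')"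
      using centraliserD(2)[OF u', of v] by (simp add: C.m_assoc[symmetric])
    then show ?thesis by (simp add: C.m_assoc)
  qed
  have bal: "balanced_hom k (csrc (centre_cospan g)) (apex (centre_cospan g)) (rleg (centre_cospan g))
      (apex (centre_cospan f)) (lleg (centre_cospan f)) (apex (centre_cospan (alg_comp g f)))
      (\<lambda>u v. u \<otimes>\<^bsub>C\<^esub> hfun g v)"
    unfolding balanced_hom_def
    by (intro conjI ballI)
      (simp_all add: closed centraliserD(1) cenB C.l_distr C.r_distr C.smult_mult_left swap,
       simp_all add: C.m_assoc centraliserD(1) cenB)
  have mult_eq: "mfun (centre_mult k g f) = tensor_ind k (centre_cospan g) (centre_cospan f)
      (apex (centre_cospan (alg_comp g f))) (\<lambda>u v. u \<otimes>\<^bsub>C\<^esub> hfun g v)"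
    by (simp add: centre_mult_def)
  note ind = c.tensor_ind[OF Zgf(3) bal, folded mult_eq]
  show *: "mfun (centre_mult k g f) (ptensor (centre_cospan g) (centre_cospan f) u v) = u \<otimes>\<^bsub>C\<^esub> hfun g v"
    if "u \<in> centraliser B C (hfun g)" "v \<in> centraliser A B (hfun f)" for u v
    using ind(2)[of u v] that by simp
  have one: "\<one>\<^bsub>B\<^esub> \<in> centraliser A B (hfun f)" "\<one>\<^bsub>C\<^esub> \<in> centraliser B C (hfun g)"
    by (simp_all add: centraliser_def)
  have lr: "z \<in> centraliser B C (hfun g)" "z \<in> carrier C" if "z \<in> centre C" for z
    using that by (simp_all add: centraliser_def centre_def)
  have rr: "hfun f a \<in> centraliser A B (hfun f)" "a \<in> carrier A" if "a \<in> centre A" for a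
    using cospan_closed(2)[OF is_cospan_centre[OF f], of a] that by (simp_all add: centre_def)
  show "is_cospan_mor k (centre_mult k g f)"
    using ind(1) c.is_cospan_comp is_cospan_centre[OF gf]
    by (simp add: is_cospan_mor_def centre_mult_def[of k g f, THEN arg_cong[of _ _ mdom]]
        centre_mult_def[of k g f, THEN arg_cong[of _ _ mcod]] c.lleg_comp c.rleg_comp * one lr rr)
qed

section \<open>The lax functor axioms\<close>

lemma centre_mult_dom_cod [simp]:
  "mdom (centre_mult k g f) = cospan_comp (centre_cospan g) (centre_cospan f)"
  "mcod (centre_mult k g f) = centre_cospan (alg_comp g f)"
  by (simp_all add: centre_mult_def)

lemma centre_functor_simps [simp]:
  "omap (centre_functor k) = centre_alg" "amap (centre_functor k) = centre_cospan"
  "cmap (centre_functor k) = (\<lambda>f. cospan_mor_id (centre_cospan f))"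
  "lax_unit (centre_functor k) = (\<lambda>A. cospan_mor_id (cospan_id (centre_alg A)))"
  "lax_mult (centre_functor k) = centre_mult k"
  by (simp_all add: centre_functor_def)

lemma lax_functor_centre:
  "lax_functor (Alg k) (CAlg k)
    (centre_functor k :: (('k, 'u::infinite) module, ('k, 'u) alg_arrow, ('k, 'u) alg_arrow,
      ('k, 'u) module, ('k, 'u) cospan, ('k, 'u) cospan_mor) lax_data)"
proof (intro lax_functor.intro lax_functor_axioms.intro bicategory_Alg bicategory_CAlg)
  fix f g h :: "('k, 'u) alg_arrow" and A B C D
  let ?F = "centre_functor k"
  assume f: "f \<in> hom1 (Alg k) A B"
  note Zf = is_cospan_centre[OF f]
  have f' [simp]: "hsrc f = A" "htrg f = B" and A: "assoc_algebra k A" and B: "assoc_algebra k B"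
    using f by (simp_all add: hom1_Alg)
  show "amap ?F f \<in> hom1 (CAlg k) (omap ?F A) (omap ?F B)"
    using Zf by (simp add: hom1_CAlg)
  have idA: "alg_id A \<in> hom1 (Alg k) A A" and idB: "alg_id B \<in> hom1 (Alg k) B B"
    using A B by (simp_all add: alg_id_hom1)
  note ZA = is_cospan_centre[OF idA, unfolded centre_cospan_id]
    and ZB = is_cospan_centre[OF idB, unfolded centre_cospan_id]
  have cen: "b \<in> carrier B" "b \<in> centraliser B B (hfun (alg_id B))" if "b \<in> centre B" for b
    using that by (simp_all add: centre_def centraliser_def alg_id_def)
  have cen': "a \<in> carrier A" "a \<in> centraliser A A (hfun (alg_id A))" if "a \<in> centre A" for a
    using that by (simp_all add: centre_def centraliser_def alg_id_def)
  \<comment> \<open>Both sides send \<open>b \<otimes> s\<close> to the product \<open>b s\<close>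
    in \<open>B\<close>: for \<open>g\<close> an identity, \<open>u (g v)\<close> is
    \<open>u v\<close>, and the left leg is an inclusion.\<close>
  show "cmap ?F (lunitor (Alg k) f) \<bullet>\<^bsub>CAlg k\<^esub> lax_mult ?F (id1 (Alg k) B) f \<bullet>\<^bsub>CAlg k\<^esub>
      (lax_unit ?F B \<star>\<^bsub>CAlg k\<^esub> id2 (CAlg k) (amap ?F f)) = lunitor (CAlg k) (amap ?F f)"
  proof -
    interpret c: composable k "cospan_id (centre_alg B)" "centre_cospan f"
      using Zf ZB by (intro composableI) simp_all
    note m = is_cospan_mor_centre_mult[OF f idB] mfun_centre_mult[OF f idB, unfolded centre_cospan_id]
    have closed: "t \<otimes>\<^bsub>B\<^esub> s \<in> centraliser A B (hfun f)"
      if "t \<in> centre B" "s \<in> centraliser A B (hfun f)" for t s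
      using centre_mult_closed[OF f idB, of t s] that cen centraliserD(1)[OF that(2)]
      by (simp add: alg_comp_id_left[OF f])
    show ?thesis
      using Zf ZB m(1)
      by (intro c.cospan_comp_mor_eqI)
        (simp_all add: cell_rules centre_cospan_id alg_comp_id_left[OF f] m(2) closed cen centraliserD(1)[of _ A B])
  qed
  \<comment> \<open>Both sides send \<open>t \<otimes> a\<close> to \<open>t (f a)\<close>, the
    unitor because the right leg is a restriction of \<open>f\<close>.\<close>
  show "cmap ?F (runitor (Alg k) f) \<bullet>\<^bsub>CAlg k\<^esub> lax_mult ?F f (id1 (Alg k) A) \<bullet>\<^bsub>CAlg k\<^esub>
      (id2 (CAlg k) (amap ?F f) \<star>\<^bsub>CAlg k\<^esub> lax_unit ?F A) = runitor (CAlg k) (amap ?F f)"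
  proof -
    interpret c: composable k "centre_cospan f" "cospan_id (centre_alg A)"
      using Zf ZA by (intro composableI) simp_all
    note m = is_cospan_mor_centre_mult[OF idA f] mfun_centre_mult[OF idA f, unfolded centre_cospan_id]
      centre_mult_closed[OF idA f, unfolded alg_comp_id_right[OF f]]
    show ?thesis
      using Zf ZA m(1)
      by (intro c.cospan_comp_mor_eqI)
        (simp_all add: cell_rules centre_cospan_id alg_comp_id_right[OF f] m(2,3) cen')
  qed
  assume g: "g \<in> hom1 (Alg k) B C"
  note Zg = is_cospan_centre[OF g]
  have g' [simp]: "hsrc g = B" "htrg g = C" and C: "assoc_algebra k C"
    using g by (simp_all add: hom1_Alg)
  note gf = alg_comp_hom1[OF f g] and mgf = is_cospan_mor_centre_mult[OF f g]
  show "lax_mult ?F g f \<in> hom2 (CAlg k) (amap ?F g \<diamondop>\<^bsub>CAlg k\<^esub> amap ?F f) (amap ?F (g \<diamondop>\<^bsub>Alg k\<^esub> f))"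
    using mgf by (simp add: hom2_CAlg)
  {
    fix f' g' \<sigma> \<tau>
    assume "\<sigma> \<in> hom2 (Alg k) f f'" "\<tau> \<in> hom2 (Alg k) g g'"
    then have [simp]: "f' = f" "\<sigma> = f" "g' = g" "\<tau> = g"
      by (simp_all add: hom2_Alg)
    interpret c: composable k "centre_cospan g" "centre_cospan f"
      using Zf Zg by (intro composableI) simp_all
    show "lax_mult ?F g' f' \<bullet>\<^bsub>CAlg k\<^esub> (cmap ?F \<tau> \<star>\<^bsub>CAlg k\<^esub> cmap ?F \<sigma>)
        = cmap ?F (\<tau> \<star>\<^bsub>Alg k\<^esub> \<sigma>) \<bullet>\<^bsub>CAlg k\<^esub> lax_mult ?F g f"
      using Zf Zg mgf is_cospan_centre[OF gf]
      by (intro c.cospan_comp_mor_eqI)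
        (simp_all add: cell_rules mfun_centre_mult[OF f g] centre_mult_closed[OF f g])
  }
  assume h: "h \<in> hom1 (Alg k) C D"
  note Zh = is_cospan_centre[OF h]
  have h' [simp]: "hsrc h = C" "htrg h = D" and D: "assoc_algebra k D"
    and hh': "hfun h \<in> alg_hom k C D" and hg': "hfun g \<in> alg_hom k B C"
    using g h by (simp_all add: hom1_Alg)
  interpret D: assoc_algebra k D by (rule D)
  note hg = alg_comp_hom1[OF g h] and assoc = alg_comp_assoc[OF f g h]
  note m = is_cospan_mor_centre_mult[OF f g] is_cospan_mor_centre_mult[OF g h]
    is_cospan_mor_centre_mult[OF f hg] is_cospan_mor_centre_mult[OF gf h]
  note mf = mfun_centre_mult[OF f g] mfun_centre_mult[OF g h]
    mfun_centre_mult[OF f hg] mfun_centre_mult[OF gf h]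
    centre_mult_closed[OF f g] centre_mult_closed[OF g h]
    centre_mult_closed[OF f hg] centre_mult_closed[OF gf h]
  have hgv: "hfun (alg_comp h g) w = hfun h (hfun g w)" if "w \<in> carrier B" for w
    using that by (simp add: alg_comp_def compose_eq)
  \<comment> \<open>The cell \<open>cmap\<close> of the associator is an identity 2-cell and
    evaluates only on members of the centraliser. The membership is stated in the form reached after
    distributing \<open>h\<close> and reassociating.\<close>
  have closed: "u \<otimes>\<^bsub>D\<^esub> (hfun h t \<otimes>\<^bsub>D\<^esub> hfun h (hfun g s))
      \<in> centraliser A D (hfun (alg_comp h (alg_comp g f)))"
    if "u \<in> centraliser C D (hfun h)" "t \<in> centraliser B C (hfun g)" "s \<in> centraliser A B (hfun f)"
    for u t s
    using centre_mult_closed[OF gf h, of u "t \<otimes>\<^bsub>C\<^esub> hfun g s"] centre_mult_closed[OF f g, of t s] that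
      centraliserD(1)[OF that(2)] centraliserD(1)[OF that(3)]
    by (simp add: alg_homD(3)[OF hh'] alg_homD(2)[OF hg'])
  interpret c: composable3 k "centre_cospan h" "centre_cospan g" "centre_cospan f"
    using Zf Zg Zh by (intro composable3I) simp_all
  show "cmap ?F (associator (Alg k) h g f) \<bullet>\<^bsub>CAlg k\<^esub> lax_mult ?F (h \<diamondop>\<^bsub>Alg k\<^esub> g) f \<bullet>\<^bsub>CAlg k\<^esub>
      (lax_mult ?F h g \<star>\<^bsub>CAlg k\<^esub> id2 (CAlg k) (amap ?F f))
    = lax_mult ?F h (g \<diamondop>\<^bsub>Alg k\<^esub> f) \<bullet>\<^bsub>CAlg k\<^esub>
      (id2 (CAlg k) (amap ?F h) \<star>\<^bsub>CAlg k\<^esub> lax_mult ?F g f) \<bullet>\<^bsub>CAlg k\<^esub>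
      associator (CAlg k) (amap ?F h) (amap ?F g) (amap ?F f)"
    using Zf Zg Zh m is_cospan_centre[OF gf] is_cospan_centre[OF hg]
      is_cospan_centre[OF alg_comp_hom1[OF gf h]]
    by (intro c.cospan_comp3_mor_eqI)
      (simp_all add: cell_rules assoc mf[simplified assoc] closed hgv D.m_assoc alg_homD(2,3)[OF hh'] alg_homD(2)[OF hg'] centraliserD(1))
next
  fix f g :: "('k, 'u) alg_arrow" and \<sigma>
  assume "\<sigma> \<in> hom2 (Alg k) f g"
  then show "cmap (centre_functor k) \<sigma>
      \<in> hom2 (CAlg k) (amap (centre_functor k) f) (amap (centre_functor k) g)"
    using is_cospan_centre[of f k "hsrc f" "htrg f"]
    by (simp add: hom2_Alg hom2_CAlg is_cospan_mor_id arrs_Alg_iff del: Alg_simps(2))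
next
  fix A :: "('k, 'u) module" assume "A \<in> objs (Alg k)"
  then have A: "assoc_algebra k A" by simp
  show "omap (centre_functor k) A \<in> objs (CAlg k)"
    using algebra_centre[OF A] by simp
  show "lax_unit (centre_functor k) A \<in> hom2 (CAlg k) (id1 (CAlg k) (omap (centre_functor k) A))
      (amap (centre_functor k) (id1 (Alg k) A))"
    using is_cospan_id[OF algebra_centre[OF A]]
    by (simp add: hom2_CAlg centre_cospan_id is_cospan_mor_id)
next
  fix f :: "('k, 'u) alg_arrow"
  show "cmap (centre_functor k) (id2 (Alg k) f) = id2 (CAlg k) (amap (centre_functor k) f)"
    by simp
next
  fix f g h :: "('k, 'u) alg_arrow" and \<sigma> \<tau>
  assume "\<sigma> \<in> hom2 (Alg k) f g" "\<tau> \<in> hom2 (Alg k) g h"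
  then have [simp]: "\<sigma> = f" "\<tau> = f" and f: "f \<in> hom1 (Alg k) (hsrc f) (htrg f)"
    by (simp_all add: hom2_Alg arrs_Alg_iff del: Alg_simps(2))
  show "cmap (centre_functor k) (\<tau> \<bullet>\<^bsub>Alg k\<^esub> \<sigma>)
      = cmap (centre_functor k) \<tau> \<bullet>\<^bsub>CAlg k\<^esub> cmap (centre_functor k) \<sigma>"
    using is_cospan_centre[OF f] by (intro cospan_mor_eqI[of k]) (simp_all add: cell_rules)
qed

theorem theorem4p11:
  fixes k :: "'k ring"
  assumes "field k"
  shows "lax_functor (Alg k) (CAlg k)
           (centre_functor k ::
             (('k, 'u::infinite) module, ('k, 'u) alg_arrow, ('k, 'u) alg_arrow,
              ('k, 'u) module, ('k, 'u) cospan, ('k, 'u) cospan_mor) lax_data)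
       \<and> (\<forall>A \<in> objs (Alg k :: (('k, 'u) module, _, _) bicat).
            lax_unit (centre_functor k) A = id2 (CAlg k) (id1 (CAlg k) (omap (centre_functor k) A))
          \<and> amap (centre_functor k) (id1 (Alg k) A) = id1 (CAlg k) (omap (centre_functor k) A))
       \<and> (\<forall>A B C :: ('k, 'u) module.
            \<forall>f \<in> hom1 (Alg k) A B. \<forall>g \<in> hom1 (Alg k) B C.
            \<forall>u \<in> centraliser B C (hfun g). \<forall>v \<in> centraliser A B (hfun f).
              mfun (lax_mult (centre_functor k) g f)
                  (ptensor (amap (centre_functor k) g) (amap (centre_functor k) f) u v)
                = u \<otimes>\<^bsub>C\<^esub> hfun g v)"
proof (intro conjI ballI allI)
  show "lax_functor (Alg k) (CAlg k) (centre_functor k ::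
             (('k, 'u::infinite) module, ('k, 'u) alg_arrow, ('k, 'u) alg_arrow,
              ('k, 'u) module, ('k, 'u) cospan, ('k, 'u) cospan_mor) lax_data)"
    by (rule lax_functor_centre)
qed (simp_all add: centre_cospan_id mfun_centre_mult)

end
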